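(* Let $\bar H(x)=\sqrt{\frac32}\left(\frac{x}{|x|}\otimes\frac{x}{|x|}-\frac13 I\right)$ be the constant norm hedgehog on the unit ball $B_1\subset\mathbb{R}^3$. There exists a radial function $\xi\in C^\infty_c(B_1\setminus\{0\})$ such that for any $\bar v\in\mathbb{S}^4$, $\bar H$ is a critical point of $\mathcal{E}_0$ which is unstable along the vector field $\Phi:=\xi\bar v$, i.e., $\mathcal{E}_0''(\Phi;\bar H)<0$. As a consequence, for each $\lambda>0$ there exists a radial function $\xi_\lambda\in C^\infty_c(B_1\setminus\{0\})$ such that for any $\bar v\in\mathbb{S}^4$, $\bar H$ is a critical point of $\mathcal{E}_\lambda$ which is unstable along the vector field $\Phi_\lambda:=\xi_\lambda\bar v$, i.e., $\mathcal{E}_\lambda''(\Phi_\lambda;\bar H)<0$.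
   Context: $\mathcal{S}_0$ is the 5-dimensional space of real symmetric traceless $3\times 3$ matrices with inner product $P:Q=\mathrm{tr}(PQ)$ and norm $|Q|^2=\mathrm{tr}(Q^2)$; $\mathbb{S}^4=\{Q\in\mathcal{S}_0:|Q|=1\}$. The potential is $W(Q)=\frac{1}{4\sqrt6}|Q|^4-\frac13\mathrm{tr}(Q^3)+\frac{1}{12\sqrt6}$. For $\lambda\ge0$ and $Q\in W^{1,2}(B_1;\mathbb{S}^4)$, $\mathcal{E}_\lambda(Q)=\int_{B_1}\frac12|\nabla Q|^2+\lambda W(Q)\,dx$. A map $Q\in W^{1,2}(B_1;\mathbb{S}^4)$ is a critical point of $\mathcal{E}_\lambda$ if $\frac{d}{dt}\big|_{t=0}\mathcal{E}_\lambda\big(\frac{Q+t\Phi}{|Q+t\Phi|}\big)=0$ for every $\Phi\in C^1_c(B_1;\mathcal{S}_0)$. For $\Phi\in C_c^\infty(B_1;\mathcal{S}_0)$, the second variation is $$\mathcal{E}_\lambda''(\Phi;\bar H)=\left[\frac{d^2}{dt^2}\mathcal{E}_\lambda\left(\frac{\bar H+t\Phi}{|\bar H+t\Phi|}\right)\right]_{t=0}.$$ *)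

theory Defs
  imports "HOL-Analysis.Analysis"
begin

section \<open>Symmetric traceless matrices and the potential\<close>

text \<open>
  On \<open>real^3^3\<close> the library inner product and norm are the entrywise (Frobenius) ones. The two
  lemmas below show that on \<open>S0\<close> they are \<open>P : Q = tr (P Q)\<close> and \<open>|Q|^2 = tr (Q^2)\<close>.
\<close>

definition S0 :: "(real^3^3) set" where
  "S0 = {Q. transpose Q = Q \<and> trace Q = 0}"

definition S4 :: "(real^3^3) set" where
  "S4 = {Q \<in> S0. norm Q = 1}"

lemma inner_S0:
  assumes "P \<in> S0" "Q \<in> S0"
  shows "P \<bullet> Q = trace (P ** Q)"
proof -
  have "Q $ i $ j = Q $ j $ i" for i j
    using assms(2) unfolding S0_def transpose_def by (metis (mono_tags) mem_Collect_eq vec_lambda_beta)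
  then show ?thesis
    by (simp add: trace_def matrix_matrix_mult_def inner_vec_def)
qed

lemma norm_S0:
  assumes "Q \<in> S0"
  shows "(norm Q)\<^sup>2 = trace (Q ** Q)"
  using inner_S0[OF assms assms] by (simp add: power2_norm_eq_inner)

definition W :: "real^3^3 \<Rightarrow> real" where
  "W Q = 1 / (4 * sqrt 6) * norm Q ^ 4 - 1 / 3 * trace (Q ** Q ** Q) + 1 / (12 * sqrt 6)"

section \<open>Compactly supported test functions\<close>

primrec C_k :: "nat \<Rightarrow> ('a::euclidean_space \<Rightarrow> 'b::real_normed_vector) \<Rightarrow> bool" where
  "C_k 0 f \<longleftrightarrow> continuous_on UNIV f"
| "C_k (Suc k) f \<longleftrightarrow>
     (\<forall>x. f differentiable at x) \<and> (\<forall>v\<in>Basis. C_k k (\<lambda>x. frechet_derivative f (at x) v))"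

text \<open>
  The elements of \<open>C\<^sub>c\<^sup>k(\<Omega>; V)\<close>, with \<open>k\<close> possibly \<open>\<infinity>\<close>, are identified with their
  extensions by zero to the whole space.
\<close>

definition C_c :: "enat \<Rightarrow> 'a::euclidean_space set \<Rightarrow> 'b::real_normed_vector set \<Rightarrow> ('a \<Rightarrow> 'b) set" where
  "C_c k \<Omega> V = {f. (\<forall>m. enat m \<le> k \<longrightarrow> C_k m f) \<and>
     compact (closure {x. f x \<noteq> 0}) \<and> closure {x. f x \<noteq> 0} \<subseteq> \<Omega> \<and> (\<forall>x. f x \<in> V)}"

section \<open>Weak gradients and Sobolev maps\<close>

definition locally_integrable ::
    "'a::euclidean_space set \<Rightarrow> ('a \<Rightarrow> 'b::euclidean_space) \<Rightarrow> bool" where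
  "locally_integrable \<Omega> f \<longleftrightarrow> (\<forall>K. compact K \<and> K \<subseteq> \<Omega> \<longrightarrow> set_integrable lebesgue K f)"

definition square_integrable ::
    "'a::euclidean_space set \<Rightarrow> ('a \<Rightarrow> 'b::euclidean_space) \<Rightarrow> bool" where
  "square_integrable \<Omega> f \<longleftrightarrow>
     set_borel_measurable lebesgue \<Omega> f \<and> set_integrable lebesgue \<Omega> (\<lambda>x. (norm (f x))\<^sup>2)"

text \<open>
  A gradient is the vector of the partial derivatives, \<open>G x $ i\<close> being the \<open>i\<close>-th one, so that
  \<open>(norm (G x))\<^sup>2\<close> is the sum of their squared norms.
\<close>

definition has_weak_gradient ::
    "(real^'n \<Rightarrow> 'b::euclidean_space) \<Rightarrow> (real^'n \<Rightarrow> 'b^'n) \<Rightarrow> (real^'n) set \<Rightarrow> bool" where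
  "has_weak_gradient f G \<Omega> \<longleftrightarrow>
     locally_integrable \<Omega> f \<and> locally_integrable \<Omega> G \<and>
     (\<forall>\<phi> \<in> C_c \<infinity> \<Omega> (UNIV :: real set). \<forall>i.
        (\<integral>x\<in>\<Omega>. frechet_derivative \<phi> (at x) (axis i 1) *\<^sub>R f x \<partial>lebesgue) =
        - (\<integral>x\<in>\<Omega>. \<phi> x *\<^sub>R (G x $ i) \<partial>lebesgue))"

text \<open>
  Weak gradients are unique only up to null sets; \<open>weak_gradient\<close> chooses a representative and
  is only to be used inside integrals.
\<close>

definition weak_gradient ::
    "(real^'n) set \<Rightarrow> (real^'n \<Rightarrow> 'b::euclidean_space) \<Rightarrow> (real^'n \<Rightarrow> 'b^'n)" where
  "weak_gradient \<Omega> f = (SOME G. has_weak_gradient f G \<Omega>)"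

text \<open>\<open>W\<^sup>1\<^sup>,\<^sup>2(\<Omega>; N)\<close>: the constraint is imposed almost everywhere.\<close>

definition W12 :: "(real^'n) set \<Rightarrow> 'b::euclidean_space set \<Rightarrow> (real^'n \<Rightarrow> 'b) set" where
  "W12 \<Omega> N = {f. square_integrable \<Omega> f \<and>
     (\<exists>G. has_weak_gradient f G \<Omega> \<and> square_integrable \<Omega> G) \<and>
     (AE x in lebesgue. x \<in> \<Omega> \<longrightarrow> f x \<in> N)}"

section \<open>The energy and its variations\<close>

abbreviation B1 :: "(real^3) set" where
  "B1 \<equiv> ball 0 1"

text \<open>The energy is meaningful for \<open>Q \<in> W12 B1 S4\<close>.\<close>

definition energy :: "real \<Rightarrow> (real^3 \<Rightarrow> real^3^3) \<Rightarrow> real" where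
  "energy lam Q = (\<integral>x\<in>B1. (1 / 2 * (norm (weak_gradient B1 Q x))\<^sup>2 + lam * W (Q x)) \<partial>lebesgue)"

definition variation ::
    "(real^3 \<Rightarrow> real^3^3) \<Rightarrow> (real^3 \<Rightarrow> real^3^3) \<Rightarrow> real \<Rightarrow> real^3 \<Rightarrow> real^3^3" where
  "variation Q \<Phi> t x = (1 / norm (Q x + t *\<^sub>R \<Phi> x)) *\<^sub>R (Q x + t *\<^sub>R \<Phi> x)"

definition critical_point :: "real \<Rightarrow> (real^3 \<Rightarrow> real^3^3) \<Rightarrow> bool" where
  "critical_point lam Q \<longleftrightarrow> Q \<in> W12 B1 S4 \<and>
     (\<forall>\<Phi> \<in> C_c 1 B1 S0. ((\<lambda>t. energy lam (variation Q \<Phi> t)) has_real_derivative 0) (at 0))"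

text \<open>
  \<open>has_second_variation lam \<Phi> Q c\<close> says that \<open>t \<mapsto> energy lam (variation Q \<Phi> t)\<close> is differentiable near
  \<open>0\<close>, that its derivative is differentiable at \<open>0\<close>, and that the second derivative there is \<open>c\<close>.
\<close>

definition has_second_variation ::
    "real \<Rightarrow> (real^3 \<Rightarrow> real^3^3) \<Rightarrow> (real^3 \<Rightarrow> real^3^3) \<Rightarrow> real \<Rightarrow> bool" where
  "has_second_variation lam \<Phi> Q c \<longleftrightarrow> \<Phi> \<in> C_c \<infinity> B1 S0 \<and>
     (\<exists>e'. (\<forall>\<^sub>F t in nhds 0. ((\<lambda>s. energy lam (variation Q \<Phi> s)) has_real_derivative e' t) (at t)) \<and>
           (e' has_real_derivative c) (at 0))"

lemma has_second_variation_unique: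
  assumes "has_second_variation lam \<Phi> Q c" "has_second_variation lam \<Phi> Q d"
  shows "c = d"
proof -
  let ?e = "\<lambda>s. energy lam (variation Q \<Phi> s)"
  obtain f where f: "\<forall>\<^sub>F t in nhds 0. (?e has_real_derivative f t) (at t)"
      "(f has_real_derivative c) (at 0)"
    using assms(1) unfolding has_second_variation_def by blast
  obtain g where g: "\<forall>\<^sub>F t in nhds 0. (?e has_real_derivative g t) (at t)"
      "(g has_real_derivative d) (at 0)"
    using assms(2) unfolding has_second_variation_def by blast
  have "\<forall>\<^sub>F t in nhds 0. f t = g t"
    using f(1) g(1) by eventually_elim (rule DERIV_unique)
  then have "(f has_real_derivative d) (at 0)"
    using g(2) DERIV_cong_ev[OF refl _ refl] by blast
  with f(2) show ?thesis by (rule DERIV_unique)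
qed

definition unstable_along :: "real \<Rightarrow> (real^3 \<Rightarrow> real^3^3) \<Rightarrow> (real^3 \<Rightarrow> real^3^3) \<Rightarrow> bool" where
  "unstable_along lam Q \<Phi> \<longleftrightarrow> (\<exists>c. has_second_variation lam \<Phi> Q c \<and> c < 0)"

section \<open>The hedgehog\<close>

definition tensor :: "real^'m \<Rightarrow> real^'n \<Rightarrow> real^'n^'m" where
  "tensor u v = (\<chi> i j. u $ i * v $ j)"

definition hedgehog :: "real^3 \<Rightarrow> real^3^3" where
  "hedgehog x = sqrt (3 / 2) *\<^sub>R
     (tensor ((1 / norm x) *\<^sub>R x) ((1 / norm x) *\<^sub>R x) - (1 / 3) *\<^sub>R mat 1)"

definition radial :: "(real^3 \<Rightarrow> real) \<Rightarrow> bool" where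
  "radial f \<longleftrightarrow> (\<forall>x y. norm x = norm y \<longrightarrow> f x = f y)"

end

theory Submission
  imports Defs
begin

text \<open>
  Write \<open>n = x / |x|\<close>, so that \<open>H = hedgehog\<close> is \<open>sqrt (3/2) (n \<otimes> n - I/3)\<close>. Its entries are spherical harmonics of
  degree 2 and \<open>|\<nabla>H|\<^sup>2 = 6 / |x|\<^sup>2\<close>, hence \<open>- \<Delta>H = |\<nabla>H|\<^sup>2 H\<close> away from the origin (\<open>laplacian_hedgehog\<close>). The singularity at
  the origin is of order \<open>1/|x|\<close> for the gradient and carries no distributional mass in dimension 3, so the equation
  holds weakly in the whole ball (\<open>hedgehog_weakly_harmonic\<close>). Moreover \<open>H\<^sup>2 = H / sqrt 6 + I/3\<close> (\<open>hedgehog_square\<close>), so the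
  derivative of the potential vanishes at \<open>H\<close> along tangential traceless directions. Together this makes \<open>H\<close> critical for every
  \<open>\<lambda>\<close>.

  For \<open>\<Phi> = \<xi> v\<close> with \<open>\<xi>\<close> radial, the second variation of the Dirichlet energy is the integral of
  \<open>|\<nabla>\<psi>|\<^sup>2 - (6 / |x|\<^sup>2) |\<psi>|\<^sup>2\<close>, where \<open>\<psi> = \<xi> (v - (H \<bullet> v) H)\<close> is the tangential part of \<open>\<Phi>\<close>. The quantities \<open>(H \<bullet> v)\<^sup>2\<close>
  and \<open>|x|\<^sup>2 |\<nabla>(H \<bullet> v)|\<^sup>2\<close> have the averages 1/5 and 6/5 over every sphere, whatever \<open>v \<in> S4\<close> is
  (\<open>sphere_averages\<close>), and what remains is
  \<open>4/5 \<integral> (|\<nabla>\<xi>|\<^sup>2 - 3 \<xi>\<^sup>2 / |x|\<^sup>2)\<close> (\<open>edensity_d2_radial\<close>). The optimal constant in the Hardy inequality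
  in dimension 3 is \<open>1/4 < 3\<close>. Therefore \<open>\<xi> = |x|\<^sup>-\<^sup>1\<^sup>/\<^sup>2\<close>, cut off at two radii with a large quotient, makes this negative: the
  gain \<open>\<integral> |x|\<^sup>-\<^sup>3\<close> grows logarithmically with the quotient of the radii, while the cost of each cutoff does not depend on the
  radius (\<open>profile_bound\<close>, \<open>negative_majorant\<close>). The potential adds at most \<open>2 \<lambda> \<integral> \<xi>\<^sup>2\<close>, which is a small multiple of
  \<open>\<integral> \<xi>\<^sup>2 / |x|\<^sup>2\<close> if \<open>\<xi>\<close> is supported in a small ball; this is how \<open>\<xi>\<close> depends on \<open>\<lambda>\<close>.

  To connect this with the energy, which is defined through an arbitrarily chosen weak gradient, one has to know that weak
  gradients are unique almost everywhere (\<open>weak_gradient_unique\<close>), that the classical gradient of a bounded map that is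
  singular at one point is a weak gradient (\<open>has_weak_gradient_grad\<close>), and that the energy of the variation may be
  differentiated twice under the integral (\<open>energy_hedgehog_variation\<close>). In the last step the
  majorant is a multiple of \<open>1/|x|\<^sup>2\<close>, which is integrable in dimension 3. Averages over spheres are
  obtained without surface integrals, by applying the divergence theorem to tangential vector fields.
\<close>

section \<open>Functions of class C\<open>\<^sup>k\<close> on open sets\<close>

text \<open>
  The local version of \<open>C_k\<close>: a test function that is given by a formula only on part of the space
  has to be handled on open pieces that are glued afterwards.
\<close>

primrec C_k_on :: "nat \<Rightarrow> 'a::euclidean_space set \<Rightarrow> ('a \<Rightarrow> 'b::real_normed_vector) \<Rightarrow> bool" where
  "C_k_on 0 U f \<longleftrightarrow> continuous_on U f"
| "C_k_on (Suc k) U f \<longleftrightarrow>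
     (\<forall>x\<in>U. f differentiable at x) \<and> (\<forall>v\<in>Basis. C_k_on k U (\<lambda>x. frechet_derivative f (at x) v))"

lemma C_k_on_UNIV: "C_k_on k UNIV f = C_k k f"
  by (induction k arbitrary: f) auto

lemma C_k_on_cong:
  assumes "open U" "C_k_on k U f" "\<And>x. x \<in> U \<Longrightarrow> f x = g x"
  shows "C_k_on k U g"
  using assms(2,3)
proof (induction k arbitrary: f g)
  case 0
  then show ?case by (simp cong: continuous_on_cong)
next
  case (Suc k)
  have eq: "frechet_derivative f (at x) = frechet_derivative g (at x)" if "x \<in> U" for x
    using frechet_derivative_transform_within_open[of f x U g] Suc.prems assms(1) that by auto
  have "g differentiable at x" if "x \<in> U" for x
    using Suc.prems that assms(1) unfolding differentiable_def
    by (meson C_k_on.simps(2) differentiable_def has_derivative_transform_within_open)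
  moreover have "C_k_on k U (\<lambda>x. frechet_derivative g (at x) v)" if "v \<in> Basis" for v
    by (rule Suc.IH[of "\<lambda>x. frechet_derivative f (at x) v"]) (use Suc.prems that eq in auto)
  ultimately show ?case by simp
qed

text \<open>
  Derivatives are usually known by a formula, not in the form \<open>frechet_derivative\<close> in which \<open>C_k\<close> iterates them.
\<close>

lemma C_k_on_SucI:
  assumes "open U" "\<And>x. x \<in> U \<Longrightarrow> (f has_derivative D x) (at x)"
    "\<And>v. v \<in> Basis \<Longrightarrow> C_k_on k U (\<lambda>x. D x v)"
  shows "C_k_on (Suc k) U f"
proof -
  have "C_k_on k U (\<lambda>x. frechet_derivative f (at x) v)" if "v \<in> Basis" for v
    by (rule C_k_on_cong[OF assms(1) assms(3)[OF that]])
      (use assms(2) frechet_derivative_at in metis)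
  with assms(2) show ?thesis by (auto simp: differentiable_def)
qed

lemma C_k_on_SucD:
  assumes "C_k_on (Suc k) U f"
  shows "C_k_on k U f"
  using assms
proof (induction k arbitrary: f)
  case 0
  then show ?case
    by (auto intro!: continuous_at_imp_continuous_on differentiable_imp_continuous_within)
next
  case (Suc k)
  then show ?case by auto
qed

lemma C_k_on_has_derivative:
  "C_k_on (Suc k) U f \<Longrightarrow> x \<in> U \<Longrightarrow> (f has_derivative frechet_derivative f (at x)) (at x)"
  by (simp add: frechet_derivative_works)

lemma C_k_on_imp_continuous_on: "C_k_on k U f \<Longrightarrow> continuous_on U f"
proof (induction k)
  case (Suc k)
  then show ?case using C_k_on_SucD by blast
qed simp

lemma C_k_on_subset: "C_k_on k U f \<Longrightarrow> V \<subseteq> U \<Longrightarrow> C_k_on k V f"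
  by (induction k arbitrary: f) (auto intro: continuous_on_subset)

lemma C_k_on_Un:
  assumes "open U" "open V" "C_k_on k U f" "C_k_on k V f"
  shows "C_k_on k (U \<union> V) f"
  using assms(3,4)
proof (induction k arbitrary: f)
  case 0
  then show ?case using continuous_on_open_Un[OF assms(1,2)] by simp
next
  case (Suc k)
  then show ?case by (metis C_k_on.simps(2) Un_iff)
qed

lemma C_k_on_const: "open U \<Longrightarrow> C_k_on k U (\<lambda>x. c)"
proof (induction k arbitrary: c)
  case (Suc k)
  show ?case by (rule C_k_on_SucI[where D = "\<lambda>_ _. 0"]) (use Suc in auto)
qed simp

lemma C_k_on_bounded_linear:
  assumes "open U" "bounded_linear L" "C_k_on k U f"
  shows "C_k_on k U (\<lambda>x. L (f x))"
  using assms(3)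
proof (induction k arbitrary: f)
  case 0
  then show ?case using bounded_linear.continuous_on[OF assms(2)] by simp
next
  case (Suc k)
  show ?case
    by (rule C_k_on_SucI[where D = "\<lambda>x v. L (frechet_derivative f (at x) v)"])
      (use Suc assms in \<open>auto intro!: bounded_linear.has_derivative[OF assms(2)]
         simp: frechet_derivative_works[symmetric]\<close>)
qed

lemma C_k_on_ident: "open U \<Longrightarrow> C_k_on k U (\<lambda>x. x)"
proof (cases k)
  case (Suc j)
  assume "open U"
  then show ?thesis unfolding Suc
    by (intro C_k_on_SucI[where D = "\<lambda>_ v. v"]) (auto intro: C_k_on_const)
qed simp

lemma C_k_on_linear: "open U \<Longrightarrow> bounded_linear L \<Longrightarrow> C_k_on k U L"
  using C_k_on_bounded_linear C_k_on_ident by blast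

lemma C_k_on_add:
  assumes "open U" "C_k_on k U f" "C_k_on k U g"
  shows "C_k_on k U (\<lambda>x. f x + g x)"
  using assms(2,3)
proof (induction k arbitrary: f g)
  case (Suc k)
  show ?case
    by (rule C_k_on_SucI[where
          D = "\<lambda>x v. frechet_derivative f (at x) v + frechet_derivative g (at x) v"])
      (use Suc assms(1) in \<open>auto intro!: has_derivative_add simp: frechet_derivative_works[symmetric]\<close>)
qed (simp add: continuous_on_add)

lemma C_k_on_diff:
  fixes f g :: "_ \<Rightarrow> 'b::real_normed_vector"
  assumes "open U" "C_k_on k U f" "C_k_on k U g"
  shows "C_k_on k U (\<lambda>x. f x - g x)"
proof -
  have "C_k_on k U (\<lambda>x. - g x)"
    by (rule C_k_on_bounded_linear[OF assms(1) bounded_linear_minus[OF bounded_linear_ident] assms(3)])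
  from C_k_on_add[OF assms(1,2) this] show ?thesis by simp
qed

lemma C_k_on_bilinear:
  fixes f :: "'a::euclidean_space \<Rightarrow> _"
  assumes "open U" "bounded_bilinear B" "C_k_on k U f" "C_k_on k U g"
  shows "C_k_on k U (\<lambda>x. B (f x) (g x))"
  using assms(3,4)
proof (induction k arbitrary: f g)
  case 0
  then show ?case using bounded_bilinear.continuous_on[OF assms(2)] by simp
next
  case (Suc k)
  have d: "C_k_on k U f" "C_k_on k U g" using Suc.prems C_k_on_SucD by blast+
  show ?case
  proof (rule C_k_on_SucI[where D = "\<lambda>x v. B (f x) (frechet_derivative g (at x) v) +
          B (frechet_derivative f (at x) v) (g x)"])
    fix x assume x: "x \<in> U"
    show "((\<lambda>x. B (f x) (g x)) has_derivative (\<lambda>v. B (f x) (frechet_derivative g (at x) v) +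
          B (frechet_derivative f (at x) v) (g x))) (at x)"
      by (rule bounded_bilinear.FDERIV[OF assms(2)]; rule C_k_on_has_derivative; rule Suc.prems x)
  next
    fix v :: 'a assume "v \<in> Basis"
    then have "C_k_on k U (\<lambda>x. frechet_derivative f (at x) v)"
      "C_k_on k U (\<lambda>x. frechet_derivative g (at x) v)"
      using Suc.prems by (metis C_k_on.simps(2))+
    with d show "C_k_on k U (\<lambda>x. B (f x) (frechet_derivative g (at x) v) +
          B (frechet_derivative f (at x) v) (g x))"
      by (intro C_k_on_add[OF assms(1) Suc.IH Suc.IH])
  qed (rule assms(1))
qed

lemmas C_k_on_mult = C_k_on_bilinear[OF _ bounded_bilinear_mult]
lemmas C_k_on_inner = C_k_on_bilinear[OF _ bounded_bilinear_inner]
lemmas C_k_on_scaleR = C_k_on_bilinear[OF _ bounded_bilinear_scaleR]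

lemma C_k_on_prod:
  fixes f :: "'i \<Rightarrow> 'a::euclidean_space \<Rightarrow> real"
  assumes "open U" "finite I" "\<And>i. i \<in> I \<Longrightarrow> C_k_on k U (f i)"
  shows "C_k_on k U (\<lambda>x. \<Prod>i\<in>I. f i x)"
  using assms(2,3)
proof (induction I)
  case empty
  show ?case using C_k_on_const[OF assms(1)] by simp
next
  case (insert i I)
  have "C_k_on k U (\<lambda>x. f i x * (\<Prod>i\<in>I. f i x))"
    by (rule C_k_on_mult[OF assms(1)]) (use insert in auto)
  then show ?case using insert by simp
qed

lemma C_k_on_compose:
  fixes F :: "real \<Rightarrow> 'b::real_normed_vector" and u :: "'a::euclidean_space \<Rightarrow> real"
  assumes "open U" "C_k k F" "C_k_on k U u"
  shows "C_k_on k U (\<lambda>x. F (u x))"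
  using assms(2,3)
proof (induction k arbitrary: F u)
  case 0
  then show ?case using continuous_on_compose2[of UNIV F U u] by auto
next
  case (Suc k)
  have F': "C_k k (\<lambda>s. frechet_derivative F (at s) 1)" using Suc.prems by simp
  have u: "C_k_on k U u" using Suc.prems C_k_on_SucD by blast
  show ?case
  proof (rule C_k_on_SucI[where D = "\<lambda>x v. frechet_derivative u (at x) v *\<^sub>R
          frechet_derivative F (at (u x)) 1"])
    fix x assume "x \<in> U"
    then have u': "(u has_derivative frechet_derivative u (at x)) (at x)"
      using Suc.prems(2) C_k_on_has_derivative by blast
    have Fd: "(F has_derivative frechet_derivative F (at (u x))) (at (u x))"
      using Suc.prems(1) by (simp add: frechet_derivative_works[symmetric])
    have "frechet_derivative F (at (u x)) s = s *\<^sub>R frechet_derivative F (at (u x)) 1" for s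
      using linear_scale[OF has_derivative_linear[OF Fd], of s 1] by simp
    then have "frechet_derivative F (at (u x)) = (\<lambda>s. s *\<^sub>R frechet_derivative F (at (u x)) 1)"
      by (rule ext)
    with Fd have Fd': "(F has_derivative (\<lambda>s. s *\<^sub>R frechet_derivative F (at (u x)) 1)) (at (u x))"
      by argo
    show "((\<lambda>x. F (u x)) has_derivative
        (\<lambda>v. frechet_derivative u (at x) v *\<^sub>R frechet_derivative F (at (u x)) 1)) (at x)"
      using diff_chain_at[OF u' Fd'] by (simp only: o_def)
  next
    fix v :: 'a assume v: "v \<in> Basis"
    have "C_k_on k U (\<lambda>x. frechet_derivative u (at x) v)"
      using Suc.prems(2) v by (metis C_k_on.simps(2))
    moreover have "C_k_on k U (\<lambda>x. frechet_derivative F (at (u x)) 1)"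
      using Suc.IH[OF F' u] .
    ultimately show "C_k_on k U (\<lambda>x. frechet_derivative u (at x) v *\<^sub>R frechet_derivative F (at (u x)) 1)"
      by (rule C_k_on_scaleR[OF assms(1)])
  qed (rule assms(1))
qed

text \<open>
  Differentiation lowers the exponent, so the exponent has to vary in the induction. With \<open>a = - 1\<close> and \<open>a = 1/2\<close> this covers
  reciprocals, square roots and hence the Euclidean norm away from 0.
\<close>

lemma C_k_on_powr:
  fixes u :: "'a::euclidean_space \<Rightarrow> real"
  assumes "open U" "C_k_on k U u" "\<And>x. x \<in> U \<Longrightarrow> u x > 0"
  shows "C_k_on k U (\<lambda>x. u x powr a)"
  using assms(2)
proof (induction k arbitrary: a)
  case 0
  then show ?case using assms(3) by (force intro!: continuous_intros)
next
  case (Suc k)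
  have u: "C_k_on k U u" using Suc.prems C_k_on_SucD by blast
  show ?case
  proof (rule C_k_on_SucI[where D = "\<lambda>x v. (a * u x powr (a - 1)) * frechet_derivative u (at x) v"])
    fix x assume x: "x \<in> U"
    then have "(u has_derivative frechet_derivative u (at x)) (at x)"
      using Suc.prems C_k_on_has_derivative by blast
    moreover have "((\<lambda>y. y powr a) has_derivative (\<lambda>h. (a * u x powr (a - 1)) * h)) (at (u x))"
      using has_real_derivative_powr[OF assms(3)[OF x], of a]
      by (simp add: has_field_derivative_def)
    ultimately show "((\<lambda>x. u x powr a) has_derivative
        (\<lambda>v. (a * u x powr (a - 1)) * frechet_derivative u (at x) v)) (at x)"
      using diff_chain_at by (fastforce simp: o_def)
  next
    fix v :: 'a assume "v \<in> Basis"
    then show "C_k_on k U (\<lambda>x. (a * u x powr (a - 1)) * frechet_derivative u (at x) v)"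
      using Suc.prems by (auto intro!: C_k_on_mult[OF assms(1)] C_k_on_const[OF assms(1)] Suc.IH u)
  qed (rule assms(1))
qed

text \<open>
  The function is of class C\<open>\<^sup>k\<close> on \<open>U\<close> and, being zero there, on the complement of \<open>K\<close>; these two open sets cover the space.
\<close>

lemma C_k_extend_by_zero:
  assumes "open U" "C_k_on k U f" "closed K" "K \<subseteq> U" "\<And>x. x \<notin> K \<Longrightarrow> f x = 0"
  shows "C_k k f"
proof -
  have "C_k_on k (- K) f"
    by (rule C_k_on_cong[of _ _ "\<lambda>_. 0"]) (use assms in \<open>auto intro: C_k_on_const\<close>)
  then have "C_k_on k (U \<union> - K) f"
    using assms by (intro C_k_on_Un) auto
  moreover have "U \<union> - K = UNIV" using assms(4) by auto
  ultimately show ?thesis by (simp add: C_k_on_UNIV)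
qed

lemma C_c_infinityI:
  assumes "open U" "\<And>k. C_k_on k U f" "compact K" "K \<subseteq> U" "K \<subseteq> \<Omega>" "\<And>x. x \<notin> K \<Longrightarrow> f x = 0"
    "\<And>x. f x \<in> V"
  shows "f \<in> C_c \<infinity> \<Omega> V"
proof -
  have "closure {x. f x \<noteq> 0} \<subseteq> K"
    using assms(3,6) by (intro closure_minimal compact_imp_closed) auto
  moreover from this have "compact (closure {x. f x \<noteq> 0})"
    using assms(3) by (metis closed_closure compact_Int_closed Int_absorb1)
  moreover have "C_k m f" for m
    using C_k_extend_by_zero[OF assms(1,2) compact_imp_closed[OF assms(3)] assms(4,6)] .
  ultimately show ?thesis using assms(5,7) by (auto simp: C_c_def)
qed

section \<open>Cutoff functions\<close>

text \<open>
  With \<open>p = 1\<close> this is the classical smooth function \<open>exp (-1/t)\<close> that is flat at the origin. The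
  polynomial factor makes the family closed under differentiation, so that smoothness is an
  induction.
\<close>

definition flat_exp :: "real poly \<Rightarrow> real \<Rightarrow> real" where
  "flat_exp p t = (if t > 0 then poly p (1 / t) * exp (- (1 / t)) else 0)"

lemma poly_times_exp_minus_tendsto_0: "((\<lambda>s. poly p s * exp (- s)) \<longlongrightarrow> (0::real)) at_top"
proof -
  have "((\<lambda>s. \<Sum>i\<le>degree p. coeff p i * (s ^ i / exp s)) \<longlongrightarrow> (\<Sum>i\<le>degree p. coeff p i * 0)) at_top"
    by (intro tendsto_intros tendsto_power_div_exp_0)
  then show ?thesis
    by (simp add: poly_altdef exp_minus divide_inverse sum_distrib_right mult.assoc)
qed

text \<open>
  Substituting \<open>s = 1/t\<close> turns this into the domination of polynomials by the exponential function.
\<close>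

lemma flat_exp_quotient_tendsto_0: "((\<lambda>t. flat_exp p t / t) \<longlongrightarrow> 0) (at 0)"
proof -
  have "((\<lambda>t. poly ([:0, 1:] * p) (inverse t) * exp (- inverse t)) \<longlongrightarrow> (0::real)) (at_right 0)"
    by (rule filterlim_compose[OF poly_times_exp_minus_tendsto_0 filterlim_inverse_at_top_right])
  then have "((\<lambda>t. flat_exp p t / t) \<longlongrightarrow> 0) (at_right 0)"
    by (rule Lim_transform_eventually)
      (auto simp: eventually_at_filter flat_exp_def field_simps inverse_eq_divide)
  moreover have "((\<lambda>t. flat_exp p t / t) \<longlongrightarrow> 0) (at_left 0)"
    by (rule Lim_transform_eventually[of "\<lambda>_. 0"])
      (auto simp: eventually_at_filter flat_exp_def)
  ultimately show ?thesis by (simp add: filterlim_split_at)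
qed

lemma flat_exp_has_derivative:
  "(flat_exp p has_real_derivative flat_exp ([:0, 0, 1:] * (p - pderiv p)) t) (at t)"
proof -
  consider "t > 0" | "t < 0" | "t = 0" by linarith
  then show ?thesis
  proof cases
    case 1
    have "((\<lambda>t. poly p (1 / t) * exp (- (1 / t))) has_real_derivative
        flat_exp ([:0, 0, 1:] * (p - pderiv p)) t) (at t)"
      using 1 by (auto intro!: derivative_eq_intros DERIV_chain2[OF poly_DERIV]
          simp: flat_exp_def field_simps power2_eq_square)
    then show ?thesis
      by (rule has_field_derivative_transform_within_open[of _ _ _ "{0<..}"])
        (use 1 in \<open>auto simp: flat_exp_def\<close>)
  next
    case 2
    have "((\<lambda>t. 0) has_real_derivative flat_exp ([:0, 0, 1:] * (p - pderiv p)) t) (at t)"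
      using 2 by (auto simp: flat_exp_def)
    then show ?thesis
      by (rule has_field_derivative_transform_within_open[of _ _ _ "{..<0}"])
        (use 2 in \<open>auto simp: flat_exp_def\<close>)
  next
    case 3
    then show ?thesis
      using flat_exp_quotient_tendsto_0[of p] by (simp add: has_field_derivative_iff flat_exp_def)
  qed
qed

lemma C_k_flat_exp: "C_k k (flat_exp p)"
proof (induction k arbitrary: p)
  case 0
  show ?case
    by (simp add: continuous_at_imp_continuous_on DERIV_isCont[OF flat_exp_has_derivative])
next
  case (Suc k)
  have "C_k_on (Suc k) UNIV (flat_exp p)"
  proof (rule C_k_on_SucI[where D = "\<lambda>t h. flat_exp ([:0, 0, 1:] * (p - pderiv p)) t * h"])
    show "(flat_exp p has_derivative (\<lambda>h. flat_exp ([:0, 0, 1:] * (p - pderiv p)) x * h)) (at x)" for x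
      using flat_exp_has_derivative[of p x] by (simp add: has_field_derivative_def)
  qed (use Suc in \<open>auto simp: C_k_on_UNIV\<close>)
  then show ?case by (simp only: C_k_on_UNIV)
qed

abbreviation flat :: "real \<Rightarrow> real" where "flat \<equiv> flat_exp 1"

lemma flat_simps: "t \<le> 0 \<Longrightarrow> flat t = 0" "t > 0 \<Longrightarrow> flat t = exp (- (1 / t))" "flat t > 0 \<longleftrightarrow> t > 0"
  "0 \<le> flat t" "flat t \<le> 1"
  by (auto simp: flat_exp_def)

text \<open>
  A smooth function that increases from 0 to 1 on the interval \<open>[1, 2]\<close>.
\<close>

definition smooth_step :: "real \<Rightarrow> real" where
  "smooth_step t = flat (t - 1) * (flat (t - 1) + flat (2 - t)) powr (- 1)"

lemma smooth_step_pos: "flat (t - 1) + flat (2 - t) > 0"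
  using flat_simps(3,4)[of "t - 1"] flat_simps(3,4)[of "2 - t"] by (cases "t > 1") fastforce+

lemma smooth_step_simps: "t \<le> 1 \<Longrightarrow> smooth_step t = 0" "t \<ge> 2 \<Longrightarrow> smooth_step t = 1"
  "0 \<le> smooth_step t" "smooth_step t \<le> 1"
  using smooth_step_pos[of t] flat_simps(3)[of "t - 1"]
  by (auto simp: smooth_step_def flat_simps powr_minus divide_inverse[symmetric] divide_le_eq_1)

lemma C_k_smooth_step: "C_k k smooth_step"
  unfolding C_k_on_UNIV[symmetric] smooth_step_def[abs_def]
  by (intro C_k_on_mult C_k_on_powr C_k_on_add C_k_on_compose[OF _ C_k_flat_exp] C_k_on_diff
      C_k_on_ident C_k_on_const smooth_step_pos open_UNIV)

definition smooth_step' :: "real \<Rightarrow> real" where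
  "smooth_step' t = frechet_derivative smooth_step (at t) 1"

lemma smooth_step_has_derivative: "(smooth_step has_real_derivative smooth_step' t) (at t)"
proof -
  have "(smooth_step has_derivative frechet_derivative smooth_step (at t)) (at t)"
    using C_k_smooth_step[of 1] by (simp add: frechet_derivative_works[symmetric])
  moreover have "frechet_derivative smooth_step (at t) s = smooth_step' t * s" for s
    using linear_scale[OF has_derivative_linear[OF calculation], of s 1]
    by (simp add: smooth_step'_def)
  then have "frechet_derivative smooth_step (at t) = (*) (smooth_step' t)" by (rule ext)
  ultimately show ?thesis unfolding has_field_derivative_def by argo
qed

lemma smooth_step'_eq_0: "t < 1 \<or> t > 2 \<Longrightarrow> smooth_step' t = 0"
proof -
  assume *: "t < 1 \<or> t > 2"
  have "((\<lambda>_. if t < 1 then 0 else 1) has_real_derivative 0) (at t)" by simp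
  then have "(smooth_step has_real_derivative 0) (at t)"
    by (rule has_field_derivative_transform_within_open[of _ _ _ "if t < 1 then {..<1} else {2<..}"])
      (use * in \<open>auto simp: smooth_step_simps split: if_splits\<close>)
  then show ?thesis using smooth_step_has_derivative DERIV_unique by blast
qed

lemma continuous_smooth_step': "continuous_on UNIV smooth_step'"
  using C_k_smooth_step[of 1] by (simp add: smooth_step'_def[abs_def])

lemma smooth_step'_bounded: obtains C where "C > 0" "\<And>t. \<bar>smooth_step' t\<bar> \<le> C"
proof -
  have "compact (smooth_step' ` {1..2})"
    using continuous_smooth_step' by (intro compact_continuous_image) (auto intro: continuous_on_subset)
  then obtain C where C: "C > 0" "\<And>t. t \<in> {1..2} \<Longrightarrow> \<bar>smooth_step' t\<bar> \<le> C"
    by (metis bounded_pos compact_imp_bounded image_eqI real_norm_def)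
  have "\<bar>smooth_step' t\<bar> \<le> C" for t
    using C(1) C(2)[of t] smooth_step'_eq_0[of t] by (cases "t \<in> {1..2}") auto
  with C(1) show thesis using that by blast
qed

section \<open>Almost everywhere uniqueness of the weak gradient\<close>

text \<open>
  A Lebesgue measurable set differs from a Borel set by a null set, so the integrals over all Lebesgue measurable sets vanish.
\<close>

lemma AE_zero_of_integral_borel_zero:
  fixes f :: "'a::euclidean_space \<Rightarrow> real"
  assumes f: "integrable lebesgue f"
    and zero: "\<And>A. A \<in> sets borel \<Longrightarrow> (\<integral>x\<in>A. f x \<partial>lebesgue) = 0"
  shows "AE x in lebesgue. f x = 0"
proof -
  have "(\<integral>x\<in>A. f x \<partial>lebesgue) = 0" if A: "A \<in> sets lebesgue" for A
  proof -
    obtain S N N' where SN: "A = S \<union> N" "N \<subseteq> N'" "N' \<in> null_sets lborel" "S \<in> sets lborel"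
      using sets_completionE[OF A] by metis
    have N': "N' \<in> null_sets lebesgue" using SN(3) by (rule null_sets_completionI)
    have "(\<integral>x\<in>A. f x \<partial>lebesgue) = (\<integral>x\<in>S. f x \<partial>lebesgue)"
      unfolding set_lebesgue_integral_def
    proof (rule integral_cong_AE)
      have [measurable]: "A \<in> sets lebesgue" "S \<in> sets lebesgue" using A SN(4) by auto
      note [measurable] = borel_measurable_integrable[OF f]
      show "(\<lambda>x. indicator A x *\<^sub>R f x) \<in> borel_measurable lebesgue"
        "(\<lambda>x. indicator S x *\<^sub>R f x) \<in> borel_measurable lebesgue" by measurable
      show "AE x in lebesgue. indicator A x *\<^sub>R f x = indicator S x *\<^sub>R f x"
        using AE_not_in[OF N'] by eventually_elim (use SN(1,2) in \<open>auto simp: indicator_def\<close>)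
    qed
    also have "\<dots> = 0" using zero SN(4) by simp
    finally show ?thesis .
  qed
  then show ?thesis
    using density_unique_real[OF f, of "\<lambda>_. 0"] by (simp add: set_lebesgue_integral_def)
qed

text \<open>
  The sets over which the integral vanishes form a Dynkin system, and open boxes are a generator of the Borel sets that is
  closed under intersection.
\<close>

lemma AE_zero_of_integral_box_zero:
  fixes f :: "'a::euclidean_space \<Rightarrow> real"
  assumes f: "integrable lebesgue f"
    and zero: "\<And>a b. (\<integral>x\<in>box a b. f x \<partial>lebesgue) = 0"
  shows "AE x in lebesgue. f x = 0"
proof (rule AE_zero_of_integral_borel_zero[OF f])
  have si: "set_integrable lebesgue A f" if "A \<in> sets borel" for A
    unfolding set_integrable_def using that by (intro integrable_mult_indicator f) auto
  have all: "(\<integral>x. f x \<partial>lebesgue) = 0"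
  proof -
    let ?B = "\<lambda>n::nat. box (- (real n *\<^sub>R One)) (real n *\<^sub>R One) :: 'a set"
    have "(\<lambda>n. \<integral>x\<in>?B n. f x \<partial>lebesgue) \<longlonglongrightarrow> (\<integral>x\<in>(\<Union>n. ?B n). f x \<partial>lebesgue)"
    proof (rule set_integral_cont_up)
      show "incseq ?B"
        by (rule incseq_SucI, rule subset_box_imp) (auto simp: inner_sum_left inner_Basis)
    qed (auto simp: UN_box_eq_UNIV si)
    then show ?thesis
      by (simp add: zero UN_box_eq_UNIV LIMSEQ_const_iff) (simp add: set_lebesgue_integral_def)
  qed
  fix A :: "'a set" assume "A \<in> sets borel"
  then have "A \<in> sigma_sets UNIV (range (\<lambda>(a, b). box a b))"
    by (simp add: borel_eq_box)
  then show "(\<integral>x\<in>A. f x \<partial>lebesgue) = 0"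
  proof (induction rule: sigma_sets_induct_disjoint[rotated 2, consumes 1, case_names basic empty compl union])
    case (basic A)
    then show ?case using zero by auto
  next
    case empty
    show ?case by (simp add: set_lebesgue_integral_def)
  next
    case (compl A)
    then have A: "A \<in> sets borel" by (simp add: borel_eq_box)
    have "(\<integral>x\<in>UNIV - A. f x \<partial>lebesgue) = (\<integral>x. f x - indicator A x *\<^sub>R f x \<partial>lebesgue)"
      unfolding set_lebesgue_integral_def
      by (rule Bochner_Integration.integral_cong) (auto simp: indicator_def)
    also have "\<dots> = 0"
      using compl si[OF A] f all by (simp add: set_lebesgue_integral_def set_integrable_def)
    finally show ?case .
  next
    case (union A)
    then have A: "A i \<in> sets borel" for i by (auto simp: borel_eq_box)
    have "(\<integral>x\<in>(\<Union>i. A i). f x \<partial>lebesgue) = (\<Sum>i. \<integral>x\<in>A i. f x \<partial>lebesgue)"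
      using A union(1) by (intro lebesgue_integral_countable_add si) (auto simp: disjoint_family_on_def)
    then show ?case using union by simp
  next
    show "Int_stable (range (\<lambda>(a, b). box a b :: 'a set))"
      by (auto simp: Int_stable_def box_Int_box)
  qed auto
qed

text \<open>
  The indicator of an open box is the increasing limit of products of the functions
  \<open>flat (n (x - a)) flat (n (b - x))\<close> in the single coordinates.
\<close>

lemma set_integral_box_zero:
  fixes g :: "'a::euclidean_space \<Rightarrow> real"
  assumes zero: "\<And>\<phi>. \<phi> \<in> C_c \<infinity> \<Omega> UNIV \<Longrightarrow> (\<integral>x\<in>\<Omega>. \<phi> x *\<^sub>R g x \<partial>lebesgue) = 0"
    and K: "cbox c d \<subseteq> \<Omega>" and g: "set_integrable lebesgue (cbox c d) g"
    and sub: "box a b \<subseteq> cbox c d"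
  shows "(\<integral>x\<in>box a b. g x \<partial>lebesgue) = 0"
proof -
  define \<phi> where "\<phi> n x = (\<Prod>i\<in>Basis. flat (real n * (x \<bullet> i - a \<bullet> i)) * flat (real n * (b \<bullet> i - x \<bullet> i)))"
    for n and x :: 'a
  have \<phi>0: "\<phi> n x = 0" if out: "x \<notin> box a b" for n x
  proof -
    obtain i where i: "i \<in> Basis" "\<not> (a \<bullet> i < x \<bullet> i \<and> x \<bullet> i < b \<bullet> i)"
      using out unfolding mem_box by blast
    then have "flat (real n * (x \<bullet> i - a \<bullet> i)) * flat (real n * (b \<bullet> i - x \<bullet> i)) = 0"
      by (auto simp: not_less mult_nonneg_nonpos flat_simps(1))
    then show ?thesis unfolding \<phi>_def using i by (intro prod_zero) auto
  qed
  have \<phi>1: "0 \<le> \<phi> n x" "\<phi> n x \<le> 1" for n x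
    unfolding \<phi>_def by (auto intro!: prod_nonneg prod_le_1 mult_le_one simp: flat_simps(4,5))
  have smooth: "C_k_on k UNIV (\<phi> n)" for k n
    unfolding \<phi>_def[abs_def]
    by (intro C_k_on_prod C_k_on_mult C_k_on_compose[OF _ C_k_flat_exp] C_k_on_diff C_k_on_const
        C_k_on_linear bounded_linear_inner_left open_UNIV finite_Basis)
  have test: "\<phi> n \<in> C_c \<infinity> \<Omega> UNIV" for n
    using sub K \<phi>0 by (intro C_c_infinityI[where U = UNIV and K = "cbox c d"] smooth) auto
  have flat_lim: "(\<lambda>n. flat (real n * t)) \<longlonglongrightarrow> 1" if "t > 0" for t
  proof -
    have "(\<lambda>n. exp (- (1 / t * (1 / real n)))) \<longlonglongrightarrow> exp (- (1 / t * 0))"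
      by (intro tendsto_intros lim_1_over_n)
    moreover have "\<forall>\<^sub>F n in sequentially. exp (- (1 / t * (1 / real n))) = flat (real n * t)"
      by (rule eventually_sequentiallyI[of 1]) (use that in \<open>simp add: flat_simps(2) mult.commute\<close>)
    ultimately show ?thesis using Lim_transform_eventually by fastforce
  qed
  have lim: "(\<lambda>n. \<phi> n x) \<longlonglongrightarrow> indicator (box a b) x" for x
  proof (cases "x \<in> box a b")
    case True
    have "(\<lambda>n. \<phi> n x) \<longlonglongrightarrow> (\<Prod>i\<in>(Basis::'a set). 1 * 1)"
      unfolding \<phi>_def using True by (intro tendsto_prod tendsto_mult flat_lim) (auto simp: mem_box)
    with True show ?thesis by simp
  qed (simp add: \<phi>0)
  have int: "integrable lebesgue (\<lambda>x. indicator (cbox c d) x *\<^sub>R g x)"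
    using g by (simp add: set_integrable_def)
  note gm = borel_measurable_integrable[OF int]
  have m\<phi>: "\<phi> n \<in> borel_measurable lebesgue" for n
    using C_k_on_imp_continuous_on[OF smooth[of 0 n]]
    by (intro measurable_completion) (auto intro: borel_measurable_continuous_onI)
  have "(\<lambda>n. \<integral>x. \<phi> n x *\<^sub>R (indicator (cbox c d) x *\<^sub>R g x) \<partial>lebesgue)
      \<longlonglongrightarrow> (\<integral>x. indicator (box a b) x *\<^sub>R (indicator (cbox c d) x *\<^sub>R g x) \<partial>lebesgue)"
  proof (rule integral_dominated_convergence[where w = "\<lambda>x. norm (indicator (cbox c d) x *\<^sub>R g x)"])
    show "AE x in lebesgue. (\<lambda>n. \<phi> n x *\<^sub>R (indicator (cbox c d) x *\<^sub>R g x))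
        \<longlonglongrightarrow> indicator (box a b) x *\<^sub>R (indicator (cbox c d) x *\<^sub>R g x)"
      by (intro AE_I2 tendsto_scaleR lim tendsto_const)
    show "AE x in lebesgue. norm (\<phi> n x *\<^sub>R (indicator (cbox c d) x *\<^sub>R g x))
        \<le> norm (indicator (cbox c d) x *\<^sub>R g x)" for n
      using \<phi>1 by (intro AE_I2) (simp add: abs_mult abs_of_nonneg mult_left_le_one_le)
    show "(\<lambda>x. indicator (box a b) x *\<^sub>R (indicator (cbox c d) x *\<^sub>R g x)) \<in> borel_measurable lebesgue"
      by (rule borel_measurable_scaleR[OF borel_measurable_indicator gm]) simp
  qed (rule borel_measurable_scaleR[OF m\<phi> gm] integrable_norm[OF int])+
  moreover have "(\<integral>x. \<phi> n x *\<^sub>R (indicator (cbox c d) x *\<^sub>R g x) \<partial>lebesgue) = 0" for n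
  proof -
    have "(\<integral>x. \<phi> n x *\<^sub>R (indicator (cbox c d) x *\<^sub>R g x) \<partial>lebesgue) = (\<integral>x\<in>\<Omega>. \<phi> n x *\<^sub>R g x \<partial>lebesgue)"
      unfolding set_lebesgue_integral_def using \<phi>0[of _ n] sub K
      by (intro Bochner_Integration.integral_cong) (auto simp: indicator_def)
    then show ?thesis using zero[OF test] by simp
  qed
  moreover have "(\<integral>x. indicator (box a b) x *\<^sub>R (indicator (cbox c d) x *\<^sub>R g x) \<partial>lebesgue)
      = (\<integral>x\<in>box a b. g x \<partial>lebesgue)"
    unfolding set_lebesgue_integral_def using sub
    by (intro Bochner_Integration.integral_cong) (auto simp: indicator_def)
  ultimately show ?thesis by (simp add: LIMSEQ_const_iff)
qed

text \<open>The fundamental lemma of the calculus of variations.\<close>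

lemma fundamental_lemma_real:
  fixes g :: "'a::euclidean_space \<Rightarrow> real"
  assumes "open \<Omega>" and g: "locally_integrable \<Omega> g"
    and zero: "\<And>\<phi>. \<phi> \<in> C_c \<infinity> \<Omega> UNIV \<Longrightarrow> (\<integral>x\<in>\<Omega>. \<phi> x *\<^sub>R g x \<partial>lebesgue) = 0"
  shows "AE x in lebesgue. x \<in> \<Omega> \<longrightarrow> g x = 0"
proof -
  obtain \<D> where \<D>: "countable \<D>" "\<D> \<subseteq> Pow \<Omega>" "\<And>X. X \<in> \<D> \<Longrightarrow> \<exists>a b. X = cbox a b" "\<Union>\<D> = \<Omega>"
    using open_countable_Union_open_cbox[OF assms(1)] by metis
  have "AE x in lebesgue. \<forall>X\<in>\<D>. x \<in> X \<longrightarrow> g x = 0"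
    unfolding AE_ball_countable[OF \<D>(1)]
  proof
    fix X assume X: "X \<in> \<D>"
    then obtain c d where cd: "X = cbox c d" using \<D>(3) by blast
    have K: "cbox c d \<subseteq> \<Omega>" using X cd \<D>(2) by auto
    have int: "set_integrable lebesgue (cbox c d) g"
      using g K by (auto simp: locally_integrable_def)
    have intb: "set_integrable lebesgue (box c d) g"
      by (rule set_integrable_subset[OF int]) (auto simp: box_subset_cbox)
    have "AE x in lebesgue. indicator (box c d) x *\<^sub>R g x = 0"
    proof (rule AE_zero_of_integral_box_zero)
      show "integrable lebesgue (\<lambda>x. indicator (box c d) x *\<^sub>R g x)"
        using intb by (simp add: set_integrable_def)
      fix a b :: 'a
      obtain a' b' where ab: "box a b \<inter> box c d = box a' b'" using box_Int_box[of a b c d] by blast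
      have "(\<integral>x\<in>box a' b'. g x \<partial>lebesgue) = 0"
      proof (rule set_integral_box_zero[where \<Omega> = \<Omega>, OF _ K int])
        show "box a' b' \<subseteq> cbox c d" unfolding ab[symmetric] using box_subset_cbox[of c d] by blast
      qed (rule zero)
      then show "(\<integral>x\<in>box a b. indicator (box c d) x *\<^sub>R g x \<partial>lebesgue) = 0"
        unfolding set_lebesgue_integral_def ab[symmetric] by (simp add: indicator_inter_arith mult.assoc)
    qed
    moreover have "AE x in lebesgue. x \<notin> cbox c d - box c d"
      by (rule AE_not_in[OF negligible_frontier_interval[unfolded negligible_iff_null_sets]])
    ultimately show "AE x in lebesgue. x \<in> X \<longrightarrow> g x = 0"
      by eventually_elim (auto simp: cd)
  qed
  then show ?thesis by eventually_elim (use \<D>(4) in blast)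
qed

lemma test_function_times_locally_integrable:
  fixes g :: "'a::euclidean_space \<Rightarrow> 'b::euclidean_space"
  assumes "\<phi> \<in> C_c \<infinity> \<Omega> (UNIV :: real set)" "locally_integrable \<Omega> g"
  shows "set_integrable lebesgue \<Omega> (\<lambda>x. \<phi> x *\<^sub>R g x)"
proof -
  define K where "K = closure {x. \<phi> x \<noteq> 0}"
  have K: "compact K" "K \<subseteq> \<Omega>" and c: "continuous_on UNIV \<phi>"
    using assms(1) by (auto simp: C_c_def K_def enat_0 dest: spec[of _ 0])
  have K0: "\<phi> x = 0" if "x \<notin> K" for x using that closure_subset[of "{x. \<phi> x \<noteq> 0}"] by (auto simp: K_def)
  have "compact (\<phi> ` K)"
    using c K by (intro compact_continuous_image) (auto intro: continuous_on_subset)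
  then obtain C where C: "\<And>x. x \<in> K \<Longrightarrow> \<bar>\<phi> x\<bar> \<le> C"
    by (metis bounded_iff compact_imp_bounded image_eqI real_norm_def)
  have int: "integrable lebesgue (\<lambda>x. indicator K x *\<^sub>R g x)"
    using assms(2) K by (auto simp: locally_integrable_def set_integrable_def)
  have [measurable]: "\<phi> \<in> borel_measurable lebesgue"
    using c by (intro measurable_completion) (auto intro: borel_measurable_continuous_onI)
  note [measurable] = borel_measurable_integrable[OF int]
  have "integrable lebesgue (\<lambda>x. \<phi> x *\<^sub>R (indicator K x *\<^sub>R g x))"
  proof (rule Bochner_Integration.integrable_bound)
    show "integrable lebesgue (\<lambda>x. C *\<^sub>R (indicator K x *\<^sub>R g x))" by (intro integrable_scaleR_right int)
    show "AE x in lebesgue. norm (\<phi> x *\<^sub>R (indicator K x *\<^sub>R g x)) \<le> norm (C *\<^sub>R (indicator K x *\<^sub>R g x))"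
    proof (rule AE_I2)
      fix x
      show "norm (\<phi> x *\<^sub>R (indicator K x *\<^sub>R g x)) \<le> norm (C *\<^sub>R (indicator K x *\<^sub>R g x))"
        using C[of x] by (cases "x \<in> K") (auto intro!: mult_right_mono)
    qed
  qed measurable
  moreover have "(\<lambda>x. \<phi> x *\<^sub>R (indicator K x *\<^sub>R g x)) = (\<lambda>x. indicator \<Omega> x *\<^sub>R (\<phi> x *\<^sub>R g x))"
    using K(2) K0 by (force simp: indicator_def)
  ultimately show ?thesis unfolding set_integrable_def by argo
qed

lemma locally_integrable_bounded_linear:
  fixes L :: "'b::euclidean_space \<Rightarrow> 'c::euclidean_space" and g :: "'a::euclidean_space \<Rightarrow> 'b"
  assumes "bounded_linear L" "locally_integrable \<Omega> g"
  shows "locally_integrable \<Omega> (\<lambda>x. L (g x))"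
  unfolding locally_integrable_def set_integrable_def
proof (intro allI impI)
  fix K :: "'a set" assume "compact K \<and> K \<subseteq> \<Omega>"
  then have "integrable lebesgue (\<lambda>x. indicator K x *\<^sub>R g x)"
    using assms(2) by (auto simp: locally_integrable_def set_integrable_def)
  from integrable_bounded_linear[OF assms(1) this]
  show "integrable lebesgue (\<lambda>x. indicator K x *\<^sub>R L (g x))"
    by (simp add: linear_scale[OF bounded_linear.linear[OF assms(1)]])
qed

text \<open>
  All components of the difference are orthogonal to every test function. Hence the energy does not depend on the
  representative selected by \<open>weak_gradient\<close>.
\<close>

lemma weak_gradient_unique:
  fixes G G' :: "real^'n \<Rightarrow> 'b::euclidean_space^'n"
  assumes "open \<Omega>" "has_weak_gradient f G \<Omega>" "has_weak_gradient f G' \<Omega>"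
  shows "AE x in lebesgue. x \<in> \<Omega> \<longrightarrow> G x = G' x"
proof -
  have G: "locally_integrable \<Omega> G" "locally_integrable \<Omega> G'"
    using assms by (auto simp: has_weak_gradient_def)
  have *: "AE x in lebesgue. x \<in> \<Omega> \<longrightarrow> (G x - G' x) $ i \<bullet> b = 0" for i and b :: 'b
  proof (rule fundamental_lemma_real[OF assms(1)])
    have bl: "bounded_linear (\<lambda>y::'b^'n. y $ i \<bullet> b)"
      by (intro bounded_linear_compose[OF bounded_linear_inner_left bounded_linear_vec_nth])
    have "locally_integrable \<Omega> (\<lambda>x. G x $ i \<bullet> b)" "locally_integrable \<Omega> (\<lambda>x. G' x $ i \<bullet> b)"
      using locally_integrable_bounded_linear[OF bl] G by auto
    then show "locally_integrable \<Omega> (\<lambda>x. (G x - G' x) $ i \<bullet> b)"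
      by (auto simp: locally_integrable_def inner_diff_left intro!: set_integral_diff)
    fix \<phi> :: "real^'n \<Rightarrow> real" assume \<phi>: "\<phi> \<in> C_c \<infinity> \<Omega> UNIV"
    have li: "locally_integrable \<Omega> (\<lambda>x. G x $ i)" "locally_integrable \<Omega> (\<lambda>x. G' x $ i)"
      using locally_integrable_bounded_linear[OF bounded_linear_vec_nth] G by auto
    note int = li[THEN test_function_times_locally_integrable[OF \<phi>]]
    have eq: "(\<integral>x\<in>\<Omega>. \<phi> x *\<^sub>R (G x $ i) \<partial>lebesgue) = (\<integral>x\<in>\<Omega>. \<phi> x *\<^sub>R (G' x $ i) \<partial>lebesgue)"
      using assms(2)[unfolded has_weak_gradient_def, THEN conjunct2, THEN conjunct2, rule_format, OF \<phi>, of i]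
        assms(3)[unfolded has_weak_gradient_def, THEN conjunct2, THEN conjunct2, rule_format, OF \<phi>, of i]
      by simp
    have "(\<integral>x\<in>\<Omega>. \<phi> x *\<^sub>R ((G x - G' x) $ i \<bullet> b) \<partial>lebesgue)
        = (\<integral>x\<in>\<Omega>. (\<phi> x *\<^sub>R (G x $ i) - \<phi> x *\<^sub>R (G' x $ i)) \<bullet> b \<partial>lebesgue)"
      unfolding set_lebesgue_integral_def
      by (intro Bochner_Integration.integral_cong) (auto simp: inner_diff_left right_diff_distrib)
    also have "\<dots> = (\<integral>x\<in>\<Omega>. \<phi> x *\<^sub>R (G x $ i) - \<phi> x *\<^sub>R (G' x $ i) \<partial>lebesgue) \<bullet> b"
      using set_integral_diff(1)[OF int] unfolding set_lebesgue_integral_def set_integrable_def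
      by (subst integral_inner_left[symmetric]) auto
    also have "\<dots> = 0"
      using set_integral_diff(2)[OF int] eq by simp
    finally show "(\<integral>x\<in>\<Omega>. \<phi> x *\<^sub>R ((G x - G' x) $ i \<bullet> b) \<partial>lebesgue) = 0" .
  qed
  have "AE x in lebesgue. \<forall>i\<in>UNIV. \<forall>b\<in>Basis. x \<in> \<Omega> \<longrightarrow> (G x - G' x) $ i \<bullet> b = 0"
    using * by (intro AE_finite_allI) auto
  then show ?thesis
  proof eventually_elim
    case (elim x)
    show ?case
    proof
      assume "x \<in> \<Omega>"
      then have "(G x - G' x) $ i = 0" for i
        using elim by (intro euclidean_eqI[of "(G x - G' x) $ i"]) (metis UNIV_I inner_zero_left)
      then show "G x = G' x" by (simp add: vec_eq_iff)
    qed
  qed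
qed

section \<open>Differentiation under the integral sign\<close>

text \<open>
  By the mean value theorem a bound for the derivative in \<open>t\<close> is a bound for the difference quotients, so dominated
  convergence applies. The derivative is measurable in \<open>x\<close> as the limit of a sequence of difference quotients.
\<close>

lemma derivative_under_integral:
  fixes f f' :: "real \<Rightarrow> 'a \<Rightarrow> real"
  assumes d: "d > 0" and int: "\<And>t. \<bar>t - t0\<bar> < d \<Longrightarrow> integrable M (f t)"
    and der: "\<And>t x. \<bar>t - t0\<bar> < d \<Longrightarrow> x \<in> space M \<Longrightarrow> ((\<lambda>s. f s x) has_real_derivative f' t x) (at t)"
    and bound: "\<And>t x. \<bar>t - t0\<bar> < d \<Longrightarrow> x \<in> space M \<Longrightarrow> \<bar>f' t x\<bar> \<le> g x"
    and g: "integrable M g"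
  shows "integrable M (f' t0)"
    and "((\<lambda>t. \<integral>x. f t x \<partial>M) has_real_derivative (\<integral>x. f' t0 x \<partial>M)) (at t0)"
proof -
  have quot: "\<bar>(f t x - f t0 x) / (t - t0)\<bar> \<le> g x" if t: "\<bar>t - t0\<bar> < d" "t \<noteq> t0" and x: "x \<in> space M" for t x
  proof -
    have "norm (f t x - f t0 x) \<le> g x * norm (t - t0)"
    proof (rule field_differentiable_bound[where S = "ball t0 d" and f' = "\<lambda>t. f' t x"])
      show "((\<lambda>s. f s x) has_field_derivative f' s x) (at s within ball t0 d)" if "s \<in> ball t0 d" for s
        using der[OF _ x, of s] that by (auto simp: dist_real_def abs_minus_commute intro: has_field_derivative_at_within)
      show "norm (f' s x) \<le> g x" if "s \<in> ball t0 d" for s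
        using bound[OF _ x, of s] that by (auto simp: dist_real_def abs_minus_commute)
    qed (use t d in \<open>auto simp: dist_real_def abs_minus_commute\<close>)
    then show ?thesis using t by (simp add: abs_divide divide_le_eq)
  qed
  have lim: "((\<lambda>t. (f t x - f t0 x) / (t - t0)) \<longlongrightarrow> f' t0 x) (at t0)" if "x \<in> space M" for x
    using der[of t0 x] that d by (simp add: has_field_derivative_iff)
  have meas: "f' t0 \<in> borel_measurable M"
  proof (rule borel_measurable_LIMSEQ_real)
    let ?X = "\<lambda>n. t0 + d / real (n + 2)"
    have "d / real (n + 2) < d" for n
      using d by (simp add: divide_less_eq)
    then have "f (?X n) \<in> borel_measurable M" for n
      using d by (intro borel_measurable_integrable int) simp
    moreover have "f t0 \<in> borel_measurable M"
      using d by (intro borel_measurable_integrable int) simp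
    ultimately show "(\<lambda>x. (f (?X n) x - f t0 x) / (?X n - t0)) \<in> borel_measurable M" for n
      by (intro borel_measurable_divide borel_measurable_diff) simp_all
    have X: "filterlim ?X (at t0) sequentially"
    proof (rule filterlim_atI)
      have "(\<lambda>n. t0 + d * (1 / real n)) \<longlonglongrightarrow> t0 + d * 0"
        by (intro tendsto_intros lim_1_over_n)
      from LIMSEQ_ignore_initial_segment[OF this, of 2] show "?X \<longlonglongrightarrow> t0" by (simp add: add.commute)
    qed (use d in auto)
    show "(\<lambda>n. (f (?X n) x - f t0 x) / (?X n - t0)) \<longlonglongrightarrow> f' t0 x" if "x \<in> space M" for x
      using filterlim_compose[OF lim[OF that] X] .
  qed
  show f'_int: "integrable M (f' t0)"
    by (rule Bochner_Integration.integrable_bound[OF g meas]) (use bound[of t0] d in \<open>auto intro!: AE_I2 order_trans[OF _ abs_ge_self]\<close>)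
  show "((\<lambda>t. \<integral>x. f t x \<partial>M) has_real_derivative (\<integral>x. f' t0 x \<partial>M)) (at t0)"
    unfolding has_field_derivative_iff tendsto_at_iff_sequentially
  proof (intro allI impI)
    fix X :: "nat \<Rightarrow> real" assume X: "\<forall>i. X i \<in> UNIV - {t0}" "X \<longlonglongrightarrow> t0"
    then obtain N where N: "\<And>n. n \<ge> N \<Longrightarrow> \<bar>X n - t0\<bar> < d"
      using d by (auto simp: LIMSEQ_def dist_real_def) blast
    define Y where "Y n = X (n + N)" for n
    have Y: "Y n \<noteq> t0" "\<bar>Y n - t0\<bar> < d" for n using X(1) N by (auto simp: Y_def)
    have Ylim: "filterlim Y (at t0) sequentially"
      using Y(1) LIMSEQ_ignore_initial_segment[OF X(2), of N]
      by (intro filterlim_atI) (auto simp: Y_def[abs_def])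
    have "(\<lambda>n. \<integral>x. (f (Y n) x - f t0 x) / (Y n - t0) \<partial>M) \<longlonglongrightarrow> (\<integral>x. f' t0 x \<partial>M)"
    proof (rule integral_dominated_convergence[where w = g])
      show "(\<lambda>x. (f (Y n) x - f t0 x) / (Y n - t0)) \<in> borel_measurable M" for n
        using int[of "Y n"] int[of t0] d Y(2) by (intro borel_measurable_divide borel_measurable_diff)
          (auto intro!: borel_measurable_integrable)
      show "AE x in M. (\<lambda>n. (f (Y n) x - f t0 x) / (Y n - t0)) \<longlonglongrightarrow> f' t0 x"
        using filterlim_compose[OF lim Ylim] by (intro AE_I2)
      show "AE x in M. norm ((f (Y n) x - f t0 x) / (Y n - t0)) \<le> g x" for n
        using quot[OF Y(2) Y(1)] by (intro AE_I2) simp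
    qed (use g meas in auto)
    moreover have "(\<integral>x. (f (Y n) x - f t0 x) / (Y n - t0) \<partial>M)
        = ((\<integral>x. f (Y n) x \<partial>M) - (\<integral>x. f t0 x \<partial>M)) / (Y n - t0)" for n
      using int[OF Y(2)] int[of t0] d by (simp add: Bochner_Integration.integral_diff)
    ultimately have "(\<lambda>n. ((\<integral>x. f (Y n) x \<partial>M) - (\<integral>x. f t0 x \<partial>M)) / (Y n - t0)) \<longlonglongrightarrow> (\<integral>x. f' t0 x \<partial>M)"
      by (simp only:)
    then have "(\<lambda>n. ((\<integral>x. f (X n) x \<partial>M) - (\<integral>x. f t0 x \<partial>M)) / (X n - t0)) \<longlonglongrightarrow> (\<integral>x. f' t0 x \<partial>M)"
      unfolding Y_def by (rule LIMSEQ_offset)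
    then show "((\<lambda>y. ((\<integral>x. f y x \<partial>M) - (\<integral>x. f t0 x \<partial>M)) / (y - t0)) \<circ> X) \<longlonglongrightarrow> (\<integral>x. f' t0 x \<partial>M)"
      by (simp add: o_def)
  qed
qed

section \<open>Integrals of derivatives\<close>

lemma frechet_derivative_zero_on_open:
  assumes "open U" "x \<in> U" "\<And>y. y \<in> U \<Longrightarrow> f y = 0"
  shows "(f has_derivative (\<lambda>_. 0)) (at x)" "frechet_derivative f (at x) v = 0"
proof -
  show *: "(f has_derivative (\<lambda>_. 0)) (at x)"
    by (rule has_derivative_transform_within_open[of "\<lambda>_. 0" _ _ _ U]) (use assms in auto)
  show "frechet_derivative f (at x) v = 0" using frechet_derivative_at[OF *] by metis
qed

text \<open>
  The integral of \<open>x \<mapsto> \<psi> (x + t v)\<close> does not depend on \<open>t\<close>; differentiate it at \<open>t = 0\<close>.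
\<close>

lemma integral_partial_derivative_eq_0:
  fixes \<psi> :: "'a::euclidean_space \<Rightarrow> real"
  assumes \<psi>: "C_k 1 \<psi>" and R: "\<And>x. x \<notin> cball 0 R \<Longrightarrow> \<psi> x = 0" and v: "v \<in> Basis"
  shows "(\<integral>x. frechet_derivative \<psi> (at x) v \<partial>lebesgue) = 0"
proof -
  let ?D = "\<lambda>x. frechet_derivative \<psi> (at x) v"
  \<comment> \<open>The radius is larger by 1 because of the translations by \<open>t v\<close> with \<open>|t| < 1\<close>.\<close>
  let ?K = "cball 0 (max R 0 + 1) :: 'a set"
  have C1: "C_k_on 1 UNIV \<psi>" using \<psi> by (simp only: C_k_on_UNIV)
  have der: "(\<psi> has_derivative frechet_derivative \<psi> (at x)) (at x)" for x
    using C1 by (simp add: frechet_derivative_works[symmetric])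
  have cD: "continuous_on UNIV ?D" using C1 v by simp
  have c\<psi>: "continuous_on UNIV \<psi>" by (rule C_k_on_imp_continuous_on[OF C1])
  have D0: "?D x = 0" if "x \<notin> cball 0 R" for x
    using that R by (intro frechet_derivative_zero_on_open[of "- cball 0 R"]) auto
  have "continuous_on (cball 0 R) ?D" using cD by (rule continuous_on_subset) simp
  then obtain C where C: "C \<ge> 0" "\<And>x. x \<in> cball 0 R \<Longrightarrow> norm (?D x) \<le> C"
    using continuous_on_compact_bound[OF compact_cball] by metis
  have int: "integrable lborel \<psi>"
  proof -
    have "integrable lborel (\<lambda>x. indicator (cball 0 R) x *\<^sub>R \<psi> x)"
      by (rule borel_integrable_compact) (use continuous_on_subset[OF c\<psi>] in auto)
    moreover have "(\<lambda>x. indicator (cball 0 R) x *\<^sub>R \<psi> x) = \<psi>"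
    proof
      show "indicator (cball 0 R) x *\<^sub>R \<psi> x = \<psi> x" for x
        using R[of x] by (cases "x \<in> cball 0 R") auto
    qed
    ultimately show ?thesis by simp
  qed
  have trans: "integrable lborel (\<lambda>x. \<psi> (c + x))" "(\<integral>x. \<psi> (c + x) \<partial>lborel) = (\<integral>x. \<psi> x \<partial>lborel)" for c
  proof -
    have m: "(+) c \<in> measurable lborel borel" by simp
    show "integrable lborel (\<lambda>x. \<psi> (c + x))"
      using int integrable_distr[OF m, of \<psi>] by (simp add: lborel_distr_plus)
    show "(\<integral>x. \<psi> (c + x) \<partial>lborel) = (\<integral>x. \<psi> x \<partial>lborel)"
      using integral_distr[OF m borel_measurable_continuous_onI[OF c\<psi>]] by (simp add: lborel_distr_plus)
  qed
  have "((\<lambda>t. \<integral>x. \<psi> (t *\<^sub>R v + x) \<partial>lborel) has_real_derivative (\<integral>x. ?D (0 *\<^sub>R v + x) \<partial>lborel)) (at 0)"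
  proof (rule derivative_under_integral(2)[where d = 1 and g = "\<lambda>x. indicator ?K x *\<^sub>R C"])
    fix t :: real and x :: 'a
    assume t: "\<bar>t - 0\<bar> < 1"
    have "((\<lambda>s. \<psi> (s *\<^sub>R v + x)) has_derivative (\<lambda>s. frechet_derivative \<psi> (at (t *\<^sub>R v + x)) (s *\<^sub>R v))) (at t)"
      by (rule has_derivative_compose[OF _ der]) (auto intro!: derivative_eq_intros)
    moreover have "frechet_derivative \<psi> (at (t *\<^sub>R v + x)) (s *\<^sub>R v) = ?D (t *\<^sub>R v + x) * s" for s
      using linear_scale[OF has_derivative_linear[OF der], of _ s v] by simp
    then have "(\<lambda>s. frechet_derivative \<psi> (at (t *\<^sub>R v + x)) (s *\<^sub>R v)) = (*) (?D (t *\<^sub>R v + x))"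
      by (rule ext)
    ultimately show "((\<lambda>s. \<psi> (s *\<^sub>R v + x)) has_real_derivative ?D (t *\<^sub>R v + x)) (at t)"
      unfolding has_field_derivative_def by argo
    show "\<bar>?D (t *\<^sub>R v + x)\<bar> \<le> indicator ?K x *\<^sub>R C"
    proof (cases "x \<in> ?K")
      case True
      then show ?thesis using C D0[of "t *\<^sub>R v + x"] by (cases "t *\<^sub>R v + x \<in> cball 0 R") auto
    next
      case False
      have "norm x \<le> norm (t *\<^sub>R v + x) + norm (t *\<^sub>R v)"
        using norm_triangle_ineq4[of "t *\<^sub>R v + x" "t *\<^sub>R v"] by simp
      also have "norm (t *\<^sub>R v) < 1" using t v by simp
      finally have "t *\<^sub>R v + x \<notin> cball 0 R" using False by auto
      then show ?thesis using D0 False by simp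
    qed
  qed (use trans borel_integrable_compact[of ?K "\<lambda>_. C"] in auto)
  then have "((\<lambda>t. \<integral>x. \<psi> x \<partial>lborel) has_real_derivative (\<integral>x. ?D x \<partial>lborel)) (at 0)"
    by (simp add: trans)
  then have "(\<integral>x. ?D x \<partial>lborel) = 0" using DERIV_const DERIV_unique by blast
  then show ?thesis
    using borel_measurable_continuous_onI[OF cD] by (simp add: integral_completion)
qed

section \<open>Point singularities in three dimensions\<close>

lemma measure_cball_3: "measure lborel (cball (0::real^3) r) = r ^ 3 * measure lborel (ball (0::real^3) 1)" if "r \<ge> 0"
  using content_ball_conv_unit_ball[OF that, of "0::real^3"] by (simp add: content_cball_conv_ball)

text \<open>
  On the dyadic shell \<open>2^-(j+1) < |x| \<le> 2^-j\<close> the function is at most \<open>4^(j+1)\<close>, and the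
  shell has volume of order \<open>8^-j\<close>.
\<close>

lemma integrable_inverse_square:
  "integrable lebesgue (\<lambda>x::real^3. indicator (cball 0 1) x * (1 / (norm x)\<^sup>2))"
proof -
  define S where "S j = cball (0::real^3) ((1/2) ^ j) - {0}" for j :: nat
  define f where "f j x = 4 ^ Suc j * indicat_real (S j) x" for j x
  have mS: "measure lborel (S j) = (1/8) ^ j * measure lborel (ball (0::real^3) 1)" for j
  proof -
    have "measure lborel (S j) = measure lborel (cball (0::real^3) ((1/2) ^ j))"
      unfolding S_def using measure_lborel_singleton by (intro measure_Diff_null_set) auto
    moreover have "((1/2) ^ j) ^ 3 = (1/8 :: real) ^ j"
      by (simp add: power3_eq_cube power_mult_distrib[symmetric])
    ultimately show ?thesis using measure_cball_3[of "(1/2) ^ j"] by simp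
  qed
  have fin: "emeasure lborel (S j) < \<infinity>" for j
    unfolding S_def by (rule le_less_trans[OF emeasure_mono emeasure_lborel_cball_finite[of 0 "(1/2) ^ j"]]) auto
  have intS: "integrable lborel (indicat_real (S j))" for j
    using fin by (intro integrable_real_indicator) (auto simp: S_def)
  have Sempty: "indicat_real (S j) x = 0" if "(1/2) ^ i < norm x" "i \<le> j" for i j x
  proof -
    have "(1/2::real) ^ j \<le> (1/2) ^ i" using that(2) by (intro power_decreasing) auto
    from this that(1) have "(1/2) ^ j < norm x" by (rule le_less_trans)
    then have "x \<notin> S j" by (auto simp: S_def)
    then show ?thesis by simp
  qed
  have summ: "summable (\<lambda>j. f j x)" for x
  proof (cases "x = 0")
    case True
    then show ?thesis by (simp add: f_def S_def)
  next
    case False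
    then obtain i where "(1/2) ^ i < norm x" using real_arch_pow_inv[of "norm x" "1/2"] by auto
    then show ?thesis
      using Sempty by (intro summable_finite[of "{..<i}"]) (auto simp: f_def not_less)
  qed
  have "integrable lborel (\<lambda>x. \<Sum>j. f j x)"
  proof (rule integrable_suminf)
    show "integrable lborel (f j)" for j
      unfolding f_def using intS by simp
    show "AE x in lborel. summable (\<lambda>j. norm (f j x))"
      using summ by (intro AE_I2) (simp add: f_def)
    have "(\<integral>x. norm (f j x) \<partial>lborel) = 4 * measure lborel (ball (0::real^3) 1) * (1/2) ^ j" for j
      using fin[of j] by (simp add: f_def mS power_mult_distrib[symmetric] mult.assoc)
    then show "summable (\<lambda>j. \<integral>x. norm (f j x) \<partial>lborel)"
      by (simp add: summable_mult summable_geometric)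
  qed
  moreover have meas: "(\<lambda>x::real^3. indicator (cball 0 1) x * (1 / (norm x)\<^sup>2)) \<in> borel_measurable borel"
    by (intro borel_measurable_times borel_measurable_indicator borel_measurable_divide borel_measurable_power
        borel_measurable_norm borel_measurable_const measurable_ident_sets) auto
  ultimately have "integrable lborel (\<lambda>x::real^3. indicator (cball 0 1) x * (1 / (norm x)\<^sup>2))"
  proof (elim Bochner_Integration.integrable_bound)
    show "AE x::real^3 in lborel. norm (indicator (cball 0 1) x * (1 / (norm x)\<^sup>2)) \<le> norm (\<Sum>j. f j x)"
    proof (rule AE_I2)
      fix x :: "real^3"
      have f0: "f j x \<ge> 0" for j by (simp add: f_def)
      show "norm (indicator (cball 0 1) x * (1 / (norm x)\<^sup>2)) \<le> norm (\<Sum>j. f j x)"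
      proof (cases "x \<noteq> 0 \<and> norm x \<le> 1")
        case False
        then show ?thesis by (auto simp: indicator_def)
      next
        case True
        define j where "j = (LEAST i. (1/2::real) ^ Suc i < norm x)"
        obtain i where "(1/2) ^ i < norm x" using real_arch_pow_inv[of "norm x" "1/2"] True by auto
        then have "(1/2) ^ Suc i < norm x" by (rule le_less_trans[rotated]) (simp add: power_Suc)
        then have j: "(1/2) ^ Suc j < norm x" unfolding j_def by (rule LeastI)
        have xS: "x \<in> S j"
        proof (cases j)
          case (Suc k)
          then have "\<not> (1/2) ^ Suc k < norm x" unfolding j_def by (metis lessI not_less_Least)
          then show ?thesis using Suc True by (simp add: S_def)
        qed (use True in \<open>simp add: S_def\<close>)
        have "((1/2) ^ Suc j)\<^sup>2 \<le> (norm x)\<^sup>2" using j by (intro power_mono) auto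
        then have "1 / (norm x)\<^sup>2 \<le> 1 / ((1/2) ^ Suc j)\<^sup>2"
          using True by (intro divide_left_mono) auto
        also have "\<dots> = 4 ^ Suc j" by (simp add: power_divide power_mult[symmetric] mult.commute[of _ 2] power_mult)
        also have "\<dots> = f j x" using xS by (simp add: f_def)
        also have "\<dots> \<le> (\<Sum>j. f j x)"
          using sum_le_suminf[OF summ, of "{j}" x] f0 by simp
        finally have "1 / (norm x)\<^sup>2 \<le> (\<Sum>j. f j x)" .
        then show ?thesis using True by simp
      qed
    qed
  qed (use meas in simp)
  then show ?thesis using meas by (subst integrable_completion) auto
qed

lemma measurable_of_continuous_off_0:
  fixes f :: "'a::euclidean_space \<Rightarrow> 'b::euclidean_space"
  assumes "continuous_on (- {0}) f"
  shows "f \<in> borel_measurable borel" "f \<in> borel_measurable lebesgue"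
proof -
  have "(\<lambda>x. if x \<in> - {0} then f x else f 0) \<in> borel_measurable borel"
    by (rule borel_measurable_continuous_on_if) (use assms in auto)
  moreover have "(\<lambda>x. if x \<in> - {0} then f x else f 0) = f" by auto
  ultimately show *: "f \<in> borel_measurable borel" by simp
  then show "f \<in> borel_measurable lebesgue" by (intro measurable_completion) simp
qed

lemma AE_lebesgue_neq_0: "AE x::real^3 in lebesgue. x \<noteq> 0"
  using AE_not_in[of "{0::real^3}" lebesgue] by (simp add: negligible_iff_null_sets[symmetric])

lemma AE_lebesgue_norm_neq_1: "AE x::real^3 in lebesgue. norm x \<noteq> 1"
  using AE_not_in[of "sphere (0::real^3) 1" lebesgue]
  by (simp add: negligible_iff_null_sets[symmetric] negligible_sphere)

text \<open>
  This holds because Lebesgue measure is complete.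
\<close>

lemma measurable_lebesgue_AE_cong:
  fixes f g :: "'a::euclidean_space \<Rightarrow> 'b::topological_space"
  assumes f: "f \<in> borel_measurable lebesgue" and ae: "AE x in lebesgue. f x = g x"
  shows "g \<in> borel_measurable lebesgue"
proof -
  obtain N where N: "N \<in> null_sets lebesgue" "\<And>x. f x \<noteq> g x \<Longrightarrow> x \<in> N"
    using ae unfolding eventually_ae_filter by auto
  have "g -` A \<inter> space lebesgue \<in> sets lebesgue" if "A \<in> sets borel" for A
  proof -
    have "g -` A \<inter> N \<in> sets lebesgue"
    proof -
      obtain N' where N': "N' \<in> null_sets lborel" "N \<subseteq> N'"
        using N(1) unfolding null_sets_completion_iff2 by blast
      then have "g -` A \<inter> N \<in> null_sets lebesgue"
        unfolding null_sets_completion_iff2 by blast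
      then show ?thesis by auto
    qed
    moreover have "f -` A \<inter> space lebesgue \<in> sets lebesgue" using f that by (rule measurable_sets)
    moreover have "g -` A \<inter> space lebesgue = (f -` A \<inter> space lebesgue - N) \<union> (g -` A \<inter> N)"
    proof -
      have "f x = g x" if "x \<notin> N" for x using N(2) that by blast
      then show ?thesis by fastforce
    qed
    ultimately show ?thesis using N(1) by (metis null_setsD2 sets.Diff sets.Un)
  qed
  then show ?thesis by (intro measurableI) auto
qed

lemma integral_lebesgue_cong_AE:
  fixes f g :: "'a::euclidean_space \<Rightarrow> real"
  assumes f: "integrable lebesgue f" and ae: "AE x in lebesgue. f x = g x"
  shows "integrable lebesgue g" "(\<integral>x. f x \<partial>lebesgue) = (\<integral>x. g x \<partial>lebesgue)"
proof -
  have m: "f \<in> borel_measurable lebesgue" using f by (rule borel_measurable_integrable)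
  note m' = measurable_lebesgue_AE_cong[OF m ae]
  show "integrable lebesgue g" using integrable_cong_AE[OF m m' ae] f by simp
  show "(\<integral>x. f x \<partial>lebesgue) = (\<integral>x. g x \<partial>lebesgue)" by (rule integral_cong_AE[OF m m' ae])
qed

text \<open>
  The only integrability criterion for singular functions below: the density of the Dirichlet energy of \<open>hedgehog\<close> and of its
  variations is of this order.
\<close>

lemma set_integrable_inverse_square_bound:
  fixes f :: "real^3 \<Rightarrow> 'b::euclidean_space"
  assumes "f \<in> borel_measurable lebesgue" "A \<in> sets lebesgue" "A \<subseteq> cball 0 1"
    and b: "\<And>x. x \<in> A \<Longrightarrow> x \<noteq> 0 \<Longrightarrow> norm (f x) \<le> C / (norm x)\<^sup>2"
  shows "set_integrable lebesgue A f"
  unfolding set_integrable_def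
proof (rule Bochner_Integration.integrable_bound)
  show "integrable lebesgue (\<lambda>x::real^3. \<bar>C\<bar> * (indicator (cball 0 1) x * (1 / (norm x)\<^sup>2)))"
    by (intro integrable_mult_right integrable_inverse_square)
  show "(\<lambda>x. indicat_real A x *\<^sub>R f x) \<in> borel_measurable lebesgue"
    using assms by (intro borel_measurable_scaleR borel_measurable_indicator)
  show "AE x in lebesgue. norm (indicator A x *\<^sub>R f x) \<le> norm (\<bar>C\<bar> * (indicator (cball 0 1) x * (1 / (norm x)\<^sup>2)))"
    using AE_lebesgue_neq_0
  proof eventually_elim
    case (elim x)
    have "C / (norm x)\<^sup>2 \<le> \<bar>C\<bar> / (norm x)\<^sup>2" by (intro divide_right_mono) auto
    then show ?case using b[of x] elim assms(3) by (auto simp: indicator_def)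
  qed
qed

text \<open>
  A singularity of order \<open>1/|x|\<close> at a point does not disturb integration of derivatives: multiply by
  \<open>smooth_step (n\<^sup>2 |x|\<^sup>2)\<close>, whose gradient is bounded by a constant times \<open>1/|x|\<close> uniformly in \<open>n\<close>,
  so that all terms are dominated by a multiple of the integrable function \<open>1/|x|\<^sup>2\<close>.
\<close>

lemma set_integral_partial_derivative_singular:
  fixes \<psi> :: "real^3 \<Rightarrow> real"
  assumes \<psi>: "C_k_on 1 (- {0}) \<psi>" and supp: "\<And>x. x \<notin> ball 0 1 \<Longrightarrow> \<psi> x = 0" and v: "v \<in> Basis"
    and b0: "\<And>x. x \<noteq> 0 \<Longrightarrow> norm x < 1 \<Longrightarrow> \<bar>\<psi> x\<bar> \<le> C / norm x"
    and D: "\<And>x. x \<noteq> 0 \<Longrightarrow> norm x < 1 \<Longrightarrow> (\<psi> has_derivative D x) (at x)"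
    and b1: "\<And>x. x \<noteq> 0 \<Longrightarrow> norm x < 1 \<Longrightarrow> \<bar>D x v\<bar> \<le> C / (norm x)\<^sup>2"
  shows "set_integrable lebesgue B1 (\<lambda>x. D x v)" and "(\<integral>x\<in>B1. D x v \<partial>lebesgue) = 0"
proof -
  let ?D = "\<lambda>x. frechet_derivative \<psi> (at x) v"
  have der: "(\<psi> has_derivative frechet_derivative \<psi> (at x)) (at x)" if "x \<noteq> 0" for x
    using \<psi> that by (simp add: frechet_derivative_works[symmetric])
  have D_eq: "?D x = D x v" if "x \<noteq> 0" "norm x < 1" for x
    using fun_cong[OF frechet_derivative_at[OF D[OF that]], of v] by simp
  have cD: "continuous_on (- {0}) ?D" using \<psi> v by simp
  have mD: "?D \<in> borel_measurable lebesgue" by (rule measurable_of_continuous_off_0[OF cD])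
  have D0: "?D x = 0" if "1 < norm x" for x
    by (rule frechet_derivative_zero_on_open(2)[of "- cball 0 1"]) (use that supp in auto)
  have ae: "AE x in lebesgue. indicator B1 x *\<^sub>R ?D x = indicator B1 x *\<^sub>R D x v"
    using AE_lebesgue_neq_0 by (rule eventually_mono) (auto simp: indicator_def D_eq)

  have ae': "AE x in lebesgue. ?D x = indicator B1 x *\<^sub>R ?D x"
    using AE_lebesgue_norm_neq_1
  proof (rule eventually_mono)
    fix x :: "real^3" assume "norm x \<noteq> 1"
    then show "?D x = indicator B1 x *\<^sub>R ?D x" using D0[of x] by (cases "norm x < 1") auto
  qed
  have "set_integrable lebesgue B1 ?D"
    by (rule set_integrable_inverse_square_bound[OF mD, of _ C]) (use b1 D_eq ball_subset_cball in auto)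
  then have int: "integrable lebesgue (\<lambda>x. indicator B1 x *\<^sub>R ?D x)" by (simp add: set_integrable_def)
  show "set_integrable lebesgue B1 (\<lambda>x. D x v)"
    using integral_lebesgue_cong_AE(1)[OF int ae] by (simp add: set_integrable_def)
  obtain C' where C': "C' > 0" "\<And>t. \<bar>smooth_step' t\<bar> \<le> C'" using smooth_step'_bounded by blast
  define \<eta> where "\<eta> n x = smooth_step ((real n)\<^sup>2 * (x \<bullet> x))" for n and x :: "real^3"
  define E where "E n x = \<eta> n x * ?D x + smooth_step' ((real n)\<^sup>2 * (x \<bullet> x)) * ((real n)\<^sup>2 * (2 * (x \<bullet> v))) * \<psi> x" for n x
  have d\<eta>: "(\<eta> n has_derivative (\<lambda>h. smooth_step' ((real n)\<^sup>2 * (x \<bullet> x)) * ((real n)\<^sup>2 * (2 * (x \<bullet> h))))) (at x)" for n x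
  proof -
    have "((\<lambda>x. (real n)\<^sup>2 * (x \<bullet> x)) has_derivative (\<lambda>h. (real n)\<^sup>2 * (2 * (x \<bullet> h)))) (at x)"
      by (auto intro!: derivative_eq_intros simp: inner_commute)
    from has_derivative_compose[OF this smooth_step_has_derivative[unfolded has_field_derivative_def]]
    show ?thesis by (simp add: \<eta>_def[abs_def])
  qed
  have near0: "\<eta> n x = 0" if "norm x < 1 / real n" for n x
  proof -
    have "n \<noteq> 0" using that by (cases n) auto
    then have "(real n * norm x)\<^sup>2 \<le> 1" using that by (intro power_le_one) (auto simp: field_simps)
    then show ?thesis by (simp add: \<eta>_def smooth_step_simps power_mult_distrib power2_norm_eq_inner)
  qed
  have zero: "(\<integral>x. frechet_derivative (\<lambda>x. \<eta> (Suc n) x * \<psi> x) (at x) v \<partial>lebesgue) = 0" for n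
  proof (rule integral_partial_derivative_eq_0[where R = 1])
    have c\<eta>: "C_k_on 1 (- {0}) (\<eta> (Suc n))"
      unfolding \<eta>_def[abs_def]
      by (intro C_k_on_compose[OF _ C_k_smooth_step] C_k_on_mult C_k_on_const C_k_on_inner C_k_on_ident) auto
    have "C_k_on 1 (- {0}) (\<lambda>x. \<eta> (Suc n) x * \<psi> x)"
      by (intro C_k_on_mult c\<eta> \<psi>) auto
    moreover have "C_k_on 1 (ball 0 (1 / real (Suc n))) (\<lambda>x. \<eta> (Suc n) x * \<psi> x)"
      by (rule C_k_on_cong[OF _ C_k_on_const[of _ _ 0]]) (auto simp: near0)
    ultimately have "C_k_on 1 (- {0} \<union> ball 0 (1 / real (Suc n))) (\<lambda>x. \<eta> (Suc n) x * \<psi> x)"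
      by (intro C_k_on_Un) auto
    moreover have "- {0} \<union> ball 0 (1 / real (Suc n)) = (UNIV :: (real^3) set)" by auto
    ultimately show "C_k 1 (\<lambda>x. \<eta> (Suc n) x * \<psi> x)" by (simp only: C_k_on_UNIV)
  qed (use supp v in auto)
  have der_eq: "frechet_derivative (\<lambda>x. \<eta> n x * \<psi> x) (at x) v = E n x" if "x \<noteq> 0" for n x
  proof -
    have "((\<lambda>x. \<eta> n x * \<psi> x) has_derivative (\<lambda>h. \<eta> n x * frechet_derivative \<psi> (at x) h
        + smooth_step' ((real n)\<^sup>2 * (x \<bullet> x)) * ((real n)\<^sup>2 * (2 * (x \<bullet> h))) * \<psi> x)) (at x)"
      by (rule has_derivative_mult[OF d\<eta> der[OF that]])
    from fun_cong[OF frechet_derivative_at[OF this], of v] show ?thesis by (simp add: E_def)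
  qed
  have contE: "continuous_on (- {0}) (E n)" for n
  proof -
    have c1: "continuous_on (- {0}) (\<lambda>x::real^3. (real n)\<^sup>2 * (x \<bullet> x))" by (intro continuous_intros)
    have c2: "continuous_on (- {0}) (\<eta> n)"
      using d\<eta> by (intro continuous_at_imp_continuous_on ballI has_derivative_continuous)
    have c3: "continuous_on (- {0}) (\<lambda>x::real^3. smooth_step' ((real n)\<^sup>2 * (x \<bullet> x)))"
      by (rule continuous_on_compose2[OF continuous_smooth_step' c1]) simp
    have c4: "continuous_on (- {0}) (\<lambda>x::real^3. (real n)\<^sup>2 * (2 * (x \<bullet> v)))" by (intro continuous_intros)
    show ?thesis
      unfolding E_def[abs_def]
      by (intro continuous_on_add continuous_on_mult c2 c3 c4 cD C_k_on_imp_continuous_on[OF \<psi>])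
  qed
  have mE: "E n \<in> borel_measurable lebesgue" for n
    by (rule measurable_of_continuous_off_0[OF contE])
  have EI: "(\<integral>x. E (Suc n) x \<partial>lebesgue) = 0" for n
  proof -
    have "(\<integral>x. E (Suc n) x \<partial>lebesgue) = (\<integral>x. frechet_derivative (\<lambda>x. \<eta> (Suc n) x * \<psi> x) (at x) v \<partial>lebesgue)"
    proof (rule integral_cong_AE)
      show ae: "AE x in lebesgue. E (Suc n) x = frechet_derivative (\<lambda>x. \<eta> (Suc n) x * \<psi> x) (at x) v"
        using AE_lebesgue_neq_0 by eventually_elim (simp add: der_eq)
      have "continuous_on (- {0}) (\<lambda>x. frechet_derivative (\<lambda>x. \<eta> (Suc n) x * \<psi> x) (at x) v)"
        using contE[of "Suc n"] by (rule continuous_on_eq) (simp add: der_eq)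
      then show "(\<lambda>x. frechet_derivative (\<lambda>x. \<eta> (Suc n) x * \<psi> x) (at x) v) \<in> borel_measurable lebesgue"
        by (rule measurable_of_continuous_off_0)
    qed (rule mE)
    then show ?thesis using zero by simp
  qed
  have boundE: "\<bar>E n x\<bar> \<le> (1 + 4 * C') * \<bar>C\<bar> / (norm x)\<^sup>2" if x: "x \<noteq> 0" "norm x < 1" for n x
  proof -
    have "\<bar>\<eta> n x * ?D x\<bar> \<le> 1 * (\<bar>C\<bar> / (norm x)\<^sup>2)"
      unfolding abs_mult
    proof (rule mult_mono)
      show "\<bar>\<eta> n x\<bar> \<le> 1" by (simp add: \<eta>_def smooth_step_simps)
      show "\<bar>?D x\<bar> \<le> \<bar>C\<bar> / (norm x)\<^sup>2"
        using b1[OF x] unfolding D_eq[OF x] by (rule order_trans) (simp add: divide_right_mono)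
    qed auto
    moreover have "\<bar>smooth_step' ((real n)\<^sup>2 * (x \<bullet> x)) * ((real n)\<^sup>2 * (2 * (x \<bullet> v))) * \<psi> x\<bar>
        \<le> 4 * C' * \<bar>C\<bar> / (norm x)\<^sup>2"
    proof (cases "(real n)\<^sup>2 * (x \<bullet> x) > 2")
      case True
      then show ?thesis using C' by (simp add: smooth_step'_eq_0)
    next
      case False
      then have n: "(real n)\<^sup>2 \<le> 2 / (norm x)\<^sup>2"
        using x by (simp add: field_simps power2_norm_eq_inner not_less)
      have xv: "\<bar>x \<bullet> v\<bar> \<le> norm x" using Basis_le_norm[OF v] by simp
      have p: "\<bar>\<psi> x\<bar> \<le> \<bar>C\<bar> / norm x"
        using b0[OF x] by (rule order_trans) (simp add: divide_right_mono)
      have "\<bar>smooth_step' ((real n)\<^sup>2 * (x \<bullet> x)) * ((real n)\<^sup>2 * (2 * (x \<bullet> v))) * \<psi> x\<bar>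
          = \<bar>smooth_step' ((real n)\<^sup>2 * (x \<bullet> x))\<bar> * ((real n)\<^sup>2 * (2 * \<bar>x \<bullet> v\<bar>)) * \<bar>\<psi> x\<bar>"
        by (simp add: abs_mult)
      also have "\<dots> \<le> C' * (2 / (norm x)\<^sup>2 * (2 * norm x)) * (\<bar>C\<bar> / norm x)"
        using C' n xv p by (intro mult_mono) auto
      also have "\<dots> = 4 * C' * \<bar>C\<bar> / (norm x)\<^sup>2"
        using x by (simp add: field_simps power2_eq_square)
      finally show ?thesis .
    qed
    ultimately have "\<bar>E n x\<bar> \<le> \<bar>C\<bar> / (norm x)\<^sup>2 + 4 * C' * \<bar>C\<bar> / (norm x)\<^sup>2"
      unfolding E_def by linarith
    also have "\<dots> = (1 + 4 * C') * \<bar>C\<bar> / (norm x)\<^sup>2" by (simp add: algebra_simps add_divide_distrib)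
    finally show ?thesis .
  qed
  have limE: "(\<lambda>n. E (Suc n) x) \<longlonglongrightarrow> ?D x" if "x \<noteq> 0" for x
  proof (rule tendsto_eventually)
    obtain N where N: "2 / (norm x) < real N" using reals_Archimedean2 by blast
    show "\<forall>\<^sub>F n in sequentially. E (Suc n) x = ?D x"
    proof (rule eventually_sequentiallyI[of N])
      fix n assume "n \<ge> N"
      then have "2 / norm x < real (Suc n)" using N by linarith
      then have "2 < real (Suc n) * norm x" using that by (simp add: field_simps)
      then have "2\<^sup>2 < (real (Suc n) * norm x)\<^sup>2" by (intro power_strict_mono) auto
      then have "(real (Suc n))\<^sup>2 * (x \<bullet> x) > 2" by (simp add: power_mult_distrib power2_norm_eq_inner)
      then show "E (Suc n) x = ?D x"
        unfolding E_def \<eta>_def by (simp add: smooth_step'_eq_0 smooth_step_simps)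
    qed
  qed
  have "(\<lambda>n. \<integral>x. E (Suc n) x \<partial>lebesgue) \<longlonglongrightarrow> (\<integral>x. ?D x \<partial>lebesgue)"
  proof (rule integral_dominated_convergence[where
        w = "\<lambda>x. ((1 + 4 * C') * \<bar>C\<bar>) * (indicator (cball 0 1) x * (1 / (norm x)\<^sup>2))"])
    show "integrable lebesgue (\<lambda>x::real^3. ((1 + 4 * C') * \<bar>C\<bar>) * (indicator (cball 0 1) x * (1 / (norm x)\<^sup>2)))"
      by (intro integrable_mult_right integrable_inverse_square)
    show "AE x in lebesgue. (\<lambda>n. E (Suc n) x) \<longlonglongrightarrow> ?D x"
      using AE_lebesgue_neq_0 by eventually_elim (rule limE)
    show "AE x in lebesgue. norm (E (Suc n) x) \<le> ((1 + 4 * C') * \<bar>C\<bar>) * (indicator (cball 0 1) x * (1 / (norm x)\<^sup>2))" for n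
      using AE_lebesgue_neq_0 AE_lebesgue_norm_neq_1
    proof eventually_elim
      case (elim x)
      show ?case
      proof (cases "norm x < 1")
        case True
        then show ?thesis using boundE[OF elim(1) True, of "Suc n"] by simp
      next
        case False
        then show ?thesis using D0[of x] supp[of x] elim by (simp add: E_def)
      qed
    qed
  qed (use mD mE in auto)
  then have "(\<integral>x. ?D x \<partial>lebesgue) = 0" by (simp add: EI LIMSEQ_const_iff)
  moreover have "integrable lebesgue ?D"
    by (rule integral_lebesgue_cong_AE(1)[OF int]) (use ae' in \<open>rule eventually_mono, simp\<close>)
  ultimately show "(\<integral>x\<in>B1. D x v \<partial>lebesgue) = 0"
    using integral_lebesgue_cong_AE(2)[OF _ ae'] integral_lebesgue_cong_AE(2)[OF int ae]
    by (simp add: set_lebesgue_integral_def)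
qed

section \<open>Classical gradients are weak gradients\<close>

definition grad :: "(real^3 \<Rightarrow> 'b::real_normed_vector) \<Rightarrow> real^3 \<Rightarrow> 'b^3" where
  "grad f x = (\<chi> i. frechet_derivative f (at x) (axis i 1))"

lemma grad_nth: "grad f x $ i = frechet_derivative f (at x) (axis i 1)"
  by (simp add: grad_def)

lemma grad_eqI:
  assumes "(f has_derivative D) (at x)"
  shows "grad f x $ i = D (axis i 1)"
  using frechet_derivative_at[OF assms] by (simp add: grad_def)

lemma continuous_on_vecI:
  fixes f :: "'a::topological_space \<Rightarrow> 'b::real_normed_vector^'n"
  shows "(\<And>i. continuous_on S (\<lambda>x. f x $ i)) \<Longrightarrow> continuous_on S f"
  unfolding continuous_on_def by (auto intro: vec_tendstoI)

lemma continuous_on_grad: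
  "C_k_on 1 U f \<Longrightarrow> continuous_on U (grad f)"
  by (rule continuous_on_vecI) (simp add: grad_nth)

lemma norm_vec_power2: "(norm (x :: 'b::real_inner^'n))\<^sup>2 = (\<Sum>i\<in>UNIV. (norm (x $ i))\<^sup>2)"
  by (simp add: power2_norm_eq_inner inner_vec_def)

lemma inverse_le_inverse_square: "1 / norm x \<le> 1 / (norm x)\<^sup>2"
  if "x \<noteq> 0" "norm x \<le> 1" for x :: "'a::real_normed_vector"
proof -
  have "(norm x)\<^sup>2 \<le> norm x"
    using that mult_left_mono[of "norm x" 1 "norm x"] by (simp add: power2_eq_square)
  then show ?thesis using that by (intro divide_left_mono) auto
qed

lemma one_le_inverse: "1 \<le> 1 / norm x"
  if "x \<noteq> 0" "norm x \<le> 1" for x :: "'a::real_normed_vector"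
  using that by simp

lemma C_c_infinityD: "f \<in> C_c \<infinity> \<Omega> V \<Longrightarrow> C_k k f"
  by (simp add: C_c_def)

lemma C_c_eq_0: "f \<in> C_c k \<Omega> V \<Longrightarrow> x \<notin> \<Omega> \<Longrightarrow> f x = 0"
  using closure_subset[of "{x. f x \<noteq> 0}"] by (auto simp: C_c_def)

lemma locally_integrable_inverse_square_bound:
  fixes f :: "real^3 \<Rightarrow> 'b::euclidean_space"
  assumes "f \<in> borel_measurable lebesgue"
    and "\<And>x. x \<noteq> 0 \<Longrightarrow> norm x < 1 \<Longrightarrow> norm (f x) \<le> C / (norm x)\<^sup>2"
  shows "locally_integrable B1 f"
  unfolding locally_integrable_def
proof (intro allI impI)
  fix K :: "(real^3) set" assume K: "compact K \<and> K \<subseteq> B1"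
  then have "closed K" using compact_imp_closed by auto
  then have "K \<in> sets lebesgue" by auto
  then show "set_integrable lebesgue K f"
  proof (rule set_integrable_inverse_square_bound[OF assms(1)])
    show "K \<subseteq> cball 0 1" using K ball_subset_cball[of "0::real^3" 1] by auto
    show "norm (f x) \<le> C / (norm x)\<^sup>2" if "x \<in> K" "x \<noteq> 0" for x
      using assms(2)[of x] K that by auto
  qed
qed

text \<open>
  The distributional derivative of such a map has no part concentrated at the origin: for every test function \<open>\<phi>\<close> the
  product \<open>\<phi> f\<close> is bounded and its derivative is of order \<open>1/|x|\<close>, so that the integral of its derivative vanishes.
\<close>

lemma has_weak_gradient_grad:
  fixes f :: "real^3 \<Rightarrow> 'b::euclidean_space"
  assumes C1: "C_k_on 1 (- {0}) f"
    and b0: "\<And>x. x \<noteq> 0 \<Longrightarrow> norm x < 1 \<Longrightarrow> norm (f x) \<le> C"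
    and b1: "\<And>x i. x \<noteq> 0 \<Longrightarrow> norm x < 1 \<Longrightarrow> norm (grad f x $ i) \<le> C / norm x"
  shows "has_weak_gradient f (grad f) B1"
proof -
  have "norm (f ((1/2) *\<^sub>R axis 1 1)) \<le> C" by (rule b0) (simp_all add: axis_eq_0_iff)
  then have C0: "C \<ge> 0" using norm_ge_zero order_trans by blast
  have contf: "continuous_on (- {0}) f" by (rule C_k_on_imp_continuous_on[OF C1])
  have derf: "(f has_derivative frechet_derivative f (at x)) (at x)" if "x \<noteq> 0" for x
    using C1 that by (simp add: frechet_derivative_works[symmetric])
  have contg: "continuous_on (- {0}) (grad f)" by (rule continuous_on_grad[OF C1])
  have mf: "f \<in> borel_measurable lebesgue" and mg: "grad f \<in> borel_measurable lebesgue"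
    using measurable_of_continuous_off_0 contf contg by blast+
  have b0': "norm (f x) \<le> C / (norm x)\<^sup>2" if "x \<noteq> 0" "norm x < 1" for x
  proof -
    have "norm (f x) \<le> C * 1" using b0[OF that] by simp
    also have "\<dots> \<le> C * (1 / (norm x)\<^sup>2)"
      using that order_trans[OF one_le_inverse inverse_le_inverse_square, of x] C0 by (intro mult_left_mono) auto
    finally show ?thesis by simp
  qed
  have b1': "norm (grad f x $ i) \<le> C / (norm x)\<^sup>2" if "x \<noteq> 0" "norm x < 1" for x i
  proof -
    have "norm (grad f x $ i) \<le> C * (1 / norm x)" using b1[OF that] by simp
    also have "\<dots> \<le> C * (1 / (norm x)\<^sup>2)"
      using that inverse_le_inverse_square[of x] C0 by (intro mult_left_mono) auto
    finally show ?thesis by simp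
  qed
  have b1'': "norm (grad f x) \<le> (3 * C) / (norm x)\<^sup>2" if "x \<noteq> 0" "norm x < 1" for x
  proof -
    have "norm (grad f x) \<le> (\<Sum>i\<in>UNIV. norm (grad f x $ i))"
      unfolding norm_vec_def by (rule L2_set_le_sum) auto
    also have "\<dots> \<le> (\<Sum>i::3\<in>UNIV. C / (norm x)\<^sup>2)" by (intro sum_mono b1' that)
    finally show ?thesis by simp
  qed
  have "locally_integrable B1 f" "locally_integrable B1 (grad f)"
    using locally_integrable_inverse_square_bound[OF mf b0'] locally_integrable_inverse_square_bound[OF mg b1'']
    by blast+
  moreover have "(\<integral>x\<in>B1. frechet_derivative \<phi> (at x) (axis i 1) *\<^sub>R f x \<partial>lebesgue) =
        - (\<integral>x\<in>B1. \<phi> x *\<^sub>R (grad f x $ i) \<partial>lebesgue)"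
    if \<phi>: "\<phi> \<in> C_c \<infinity> B1 (UNIV::real set)" for \<phi> i
  proof -
    let ?e = "axis i 1 :: real^3"
    have \<phi>1: "C_k_on 1 UNIV \<phi>" unfolding C_k_on_UNIV by (rule C_c_infinityD[OF \<phi>])
    have der\<phi>: "(\<phi> has_derivative frechet_derivative \<phi> (at x)) (at x)" for x
      using \<phi>1 by (simp add: frechet_derivative_works[symmetric])
    have c\<phi>1: "continuous_on UNIV \<phi>" by (rule C_k_on_imp_continuous_on[OF \<phi>1])
    have c\<phi>2: "continuous_on UNIV (\<lambda>x. frechet_derivative \<phi> (at x) ?e)" using \<phi>1 by simp
    note c\<phi> = c\<phi>1 c\<phi>2
    note \<phi>0 = C_c_eq_0[OF \<phi>]
    obtain M1 where M1: "\<And>x. x \<in> cball 0 1 \<Longrightarrow> norm (\<phi> x) \<le> M1"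
      using continuous_on_compact_bound[OF compact_cball continuous_on_subset[OF c\<phi>(1) subset_UNIV]] by metis
    obtain M2 where M2: "\<And>x. x \<in> cball 0 1 \<Longrightarrow> norm (frechet_derivative \<phi> (at x) ?e) \<le> M2"
      using continuous_on_compact_bound[OF compact_cball continuous_on_subset[OF c\<phi>(2) subset_UNIV]] by metis
    have M0: "M1 \<ge> 0" "M2 \<ge> 0" using M1[of 0] M2[of 0] by (auto intro: order_trans[OF abs_ge_zero])
    let ?A = "\<lambda>x. \<phi> x *\<^sub>R (grad f x $ i)" and ?B = "\<lambda>x. frechet_derivative \<phi> (at x) ?e *\<^sub>R f x"
    have bA: "norm (?A x) \<le> M1 * C / (norm x)\<^sup>2" if "x \<noteq> 0" "norm x < 1" for x
    proof -
      have "norm (?A x) \<le> M1 * (C / (norm x)\<^sup>2)"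
        unfolding norm_scaleR real_norm_def[symmetric] using M1[of x] b1'[OF that] that M0 by (intro mult_mono) auto
      then show ?thesis by simp
    qed
    have bB: "norm (?B x) \<le> M2 * C / (norm x)\<^sup>2" if "x \<noteq> 0" "norm x < 1" for x
    proof -
      have "norm (?B x) \<le> M2 * (C / (norm x)\<^sup>2)"
        unfolding norm_scaleR real_norm_def[symmetric] using M2[of x] b0'[OF that] that M0 by (intro mult_mono) auto
      then show ?thesis by simp
    qed
    have mg': "(\<lambda>x. grad f x $ i) \<in> borel_measurable lebesgue"
      using C1 by (intro measurable_of_continuous_off_0) (simp add: grad_nth)
    have m\<phi>: "\<phi> \<in> borel_measurable lebesgue" "(\<lambda>x. frechet_derivative \<phi> (at x) ?e) \<in> borel_measurable lebesgue"
      using c\<phi> by (auto intro!: measurable_of_continuous_off_0 intro: continuous_on_subset)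
    have intA: "set_integrable lebesgue B1 ?A"
      by (rule set_integrable_inverse_square_bound[OF borel_measurable_scaleR[OF m\<phi>(1) mg'] _ _ bA]) auto
    have intB: "set_integrable lebesgue B1 ?B"
      by (rule set_integrable_inverse_square_bound[OF borel_measurable_scaleR[OF m\<phi>(2) mf] _ _ bB]) auto
    have inner0: "(\<integral>x\<in>B1. ?A x + ?B x \<partial>lebesgue) \<bullet> b = 0" for b
    proof -
      have "(\<integral>x\<in>B1. ?A x + ?B x \<partial>lebesgue) \<bullet> b = (\<integral>x\<in>B1. (?A x + ?B x) \<bullet> b \<partial>lebesgue)"
        using set_integral_add(1)[OF intA intB] unfolding set_lebesgue_integral_def set_integrable_def
        by (subst integral_inner_left[symmetric]) auto
      also have "\<dots> = (\<integral>x\<in>B1. \<phi> x * (frechet_derivative f (at x) ?e \<bullet> b) + frechet_derivative \<phi> (at x) ?e * (f x \<bullet> b) \<partial>lebesgue)"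
        by (simp add: grad_nth inner_add_left)
      also have "\<dots> = 0"
      proof (rule set_integral_partial_derivative_singular(2)[where \<psi> = "\<lambda>x. \<phi> x * (f x \<bullet> b)" and C = "(M1 * C + M2 * C) * norm b"])
        show "C_k_on 1 (- {0}) (\<lambda>x. \<phi> x * (f x \<bullet> b))"
          by (intro C_k_on_mult C_k_on_subset[OF \<phi>1] C_k_on_bounded_linear[OF _ bounded_linear_inner_left C1]) auto
        show "\<phi> x * (f x \<bullet> b) = 0" if "x \<notin> B1" for x using \<phi>0[OF that] by simp
        show "axis i 1 \<in> (Basis :: (real^3) set)" by simp
        fix x :: "real^3" assume x: "x \<noteq> 0" "norm x < 1"
        show "((\<lambda>x. \<phi> x * (f x \<bullet> b)) has_derivative (\<lambda>h. \<phi> x * (frechet_derivative f (at x) h \<bullet> b)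
            + frechet_derivative \<phi> (at x) h * (f x \<bullet> b))) (at x)"
          by (rule has_derivative_mult[OF der\<phi> has_derivative_inner_left[OF derf[OF x(1)]]])
        have "\<bar>f x \<bullet> b\<bar> \<le> C * norm b"
          by (rule order_trans[OF Cauchy_Schwarz_ineq2]) (intro mult_right_mono b0 x norm_ge_zero)
        then have "\<bar>\<phi> x * (f x \<bullet> b)\<bar> \<le> M1 * (C * norm b)"
          unfolding abs_mult using M1[of x] x M0 by (intro mult_mono) auto
        also have "\<dots> \<le> (M1 * C * norm b) * (1 / norm x)"
          using one_le_inverse[of x] x M0 C0 mult_left_mono[of 1 "1 / norm x" "M1 * C * norm b"] by simp
        also have "\<dots> \<le> ((M1 * C + M2 * C) * norm b) * (1 / norm x)"
          using M0 C0 by (intro mult_right_mono) auto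
        finally show "\<bar>\<phi> x * (f x \<bullet> b)\<bar> \<le> (M1 * C + M2 * C) * norm b / norm x" by simp
        have "\<phi> x * (frechet_derivative f (at x) ?e \<bullet> b) + frechet_derivative \<phi> (at x) ?e * (f x \<bullet> b) = (?A x + ?B x) \<bullet> b"
          by (simp add: grad_nth inner_add_left)
        also have "\<bar>\<dots>\<bar> \<le> norm (?A x + ?B x) * norm b" by (rule Cauchy_Schwarz_ineq2)
        also have "\<dots> \<le> (M1 * C / (norm x)\<^sup>2 + M2 * C / (norm x)\<^sup>2) * norm b"
          using bA[OF x] bB[OF x] by (intro mult_right_mono norm_triangle_le) auto
        also have "\<dots> = (M1 * C + M2 * C) * norm b / (norm x)\<^sup>2" by (simp add: add_divide_distrib algebra_simps)
        finally show "\<bar>\<phi> x * (frechet_derivative f (at x) ?e \<bullet> b) + frechet_derivative \<phi> (at x) ?e * (f x \<bullet> b)\<bar>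
            \<le> (M1 * C + M2 * C) * norm b / (norm x)\<^sup>2" .
      qed
      finally show ?thesis .
    qed
    have "(\<integral>x\<in>B1. ?A x + ?B x \<partial>lebesgue) = 0"
      by (rule inner_eq_zero_iff[THEN iffD1, OF inner0])
    then have "(\<integral>x\<in>B1. ?A x \<partial>lebesgue) + (\<integral>x\<in>B1. ?B x \<partial>lebesgue) = 0"
      unfolding set_integral_add(2)[OF intA intB] .
    then show ?thesis by (simp only: add_eq_0_iff)
  qed
  ultimately show ?thesis unfolding has_weak_gradient_def by (intro conjI ballI allI)
qed

text \<open>
  From here on the energy is computed with classical derivatives.
\<close>

lemma energy_eq:
  fixes Q :: "real^3 \<Rightarrow> real^3^3"
  assumes C1: "C_k_on 1 (- {0}) Q"
    and b0: "\<And>x. x \<noteq> 0 \<Longrightarrow> norm x < 1 \<Longrightarrow> norm (Q x) \<le> C"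
    and b1: "\<And>x i. x \<noteq> 0 \<Longrightarrow> norm x < 1 \<Longrightarrow> norm (grad Q x $ i) \<le> C / norm x"
  shows "energy lam Q = (\<integral>x\<in>B1. 1 / 2 * (norm (grad Q x))\<^sup>2 + lam * W (Q x) \<partial>lebesgue)"
proof -
  have wg: "has_weak_gradient Q (grad Q) B1" by (rule has_weak_gradient_grad[OF C1 b0 b1])
  then have "has_weak_gradient Q (weak_gradient B1 Q) B1"
    unfolding weak_gradient_def by (rule someI[where P = "\<lambda>G. has_weak_gradient Q G B1"])
  then have ae: "AE x in lebesgue. x \<in> B1 \<longrightarrow> grad Q x = weak_gradient B1 Q x"
    by (intro weak_gradient_unique[OF open_ball wg])
  let ?e = "\<lambda>x. indicator B1 x *\<^sub>R (1 / 2 * (norm (grad Q x))\<^sup>2 + lam * W (Q x))"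
  let ?e' = "\<lambda>x. indicator B1 x *\<^sub>R (1 / 2 * (norm (weak_gradient B1 Q x))\<^sup>2 + lam * W (Q x))"
  have ae': "AE x in lebesgue. ?e x = ?e' x"
    using ae by eventually_elim (auto simp: indicator_def)
  have "continuous_on UNIV W"
    unfolding W_def[abs_def] trace_def matrix_matrix_mult_def by (intro continuous_intros)
  then have "continuous_on (- {0}) (\<lambda>x. 1 / 2 * (norm (grad Q x))\<^sup>2 + lam * W (Q x))"
    by (intro continuous_intros continuous_on_grad[OF C1] continuous_on_compose2[OF _ C_k_on_imp_continuous_on[OF C1]]) auto
  then have m: "?e \<in> borel_measurable lebesgue"
    by (intro borel_measurable_scaleR borel_measurable_indicator measurable_of_continuous_off_0) auto
  show ?thesis
    unfolding energy_def set_lebesgue_integral_def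
    using integral_cong_AE[OF m measurable_lebesgue_AE_cong[OF m ae'] ae'] by simp
qed

section \<open>Derivatives of the hedgehog\<close>

lemma tensor_nth: "tensor u v $ i $ j = u $ i * v $ j"
  by (simp add: tensor_def)

lemma bounded_bilinear_tensor: "bounded_bilinear (tensor :: real^'m \<Rightarrow> real^'n \<Rightarrow> _)"
proof -
  have "bilinear (tensor :: real^'m \<Rightarrow> real^'n \<Rightarrow> _)"
    unfolding bilinear_def by (auto intro!: linearI simp: vec_eq_iff tensor_nth algebra_simps)
  then show ?thesis by (simp add: bilinear_conv_bounded_bilinear)
qed

lemma inner_tensor_tensor: "tensor a b \<bullet> tensor c d = (a \<bullet> c) * (b \<bullet> d)"
  by (simp add: inner_vec_def tensor_nth sum_product mult_ac) (rule sum.swap)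

lemma inner_tensor_matrix: "tensor a b \<bullet> v = a \<bullet> (v *v b)" for v :: "real^'n^'m"
  by (simp add: inner_vec_def tensor_nth matrix_vector_mult_def sum_distrib_left mult_ac)

lemma inner_mat_1: "mat 1 \<bullet> v = trace v" for v :: "real^'n^'n"
  by (simp add: inner_vec_def mat_def trace_def if_distrib[of "\<lambda>x. x * _"] cong: if_cong)

lemma inner_mat_1_tensor: "mat 1 \<bullet> tensor a b = a \<bullet> b"
  unfolding inner_mat_1 by (simp add: trace_def tensor_nth inner_vec_def)

lemma inner_mat_1_mat_1: "mat 1 \<bullet> (mat 1 :: real^3^3) = 3"
  by (simp add: inner_mat_1 trace_I)

lemma sqrt_3_2_mult: "sqrt (3 / 2) * (sqrt (3 / 2) * y) = 3 / 2 * y"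
  by (simp only: mult.assoc[symmetric] real_sqrt_mult_self)

lemmas tensor_inners = inner_tensor_tensor inner_mat_1_tensor inner_mat_1_mat_1
  inner_commute[of "tensor _ _" "mat 1"]

lemma hedgehog_eq: "hedgehog x = sqrt (3 / 2) *\<^sub>R ((1 / (x \<bullet> x)) *\<^sub>R tensor x x - (1 / 3) *\<^sub>R mat 1)"
proof -
  have "tensor ((1 / norm x) *\<^sub>R x) ((1 / norm x) *\<^sub>R x) = (1 / (x \<bullet> x)) *\<^sub>R tensor x x"
    by (simp add: vec_eq_iff tensor_nth power2_norm_eq_inner[symmetric] power2_eq_square)
  then show ?thesis by (simp add: hedgehog_def)
qed

lemma C_k_on_hedgehog: "C_k_on k (- {0}) hedgehog"
proof -
  have "C_k_on k (- {0}) (\<lambda>x. sqrt (3 / 2) *\<^sub>R ((x \<bullet> x) powr (- 1) *\<^sub>R tensor x x - (1 / 3) *\<^sub>R mat 1) :: real^3^3)"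
    by (intro C_k_on_scaleR C_k_on_const C_k_on_diff C_k_on_powr C_k_on_inner C_k_on_ident
        C_k_on_bilinear[OF _ bounded_bilinear_tensor]) auto
  then show ?thesis
    by (rule C_k_on_cong[rotated]) (auto simp: hedgehog_eq powr_minus_divide)
qed

text \<open>
  \<open>dH x h\<close> is the derivative of the hedgehog at \<open>x\<close> in direction \<open>h\<close>, and \<open>ddH x h k\<close> the derivative of
  \<open>x \<mapsto> dH x h\<close> in direction \<open>k\<close>.
\<close>

definition dH :: "real^3 \<Rightarrow> real^3 \<Rightarrow> real^3^3" where
  "dH x h = sqrt (3 / 2) *\<^sub>R ((1 / (x \<bullet> x)) *\<^sub>R (tensor x h + tensor h x)
      - (2 * (x \<bullet> h) / (x \<bullet> x)\<^sup>2) *\<^sub>R tensor x x)"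

definition ddH :: "real^3 \<Rightarrow> real^3 \<Rightarrow> real^3 \<Rightarrow> real^3^3" where
  "ddH x h k = sqrt (3 / 2) *\<^sub>R ((1 / (x \<bullet> x)) *\<^sub>R (tensor k h + tensor h k)
      - (2 * (x \<bullet> k) / (x \<bullet> x)\<^sup>2) *\<^sub>R (tensor x h + tensor h x)
      - (2 * (x \<bullet> h) / (x \<bullet> x)\<^sup>2) *\<^sub>R (tensor x k + tensor k x)
      - (2 * (k \<bullet> h) / (x \<bullet> x)\<^sup>2 - 8 * (x \<bullet> h) * (x \<bullet> k) / (x \<bullet> x) ^ 3) *\<^sub>R tensor x x)"

lemma tensor_has_derivative:
  assumes "(f has_derivative f') (at x)" "(g has_derivative g') (at x)"
  shows "((\<lambda>x. tensor (f x) (g x)) has_derivative (\<lambda>h. tensor (f x) (g' h) + tensor (f' h) (g x))) (at x)"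
  by (rule bounded_bilinear.FDERIV[OF bounded_bilinear_tensor assms])

lemma hedgehog_has_derivative:
  assumes "x \<noteq> 0"
  shows "(hedgehog has_derivative dH x) (at x)"
proof -
  have nz: "x \<bullet> x \<noteq> 0" using assms by simp
  have sq: "((\<lambda>x. 1 / (x \<bullet> x)) has_derivative (\<lambda>h. - (2 * (x \<bullet> h) / (x \<bullet> x)\<^sup>2))) (at x)"
    by (rule derivative_eq_intros refl nz)+ (auto simp: power2_eq_square inner_commute fun_eq_iff field_simps)
  have "((\<lambda>x. sqrt (3 / 2) *\<^sub>R ((1 / (x \<bullet> x)) *\<^sub>R tensor x x - (1 / 3) *\<^sub>R mat 1)) has_derivative
      (\<lambda>h. sqrt (3 / 2) *\<^sub>R (((1 / (x \<bullet> x)) *\<^sub>R (tensor x h + tensor h x)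
        + (- (2 * (x \<bullet> h) / (x \<bullet> x)\<^sup>2)) *\<^sub>R tensor x x) - 0))) (at x)"
    by (intro has_derivative_scaleR_right has_derivative_diff has_derivative_const
        has_derivative_scaleR[OF sq] tensor_has_derivative has_derivative_ident)
  then show ?thesis
    by (simp add: hedgehog_eq[abs_def] dH_def[abs_def])
qed

lemma dH_has_derivative:
  assumes "x \<noteq> 0"
  shows "((\<lambda>x. dH x h) has_derivative ddH x h) (at x)"
proof -
  have nz: "x \<bullet> x \<noteq> 0" using assms by simp
  have sq: "((\<lambda>x. 1 / (x \<bullet> x)) has_derivative (\<lambda>k. - (2 * (x \<bullet> k) / (x \<bullet> x)\<^sup>2))) (at x)"
    by (rule derivative_eq_intros refl nz)+ (auto simp: power2_eq_square inner_commute fun_eq_iff field_simps)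
  have sq2: "((\<lambda>x. 2 * (x \<bullet> h) / (x \<bullet> x)\<^sup>2) has_derivative
      (\<lambda>k. 2 * (k \<bullet> h) / (x \<bullet> x)\<^sup>2 - 8 * (x \<bullet> h) * (x \<bullet> k) / (x \<bullet> x) ^ 3)) (at x)"
    by (rule derivative_eq_intros refl nz power_not_zero)+
      (use nz in \<open>auto simp: power2_eq_square power3_eq_cube inner_commute fun_eq_iff field_simps\<close>)
  have t1: "((\<lambda>x. tensor x h + tensor h x) has_derivative (\<lambda>k. tensor k h + tensor h k)) (at x)"
    using bounded_linear_imp_has_derivative[OF bounded_bilinear.bounded_linear_left[OF bounded_bilinear_tensor, of h]]
      bounded_linear_imp_has_derivative[OF bounded_bilinear.bounded_linear_right[OF bounded_bilinear_tensor, of h]]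
    by (rule has_derivative_add)
  have "((\<lambda>x. dH x h) has_derivative (\<lambda>k. sqrt (3 / 2) *\<^sub>R
      (((1 / (x \<bullet> x)) *\<^sub>R (tensor k h + tensor h k) + (- (2 * (x \<bullet> k) / (x \<bullet> x)\<^sup>2)) *\<^sub>R (tensor x h + tensor h x))
      - ((2 * (x \<bullet> h) / (x \<bullet> x)\<^sup>2) *\<^sub>R (tensor x k + tensor k x)
        + (2 * (k \<bullet> h) / (x \<bullet> x)\<^sup>2 - 8 * (x \<bullet> h) * (x \<bullet> k) / (x \<bullet> x) ^ 3) *\<^sub>R tensor x x)))) (at x)"
    unfolding dH_def
    by (intro has_derivative_scaleR_right has_derivative_diff has_derivative_scaleR[OF sq t1]
        has_derivative_scaleR[OF sq2] tensor_has_derivative has_derivative_ident)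
  then show ?thesis
    by (simp add: ddH_def[abs_def] algebra_simps)
qed

lemma grad_hedgehog: "x \<noteq> 0 \<Longrightarrow> grad hedgehog x $ i = dH x (axis i 1)"
  by (rule grad_eqI[OF hedgehog_has_derivative])

lemma inner_hedgehog_hedgehog: "hedgehog x \<bullet> hedgehog x = 1" if "x \<noteq> 0"
  using that by (simp add: hedgehog_eq inner_diff_left inner_diff_right tensor_inners sqrt_3_2_mult)

lemma norm_hedgehog: "norm (hedgehog x) = 1" if "x \<noteq> 0"
  using inner_hedgehog_hedgehog[OF that] by (simp add: norm_eq_1)

lemma inner_hedgehog_dH: "hedgehog x \<bullet> dH x h = 0" if "x \<noteq> 0"
  using that by (simp add: hedgehog_eq dH_def inner_diff_left inner_diff_right inner_add_right tensor_inners sqrt_3_2_mult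
      inner_commute[of h x] power2_eq_square field_simps)

lemma inner_dH_dH: "dH x h \<bullet> dH x h = 3 * (h \<bullet> h) / (x \<bullet> x) - 3 * (x \<bullet> h)\<^sup>2 / (x \<bullet> x)\<^sup>2" if "x \<noteq> 0"
  using that by (simp add: dH_def inner_diff_left inner_diff_right inner_add_right inner_add_left tensor_inners sqrt_3_2_mult
      inner_commute[of h x] power2_eq_square field_simps)

lemma norm_dH_axis: "norm (dH x (axis i 1)) \<le> 2 / norm x" if "x \<noteq> 0"
proof -
  have "(norm (dH x (axis i 1)))\<^sup>2 \<le> 3 / (x \<bullet> x)"
    using inner_dH_dH[OF that, of "axis i 1"] by (simp add: power2_norm_eq_inner inner_axis_axis)
  also have "\<dots> \<le> (2 / norm x)\<^sup>2" by (simp add: power_divide power2_norm_eq_inner divide_right_mono)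
  finally show ?thesis by (rule power2_le_imp_le) simp
qed

lemma sum_inner_axis_power2: "(\<Sum>i\<in>UNIV. (x \<bullet> axis i 1)\<^sup>2) = x \<bullet> x" for x :: "real^'n"
  by (simp add: inner_axis) (simp add: inner_vec_def power2_eq_square)

text \<open>
  Only directions orthogonal to \<open>x\<close> contribute: by \<open>inner_dH_dH\<close> each of the two contributes \<open>3 / |x|\<^sup>2\<close>.
\<close>

lemma norm_grad_hedgehog: "(norm (grad hedgehog x))\<^sup>2 = 6 / (x \<bullet> x)" if "x \<noteq> 0"
proof -
  have "(norm (grad hedgehog x))\<^sup>2 = (\<Sum>i\<in>UNIV. 3 / (x \<bullet> x) - 3 / (x \<bullet> x)\<^sup>2 * (x \<bullet> axis i 1)\<^sup>2)"
    using that by (subst norm_vec_power2)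
      (simp add: grad_hedgehog power2_norm_eq_inner inner_dH_dH inner_axis_axis)
  also have "\<dots> = 9 / (x \<bullet> x) - 3 / (x \<bullet> x)\<^sup>2 * (x \<bullet> x)"
    by (simp only: sum_subtractf sum_distrib_left[symmetric] sum_inner_axis_power2) simp
  also have "\<dots> = 6 / (x \<bullet> x)" using that by (simp add: field_simps power2_eq_square)
  finally show ?thesis .
qed

lemma axis_nth: "axis i a $ j = (if j = i then a else 0)"
  by (simp add: axis_def)

lemma sum_tensor_axis:
  "(\<Sum>i\<in>UNIV. tensor (axis i 1) (axis i 1)) = (mat 1 :: real^'n^'n)"
  "(\<Sum>i\<in>UNIV. (x \<bullet> axis i 1) *\<^sub>R tensor (axis i 1) x) = tensor x (x :: real^'n)"
  "(\<Sum>i\<in>UNIV. (x \<bullet> axis i 1) *\<^sub>R tensor x (axis i 1)) = tensor x (x :: real^'n)"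
  by (auto simp: vec_eq_iff tensor_nth mat_def axis_nth inner_axis if_distrib[of "\<lambda>y. y * _"] if_distrib[of "(*) _"] cong: if_cong)

text \<open>
  The hedgehog is a homogeneous harmonic map: each entry is a spherical harmonic of degree 2, so
  its Laplacian is \<open>- 6 / |x|\<^sup>2\<close> times itself.
\<close>

lemma laplacian_hedgehog:
  assumes "x \<noteq> 0"
  shows "(\<Sum>i\<in>UNIV. ddH x (axis i 1) (axis i 1)) = - (6 / (x \<bullet> x)) *\<^sub>R hedgehog x"
proof -
  let ?e = "\<lambda>i. axis i 1 :: real^3" and ?r = "x \<bullet> x"
  have r: "?r \<noteq> 0" using assms by simp
  have "ddH x (?e i) (?e i) = sqrt (3 / 2) *\<^sub>R ((2 / ?r) *\<^sub>R tensor (?e i) (?e i)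
      - (4 / ?r\<^sup>2) *\<^sub>R ((x \<bullet> ?e i) *\<^sub>R tensor x (?e i)) - (4 / ?r\<^sup>2) *\<^sub>R ((x \<bullet> ?e i) *\<^sub>R tensor (?e i) x)
      - (2 / ?r\<^sup>2 - 8 / ?r ^ 3 * (x \<bullet> ?e i)\<^sup>2) *\<^sub>R tensor x x)" for i
    by (simp add: ddH_def inner_axis_axis scaleR_add_right vec_eq_iff tensor_nth power2_eq_square algebra_simps)
  then have "(\<Sum>i\<in>UNIV. ddH x (?e i) (?e i)) = sqrt (3 / 2) *\<^sub>R ((2 / ?r) *\<^sub>R mat 1
      - (4 / ?r\<^sup>2) *\<^sub>R tensor x x - (4 / ?r\<^sup>2) *\<^sub>R tensor x x - (6 / ?r\<^sup>2 - 8 / ?r ^ 3 * ?r) *\<^sub>R tensor x x)"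
    by (simp only: scaleR_sum_right[symmetric] sum_subtractf scaleR_sum_left[symmetric] sum_distrib_left[symmetric]
        sum_tensor_axis sum_inner_axis_power2) simp
  also have "\<dots> = - (6 / ?r) *\<^sub>R hedgehog x"
    using r unfolding hedgehog_eq
    by (simp add: vec_eq_iff tensor_nth power2_eq_square power3_eq_cube field_simps)
  finally show ?thesis .
qed

lemma norm_ddH_axis: obtains C where "\<And>x i. x \<noteq> 0 \<Longrightarrow> norm (ddH x (axis i 1) (axis i 1)) \<le> C / (norm x)\<^sup>2"
proof -
  have nt: "norm (tensor a b) = norm a * norm b" for a b :: "real^3"
    by (simp add: norm_eq_sqrt_inner inner_tensor_tensor real_sqrt_mult)
  have "norm (ddH x (axis i 1) (axis i 1)) \<le> sqrt (3 / 2) * 20 / (norm x)\<^sup>2" if "x \<noteq> 0" for x i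
  proof -
    let ?e = "axis i 1 :: real^3" and ?r = "norm x"
    have r: "?r > 0" using that by simp
    have xe: "\<bar>x \<bullet> ?e\<bar> \<le> ?r" using Cauchy_Schwarz_ineq2[of x ?e] by simp
    have 1: "norm ((1 / ?r\<^sup>2) *\<^sub>R (tensor ?e ?e + tensor ?e ?e)) \<le> 2 / ?r\<^sup>2"
      using norm_triangle_ineq[of "tensor ?e ?e" "tensor ?e ?e"] by (simp add: nt divide_right_mono)
    have t2: "norm (tensor x ?e + tensor ?e x) \<le> 2 * ?r"
      using norm_triangle_ineq[of "tensor x ?e" "tensor ?e x"] by (simp add: nt)
    have 2: "norm ((2 * (x \<bullet> ?e) / (?r\<^sup>2)\<^sup>2) *\<^sub>R (tensor x ?e + tensor ?e x)) \<le> 4 / ?r\<^sup>2"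
    proof -
      have "norm ((2 * (x \<bullet> ?e) / (?r\<^sup>2)\<^sup>2) *\<^sub>R (tensor x ?e + tensor ?e x)) \<le> (2 * ?r / (?r\<^sup>2)\<^sup>2) * (2 * ?r)"
        unfolding norm_scaleR using xe t2 r by (intro mult_mono) (auto simp: abs_mult divide_right_mono)
      also have "\<dots> = 4 / ?r\<^sup>2" using r by (simp add: power2_eq_square field_simps)
      finally show ?thesis .
    qed
    have 3: "norm ((2 * (?e \<bullet> ?e) / (?r\<^sup>2)\<^sup>2 - 8 * (x \<bullet> ?e) * (x \<bullet> ?e) / (?r\<^sup>2) ^ 3) *\<^sub>R tensor x x) \<le> 10 / ?r\<^sup>2"
    proof -
      have "(x \<bullet> ?e) * (x \<bullet> ?e) \<le> ?r\<^sup>2"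
        using power_mono[OF xe abs_ge_zero, of 2] by (simp add: power2_eq_square)
      then have "8 * (x \<bullet> ?e) * (x \<bullet> ?e) / (?r\<^sup>2) ^ 3 \<le> 8 * ?r\<^sup>2 / (?r\<^sup>2) ^ 3" "0 \<le> 8 * (x \<bullet> ?e) * (x \<bullet> ?e) / (?r\<^sup>2) ^ 3"
        by (auto intro!: divide_right_mono)
      moreover define u where "u = 1 / (?r\<^sup>2)\<^sup>2"
      moreover have "8 * ?r\<^sup>2 / (?r\<^sup>2) ^ 3 = 8 * u" "0 \<le> u"
        using r by (simp_all add: u_def power2_eq_square power3_eq_cube field_simps)
      moreover have "2 * (?e \<bullet> ?e) / (?r\<^sup>2)\<^sup>2 = 2 * u" "10 / (?r\<^sup>2)\<^sup>2 = 10 * u"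
        by (simp_all add: u_def inner_axis_axis)
      ultimately have "\<bar>2 * (?e \<bullet> ?e) / (?r\<^sup>2)\<^sup>2 - 8 * (x \<bullet> ?e) * (x \<bullet> ?e) / (?r\<^sup>2) ^ 3\<bar> \<le> 10 / (?r\<^sup>2)\<^sup>2"
        by linarith
      then have "norm ((2 * (?e \<bullet> ?e) / (?r\<^sup>2)\<^sup>2 - 8 * (x \<bullet> ?e) * (x \<bullet> ?e) / (?r\<^sup>2) ^ 3) *\<^sub>R tensor x x)
          \<le> 10 / (?r\<^sup>2)\<^sup>2 * (?r * ?r)"
        unfolding norm_scaleR nt using r by (intro mult_right_mono) auto
      also have "\<dots> = 10 / ?r\<^sup>2" using r by (simp add: power2_eq_square)
      finally show ?thesis .
    qed
    let ?a = "(1 / ?r\<^sup>2) *\<^sub>R (tensor ?e ?e + tensor ?e ?e)"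
      and ?b = "(2 * (x \<bullet> ?e) / (?r\<^sup>2)\<^sup>2) *\<^sub>R (tensor x ?e + tensor ?e x)"
      and ?c = "(2 * (?e \<bullet> ?e) / (?r\<^sup>2)\<^sup>2 - 8 * (x \<bullet> ?e) * (x \<bullet> ?e) / (?r\<^sup>2) ^ 3) *\<^sub>R tensor x x"
    have "norm (?a - ?b - ?b - ?c) \<le> norm ?a + norm ?b + norm ?b + norm ?c"
      using norm_triangle_ineq4[of "?a - ?b - ?b" ?c] norm_triangle_ineq4[of "?a - ?b" ?b] norm_triangle_ineq4[of ?a ?b]
      by linarith
    also have "\<dots> \<le> 2 / ?r\<^sup>2 + 4 / ?r\<^sup>2 + 4 / ?r\<^sup>2 + 10 / ?r\<^sup>2" using 1 2 3 by linarith
    finally have "norm (?a - ?b - ?b - ?c) \<le> 20 / ?r\<^sup>2" by simp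
    then have "sqrt (3 / 2) * norm (?a - ?b - ?b - ?c) \<le> sqrt (3 / 2) * (20 / ?r\<^sup>2)"
      by (intro mult_left_mono) auto
    moreover have "ddH x ?e ?e = sqrt (3 / 2) *\<^sub>R (?a - ?b - ?b - ?c)"
      by (simp only: ddH_def power2_norm_eq_inner)
    ultimately show ?thesis by (simp only: norm_scaleR) simp
  qed
  then show ?thesis by (rule that)
qed

section \<open>Second order expansion of the energy density\<close>

text \<open>
  Derivatives with a common bound. Since the bound is carried along through sums and products, the density of the energy,
  which is a polynomial in simple functions of \<open>t\<close>, comes with a majorant for differentiation under the integral sign.
\<close>

definition jet2 :: "real \<Rightarrow> real \<Rightarrow> (real \<Rightarrow> real) \<Rightarrow> (real \<Rightarrow> real) \<Rightarrow> (real \<Rightarrow> real) \<Rightarrow> bool" where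
  "jet2 d K f f1 f2 \<longleftrightarrow> (\<forall>t. \<bar>t\<bar> < d \<longrightarrow> (f has_real_derivative f1 t) (at t) \<and>
     (f1 has_real_derivative f2 t) (at t) \<and> \<bar>f t\<bar> \<le> K \<and> \<bar>f1 t\<bar> \<le> K \<and> \<bar>f2 t\<bar> \<le> K)"

lemma jet2_mono: "jet2 d K f f1 f2 \<Longrightarrow> K \<le> L \<Longrightarrow> jet2 d L f f1 f2"
  unfolding jet2_def by (meson order_trans)

lemma jet2_const: "jet2 d \<bar>c\<bar> (\<lambda>t. c) (\<lambda>t. 0) (\<lambda>t. 0)"
  by (auto simp: jet2_def)

lemma jet2_add:
  assumes "jet2 d K f f1 f2" "jet2 d L g g1 g2"
  shows "jet2 d (K + L) (\<lambda>t. f t + g t) (\<lambda>t. f1 t + g1 t) (\<lambda>t. f2 t + g2 t)"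
  unfolding jet2_def
proof (intro allI impI)
  fix t :: real assume "\<bar>t\<bar> < d"
  then have d: "(f has_real_derivative f1 t) (at t)" "(f1 has_real_derivative f2 t) (at t)"
      "(g has_real_derivative g1 t) (at t)" "(g1 has_real_derivative g2 t) (at t)"
    and b: "\<bar>f t\<bar> \<le> K" "\<bar>f1 t\<bar> \<le> K" "\<bar>f2 t\<bar> \<le> K" "\<bar>g t\<bar> \<le> L" "\<bar>g1 t\<bar> \<le> L" "\<bar>g2 t\<bar> \<le> L"
    using assms unfolding jet2_def by auto
  show "((\<lambda>t. f t + g t) has_real_derivative f1 t + g1 t) (at t) \<and>
      ((\<lambda>t. f1 t + g1 t) has_real_derivative f2 t + g2 t) (at t) \<and>
      \<bar>f t + g t\<bar> \<le> K + L \<and> \<bar>f1 t + g1 t\<bar> \<le> K + L \<and> \<bar>f2 t + g2 t\<bar> \<le> K + L"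
    by (intro conjI DERIV_add d order_trans[OF abs_triangle_ineq] add_mono b)
qed

lemma jet2_cmult:
  assumes "jet2 d K f f1 f2"
  shows "jet2 d (\<bar>c\<bar> * K) (\<lambda>t. c * f t) (\<lambda>t. c * f1 t) (\<lambda>t. c * f2 t)"
  unfolding jet2_def abs_mult
  by (intro allI impI conjI DERIV_cmult mult_left_mono abs_ge_zero) (use assms in \<open>auto simp: jet2_def\<close>)

lemma jet2_diff:
  assumes "jet2 d K f f1 f2" "jet2 d L g g1 g2"
  shows "jet2 d (K + L) (\<lambda>t. f t - g t) (\<lambda>t. f1 t - g1 t) (\<lambda>t. f2 t - g2 t)"
  using jet2_add[OF assms(1) jet2_cmult[OF assms(2), of "-1"]] by simp

lemma jet2_sum:
  assumes "finite I" "\<And>i. i \<in> I \<Longrightarrow> jet2 d (K i) (f i) (f1 i) (f2 i)"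
  shows "jet2 d (\<Sum>i\<in>I. K i) (\<lambda>t. \<Sum>i\<in>I. f i t) (\<lambda>t. \<Sum>i\<in>I. f1 i t) (\<lambda>t. \<Sum>i\<in>I. f2 i t)"
  using assms
proof (induction I)
  case empty
  show ?case using jet2_const[of d 0] by simp
next
  case (insert i I)
  then have "jet2 d (K i + (\<Sum>i\<in>I. K i)) (\<lambda>t. f i t + (\<Sum>i\<in>I. f i t))
      (\<lambda>t. f1 i t + (\<Sum>i\<in>I. f1 i t)) (\<lambda>t. f2 i t + (\<Sum>i\<in>I. f2 i t))"
    by (intro jet2_add) auto
  then show ?case using insert by simp
qed

text \<open>
  The factor 4 is the sum \<open>1 + 2 + 1\<close> of the coefficients in the Leibniz rule for the second derivative.
\<close>

lemma jet2_mult: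
  assumes "jet2 d K f f1 f2" "jet2 d L g g1 g2"
  shows "jet2 d (4 * (K * L)) (\<lambda>t. f t * g t) (\<lambda>t. f1 t * g t + f t * g1 t)
    (\<lambda>t. f2 t * g t + 2 * (f1 t * g1 t) + f t * g2 t)"
  unfolding jet2_def
proof (intro allI impI)
  fix t :: real assume t: "\<bar>t\<bar> < d"
  then have d: "(f has_real_derivative f1 t) (at t)" "(f1 has_real_derivative f2 t) (at t)"
      "(g has_real_derivative g1 t) (at t)" "(g1 has_real_derivative g2 t) (at t)"
    and b: "\<bar>f t\<bar> \<le> K" "\<bar>f1 t\<bar> \<le> K" "\<bar>f2 t\<bar> \<le> K" "\<bar>g t\<bar> \<le> L" "\<bar>g1 t\<bar> \<le> L" "\<bar>g2 t\<bar> \<le> L"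
    using assms unfolding jet2_def by auto
  have p: "\<bar>a * b\<bar> \<le> K * L" if "\<bar>a\<bar> \<le> K" "\<bar>b\<bar> \<le> L" for a b
    unfolding abs_mult using that by (intro mult_mono) auto
  have KL: "0 \<le> K * L" using b(1,4) by (intro mult_nonneg_nonneg) (auto intro: order_trans[OF abs_ge_zero])
  note p' = p[OF b(1) b(4)] p[OF b(2) b(4)] p[OF b(1) b(5)] p[OF b(3) b(4)] p[OF b(2) b(5)] p[OF b(1) b(6)]
  show "((\<lambda>t. f t * g t) has_real_derivative f1 t * g t + f t * g1 t) (at t) \<and>
      ((\<lambda>t. f1 t * g t + f t * g1 t) has_real_derivative f2 t * g t + 2 * (f1 t * g1 t) + f t * g2 t) (at t) \<and>
      \<bar>f t * g t\<bar> \<le> 4 * (K * L) \<and> \<bar>f1 t * g t + f t * g1 t\<bar> \<le> 4 * (K * L) \<and>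
      \<bar>f2 t * g t + 2 * (f1 t * g1 t) + f t * g2 t\<bar> \<le> 4 * (K * L)"
  proof (intro conjI)
    show "((\<lambda>t. f t * g t) has_real_derivative f1 t * g t + f t * g1 t) (at t)"
      using DERIV_mult[OF d(1) d(3)] by (simp add: algebra_simps)
    show "((\<lambda>t. f1 t * g t + f t * g1 t) has_real_derivative f2 t * g t + 2 * (f1 t * g1 t) + f t * g2 t) (at t)"
      using DERIV_add[OF DERIV_mult[OF d(2) d(3)] DERIV_mult[OF d(1) d(4)]] by (simp add: algebra_simps)
  qed (use p'[unfolded abs_le_iff] KL in \<open>unfold abs_le_iff; safe; linarith\<close>)+
qed

lemma jet2_cubic:
  assumes d: "0 < d" "d \<le> 1" and b: "\<bar>a0\<bar> \<le> K" "\<bar>a1\<bar> \<le> K" "\<bar>a2\<bar> \<le> K" "\<bar>a3\<bar> \<le> K"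
  shows "jet2 d (8 * K) (\<lambda>t. a0 + a1 * t + a2 * t\<^sup>2 + a3 * t ^ 3) (\<lambda>t. a1 + 2 * a2 * t + 3 * a3 * t\<^sup>2)
    (\<lambda>t. 2 * a2 + 6 * a3 * t)"
  unfolding jet2_def
proof (intro allI impI)
  fix t :: real assume t: "\<bar>t\<bar> < d"
  have p: "\<bar>a * t ^ n\<bar> \<le> K" if "\<bar>a\<bar> \<le> K" for a n
  proof -
    have "\<bar>t ^ n\<bar> \<le> 1" unfolding power_abs using t d by (intro power_le_one) auto
    then have "\<bar>a\<bar> * \<bar>t ^ n\<bar> \<le> K * 1" using that by (intro mult_mono) auto
    then show ?thesis by (simp add: abs_mult)
  qed
  note p' = p[OF b(2), of 1, simplified] p[OF b(3), of 1, simplified] p[OF b(4), of 1, simplified]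
    p[OF b(3), of 2] p[OF b(4), of 2] p[OF b(4), of 3]
  show "((\<lambda>t. a0 + a1 * t + a2 * t\<^sup>2 + a3 * t ^ 3) has_real_derivative a1 + 2 * a2 * t + 3 * a3 * t\<^sup>2) (at t) \<and>
      ((\<lambda>t. a1 + 2 * a2 * t + 3 * a3 * t\<^sup>2) has_real_derivative 2 * a2 + 6 * a3 * t) (at t) \<and>
      \<bar>a0 + a1 * t + a2 * t\<^sup>2 + a3 * t ^ 3\<bar> \<le> 8 * K \<and> \<bar>a1 + 2 * a2 * t + 3 * a3 * t\<^sup>2\<bar> \<le> 8 * K \<and>
      \<bar>2 * a2 + 6 * a3 * t\<bar> \<le> 8 * K"
  proof (intro conjI)
    note b' = b[unfolded abs_le_iff] and p'' = p'[unfolded abs_le_iff]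
    show "\<bar>a0 + a1 * t + a2 * t\<^sup>2 + a3 * t ^ 3\<bar> \<le> 8 * K"
      using p'' b' unfolding abs_le_iff by (safe; linarith)
    show "\<bar>a1 + 2 * a2 * t + 3 * a3 * t\<^sup>2\<bar> \<le> 8 * K"
      using p'' b' unfolding abs_le_iff mult.assoc by (safe; linarith)
    show "\<bar>2 * a2 + 6 * a3 * t\<bar> \<le> 8 * K"
      using p'' b' unfolding abs_le_iff mult.assoc by (safe; linarith)
  qed (auto intro!: derivative_eq_intros simp: power2_eq_square)
qed

lemma jet2_quadratic:
  assumes "0 < d" "d \<le> 1" "\<bar>a0\<bar> \<le> K" "\<bar>a1\<bar> \<le> K" "\<bar>a2\<bar> \<le> K"
  shows "jet2 d (8 * K) (\<lambda>t. a0 + a1 * t + a2 * t\<^sup>2) (\<lambda>t. a1 + 2 * a2 * t) (\<lambda>t. 2 * a2)"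
  using jet2_cubic[OF assms, of 0] assms(3) by simp

text \<open>
  The quadratic is \<open>|H + t P|\<^sup>2\<close> for a unit vector \<open>H\<close>, with \<open>b = H \<bullet> P\<close> and \<open>c = |P|\<^sup>2\<close>. The bound \<open>1 / (8 M)\<close> on \<open>t\<close>
  keeps it away from 0.
\<close>

lemma inverse_sqrt_quadratic_bounds:
  fixes M b c t :: real
  assumes M: "M \<ge> 1" and b: "\<bar>b\<bar> \<le> M" and c: "\<bar>c\<bar> \<le> M\<^sup>2" and t: "\<bar>t\<bar> < 1 / (8 * M)"
  shows "1 / 2 \<le> 1 + 2 * b * t + c * t\<^sup>2" and "1 + 2 * b * t + c * t\<^sup>2 \<le> 2" and "\<bar>2 * b + 2 * c * t\<bar> \<le> 3 * M"
proof -
  have tM: "\<bar>t\<bar> * M \<le> 1 / 8" using t M by (simp add: field_simps)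
  have 1: "\<bar>b * t\<bar> \<le> 1 / 8"
    using tM mult_mono[OF b order_refl[of "\<bar>t\<bar>"]] M by (simp add: abs_mult mult.commute)
  have "\<bar>c * t\<^sup>2\<bar> \<le> M\<^sup>2 * \<bar>t\<bar>\<^sup>2" using c by (simp add: abs_mult mult_right_mono)
  also have "\<dots> = (\<bar>t\<bar> * M)\<^sup>2" by (simp only: power_mult_distrib mult.commute)
  also have "\<dots> \<le> (1 / 8)\<^sup>2" using tM M by (intro power_mono) auto
  finally have 2: "\<bar>c * t\<^sup>2\<bar> \<le> 1 / 64" by (simp add: power2_eq_square)
  show "1 / 2 \<le> 1 + 2 * b * t + c * t\<^sup>2" "1 + 2 * b * t + c * t\<^sup>2 \<le> 2" 
    using 1 2 unfolding abs_le_iff mult.assoc by linarith+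
  have "\<bar>c * t\<bar> \<le> M\<^sup>2 * \<bar>t\<bar>" using c by (simp add: abs_mult mult_right_mono)
  also have "\<dots> = M * (\<bar>t\<bar> * M)" by (simp add: power2_eq_square)
  also have "\<dots> \<le> M * (1 / 8)" using tM M by (intro mult_left_mono) auto
  finally show "\<bar>2 * b + 2 * c * t\<bar> \<le> 3 * M" 
    using b M unfolding mult.assoc by linarith
qed

lemma jet2_inverse_sqrt:
  assumes M: "M \<ge> 1" and b: "\<bar>b\<bar> \<le> M" and c: "\<bar>c\<bar> \<le> M\<^sup>2"
  defines "m \<equiv> \<lambda>t. 1 + 2 * b * t + c * t\<^sup>2"
  defines "q1 \<equiv> \<lambda>t. - (1 / 2) * (2 * b + 2 * c * t) * m t powr (- 3 / 2)"
  defines "q2 \<equiv> \<lambda>t. - c * m t powr (- 3 / 2) + (3 / 4) * (2 * b + 2 * c * t)\<^sup>2 * m t powr (- 5 / 2)"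
  shows "jet2 (1 / (8 * M)) (100 * M\<^sup>2) (\<lambda>t. m t powr (- 1 / 2)) q1 q2"
  unfolding jet2_def
proof (intro allI impI)
  fix t :: real assume t: "\<bar>t\<bar> < 1 / (8 * M)"
  have m: "1 / 2 \<le> m t" and m1: "\<bar>2 * b + 2 * c * t\<bar> \<le> 3 * M"
    unfolding m_def using inverse_sqrt_quadratic_bounds[OF M b c t] by auto
  have dm: "(m has_real_derivative 2 * b + 2 * c * t) (at t)"
    unfolding m_def by (auto intro!: derivative_eq_intros)
  have dp: "((\<lambda>t. m t powr a) has_real_derivative a * m t powr (a - 1) * (2 * b + 2 * c * t)) (at t)" for a
    using DERIV_chain2[OF has_real_derivative_powr[of "m t" a] dm] m by simp
  have pb: "\<bar>m t powr (- a)\<bar> \<le> 8" if "0 \<le> a" "a \<le> 3" for a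
  proof -
    have "m t powr (- a) \<le> (1 / 2) powr (- a)" using m that by (intro powr_mono2') auto
    also have "(1 / 2) powr (- a) = 2 powr a" by (simp add: powr_minus powr_divide)
    also have "\<dots> \<le> 2 powr 3" using that by (intro powr_mono) auto
    finally show ?thesis by simp
  qed
  have M2: "M \<le> M\<^sup>2" "1 \<le> M\<^sup>2" using M by (auto simp: power2_eq_square intro: mult_mono[of 1 M 1 M, simplified])
  have sq: "(2 * b + 2 * c * t)\<^sup>2 \<le> 9 * M\<^sup>2"
    using power_mono[OF m1 abs_ge_zero, of 2] by (simp add: power_mult_distrib)
  show "((\<lambda>t. m t powr (- 1 / 2)) has_real_derivative q1 t) (at t) \<and> (q1 has_real_derivative q2 t) (at t) \<and>
      \<bar>m t powr (- 1 / 2)\<bar> \<le> 100 * M\<^sup>2 \<and> \<bar>q1 t\<bar> \<le> 100 * M\<^sup>2 \<and> \<bar>q2 t\<bar> \<le> 100 * M\<^sup>2"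
  proof (intro conjI)
    show "((\<lambda>t. m t powr (- 1 / 2)) has_real_derivative q1 t) (at t)"
      by (rule DERIV_cong[OF dp]) (simp add: q1_def field_simps)
    have "((\<lambda>t. - (1 / 2) * (2 * b + 2 * c * t)) has_real_derivative - c) (at t)"
      by (auto intro!: derivative_eq_intros)
    from DERIV_mult[OF this dp[of "- 3 / 2"]] show "(q1 has_real_derivative q2 t) (at t)"
      unfolding q1_def by (rule DERIV_cong) (simp add: q2_def power2_eq_square)
    show "\<bar>m t powr (- 1 / 2)\<bar> \<le> 100 * M\<^sup>2" using pb[of "1 / 2"] M2 by simp
    have "\<bar>q1 t\<bar> = (1 / 2) * \<bar>2 * b + 2 * c * t\<bar> * \<bar>m t powr (- (3 / 2))\<bar>" by (simp add: q1_def abs_mult)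
    also have "\<dots> \<le> (1 / 2) * (3 * M) * 8" using m1 pb[of "3 / 2"] M by (intro mult_mono) auto
    finally show "\<bar>q1 t\<bar> \<le> 100 * M\<^sup>2" using M2 by simp
    define A where "A = c * m t powr (- (3 / 2))"
    define B where "B = (2 * b + 2 * c * t)\<^sup>2 * m t powr (- (5 / 2))"
    have "\<bar>A\<bar> \<le> M\<^sup>2 * 8"
      unfolding A_def abs_mult using c pb[of "3 / 2"] by (intro mult_mono) auto
    moreover have "\<bar>B\<bar> \<le> (9 * M\<^sup>2) * 8"
      unfolding B_def abs_mult using sq pb[of "5 / 2"] by (intro mult_mono) auto
    moreover have "q2 t = (3 / 4) * B - A" by (simp add: q2_def A_def B_def)
    ultimately have "\<bar>q2 t\<bar> \<le> M\<^sup>2 * 8 + (3 / 4) * (9 * M\<^sup>2) * 8" by linarith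
    then show "\<bar>q2 t\<bar> \<le> 100 * M\<^sup>2" using M2 by simp
  qed
qed

lemma abs_trace_mult_le: "\<bar>trace (A ** B ** C)\<bar> \<le> 27 * (norm A * norm B * norm C)" for A B C :: "real^3^3"
proof -
  have e: "\<bar>X $ i $ j\<bar> \<le> norm X" for X :: "real^3^3" and i j
    using component_le_norm_cart[of "X $ i" j] Finite_Cartesian_Product.norm_nth_le[of X i] by linarith
  have "\<bar>trace (A ** B ** C)\<bar> \<le> (\<Sum>i\<in>UNIV. \<Sum>k\<in>UNIV. \<Sum>j\<in>UNIV. \<bar>A $ i $ j * B $ j $ k * C $ k $ i\<bar>)"
    unfolding trace_def matrix_matrix_mult_def
    by (simp add: sum_distrib_right) (intro order_trans[OF sum_abs] sum_mono order_refl)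
  also have "\<dots> \<le> (\<Sum>i::3\<in>UNIV. \<Sum>k::3\<in>UNIV. \<Sum>j::3\<in>UNIV. norm A * norm B * norm C)"
    unfolding abs_mult by (intro sum_mono mult_mono e mult_nonneg_nonneg abs_ge_zero norm_ge_zero)
  finally show ?thesis by simp
qed

text \<open>
  The trace is invariant under cyclic permutations, so the mixed terms coincide in groups of three.
\<close>

lemma trace_cube_add:
  fixes H P :: "real^3^3"
  shows "trace ((H + t *\<^sub>R P) ** (H + t *\<^sub>R P) ** (H + t *\<^sub>R P)) =
    trace (H ** H ** H) + 3 * trace (H ** H ** P) * t + 3 * trace (H ** P ** P) * t\<^sup>2 + trace (P ** P ** P) * t ^ 3"
proof -
  have c: "trace (A ** B ** C) = trace (B ** C ** A)" for A B C :: "real^3^3"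
    by (metis matrix_mul_assoc trace_mul_sym)
  have s: "(r *\<^sub>R A) ** B = r *\<^sub>R (A ** B)" "A ** (r *\<^sub>R B) = r *\<^sub>R (A ** B)" for r and A B :: "real^3^3"
    by (simp_all add: scalar_matrix_assoc[symmetric] matrix_scalar_ac)
  have tr: "trace (r *\<^sub>R A) = r * trace A" for r and A :: "real^3^3" by (simp add: trace_def sum_distrib_left)
  have rd: "(A + B) ** C = A ** C + B ** C" for A B C :: "real^3^3"
    by (simp add: vec_eq_iff matrix_matrix_mult_def sum.distrib algebra_simps)
  show ?thesis
    using c[of H P H] c[of P H H] c[of P H P] c[of P P H]
    by (simp add: matrix_add_ldistrib rd s tr trace_add scaleR_add_right power2_eq_square
        power3_eq_cube algebra_simps)
qed

text \<open>
  The energy density of \<open>(H + t P) / |H + t P|\<close> at a point where \<open>H\<close>, \<open>P\<close> have the partial derivatives \<open>Hd\<close>, \<open>Pd\<close>. The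
  constant \<open>1 / (3 sqrt 6)\<close> is \<open>1 / (4 sqrt 6) + 1 / (12 sqrt 6)\<close>, the part of the potential that is constant on unit vectors.
\<close>

definition edensity ::
    "real \<Rightarrow> real^3^3 \<Rightarrow> real^3^3^3 \<Rightarrow> real^3^3 \<Rightarrow> real^3^3^3 \<Rightarrow> real \<Rightarrow> real" where
  "edensity lam H Hd P Pd t = (let q = 1 / norm (H + t *\<^sub>R P) in
     1 / 2 * (\<Sum>i\<in>UNIV. q\<^sup>2 * (norm (Hd $ i + t *\<^sub>R Pd $ i))\<^sup>2
       - (q\<^sup>2)\<^sup>2 * ((H + t *\<^sub>R P) \<bullet> (Hd $ i + t *\<^sub>R Pd $ i))\<^sup>2) +
     lam * (1 / (3 * sqrt 6) - 1 / 3 * (q ^ 3 * trace ((H + t *\<^sub>R P) ** (H + t *\<^sub>R P) ** (H + t *\<^sub>R P)))))"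

text \<open>
  \<open>edensity_d1\<close> and \<open>edensity_d2\<close> are the first and second derivative of \<open>edensity\<close> in \<open>t\<close> at \<open>t = 0\<close>, provided that
  \<open>|H| = 1\<close> and that \<open>H\<close> is orthogonal to its partial derivatives.
\<close>

definition edensity_d1 ::
    "real \<Rightarrow> real^3^3 \<Rightarrow> real^3^3^3 \<Rightarrow> real^3^3 \<Rightarrow> real^3^3^3 \<Rightarrow> real" where
  "edensity_d1 lam H Hd P Pd = (\<Sum>i\<in>UNIV. Hd $ i \<bullet> Pd $ i - (H \<bullet> P) * (norm (Hd $ i))\<^sup>2)
     - lam * (trace (H ** H ** P) - (H \<bullet> P) * trace (H ** H ** H))"

definition edensity_d2 ::
    "real \<Rightarrow> real^3^3 \<Rightarrow> real^3^3^3 \<Rightarrow> real^3^3 \<Rightarrow> real^3^3^3 \<Rightarrow> real" where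
  "edensity_d2 lam H Hd P Pd = (\<Sum>i\<in>UNIV. (norm (Pd $ i))\<^sup>2 - 4 * (H \<bullet> P) * (Hd $ i \<bullet> Pd $ i)
       + (4 * (H \<bullet> P)\<^sup>2 - (norm P)\<^sup>2) * (norm (Hd $ i))\<^sup>2 - (H \<bullet> Pd $ i + P \<bullet> Hd $ i)\<^sup>2)
     - lam * (2 * trace (H ** P ** P) - 6 * (H \<bullet> P) * trace (H ** H ** P)
       + (5 * (H \<bullet> P)\<^sup>2 - (norm P)\<^sup>2) * trace (H ** H ** H))"

text \<open>
  Here \<open>s\<close> stands for \<open>1 / |x|\<close>. Derivatives are of order \<open>s\<close> and enter quadratically, which gives the order \<open>s\<^sup>2\<close> of the
  density and of its derivatives in \<open>t\<close>.
\<close>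

lemma edensity_jet2:
  assumes M: "M \<ge> 1"
  obtains K where "\<And>H Hd P Pd s. s \<ge> 1 \<Longrightarrow> norm H = 1 \<Longrightarrow> norm P \<le> M \<Longrightarrow>
      (\<And>i. H \<bullet> Hd $ i = 0) \<Longrightarrow> (\<And>i. norm (Hd $ i) \<le> M * s) \<Longrightarrow> (\<And>i. norm (Pd $ i) \<le> M * s) \<Longrightarrow>
      \<exists>e1 e2. jet2 (1 / (8 * M)) (K * s\<^sup>2) (edensity lam H Hd P Pd) e1 e2 \<and>
        e1 0 = edensity_d1 lam H Hd P Pd \<and> e2 0 = edensity_d2 lam H Hd P Pd"
proof -
  define d where "d = 1 / (8 * M)"
  have d: "0 < d" "d \<le> 1" using M by (auto simp: d_def divide_le_eq)
  define Kq where "Kq = 100 * M\<^sup>2"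
  define K2 where "K2 = 4 * (Kq * Kq)"
  define Ka where "Ka = 4 * (K2 * (8 * (2 * M\<^sup>2)))"
  define Kb where "Kb = 4 * ((4 * (K2 * K2)) * (4 * ((8 * (2 * M\<^sup>2)) * (8 * (2 * M\<^sup>2)))))"
  define Kt where "Kt = 4 * ((4 * (K2 * Kq)) * (8 * (81 * M ^ 3)))"
  define K where "K = 1 / 2 * (\<Sum>i::3\<in>UNIV. Ka + Kb) + \<bar>lam\<bar> * (1 / (3 * sqrt 6) + 1 / 3 * Kt)"
  show thesis
  proof (rule that[of K])
    fix H P :: "real^3^3" and Hd Pd :: "real^3^3^3" and s :: real
    assume s: "s \<ge> 1" and H1: "norm H = 1" and P: "norm P \<le> M" and orth: "\<And>i. H \<bullet> Hd $ i = 0"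
      and Hd: "\<And>i. norm (Hd $ i) \<le> M * s" and Pd: "\<And>i. norm (Pd $ i) \<le> M * s"
    define b where "b = H \<bullet> P"
    define c where "c = (norm P)\<^sup>2"
    have HM: "norm H \<le> M" using H1 M by simp
    have ip: "\<bar>x \<bullet> y\<bar> \<le> B * C" if "norm x \<le> B" "norm y \<le> C" for x y :: "real^3^3" and B C
      using Cauchy_Schwarz_ineq2[of x y] mult_mono[OF that order_trans[OF norm_ge_zero that(1)] norm_ge_zero] by linarith
    have bM: "\<bar>b\<bar> \<le> M" unfolding b_def using ip[OF eq_refl[OF H1] P] by simp
    have cM: "\<bar>c\<bar> \<le> M\<^sup>2" unfolding c_def using P by (simp add: power_mono)
    define m where "m t = 1 + 2 * b * t + c * t\<^sup>2" for t
    have m: "(norm (H + t *\<^sub>R P))\<^sup>2 = m t" for t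
      using H1[unfolded norm_eq_1] unfolding m_def b_def c_def power2_norm_eq_inner
      by (simp add: inner_add_left inner_add_right inner_commute[of P H] power2_eq_square algebra_simps)
    have qeq: "1 / norm (H + t *\<^sub>R P) = m t powr (- 1 / 2)" for t
    proof -
      have "m t \<ge> 0" unfolding m[symmetric] by simp
      then have "m t powr (- 1 / 2) = 1 / sqrt (m t)" by (simp add: powr_minus_divide powr_half_sqrt)
      then show ?thesis unfolding m[symmetric] by simp
    qed
    obtain q1 q2 where jq: "jet2 d Kq (\<lambda>t. m t powr (- 1 / 2)) q1 q2" and q0: "m 0 powr (- 1 / 2) = 1" "q1 0 = - b" "q2 0 = 3 * b\<^sup>2 - c"
      using jet2_inverse_sqrt[OF M bM cM] unfolding d_def Kq_def m_def
      by (fastforce simp: power2_eq_square)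
    define q where "q t = m t powr (- 1 / 2)" for t
    have jq: "jet2 d Kq q q1 q2" and q0: "q 0 = 1" "q1 0 = - b" "q2 0 = 3 * b\<^sup>2 - c"
      using jq q0 by (simp_all add: q_def[abs_def])
    note jqq = jet2_mult[OF jq jq, folded K2_def]
    \<comment> \<open>\<open>a i\<close> and \<open>\<beta> i\<close> are the squared norm of the i-th derivative of \<open>H + t P\<close> and its inner product with \<open>H + t P\<close>.\<close>
    define a where "a i t = (Hd $ i \<bullet> Hd $ i) + 2 * (Hd $ i \<bullet> Pd $ i) * t + (Pd $ i \<bullet> Pd $ i) * t\<^sup>2" for i t
    define \<beta> where "\<beta> i t = 0 + (H \<bullet> Pd $ i + P \<bullet> Hd $ i) * t + (P \<bullet> Pd $ i) * t\<^sup>2" for i t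
    have Ms: "M * M * s \<le> M\<^sup>2 * s" "M\<^sup>2 * s \<ge> 0" "(M * s) * (M * s) = M\<^sup>2 * s\<^sup>2" "M\<^sup>2 * s\<^sup>2 \<ge> 0"
      using M s by (simp_all add: power2_eq_square)
    have ja: "jet2 d (8 * (2 * (M\<^sup>2 * s\<^sup>2))) (a i) (\<lambda>t. 2 * (Hd $ i \<bullet> Pd $ i) + 2 * (Pd $ i \<bullet> Pd $ i) * t) (\<lambda>t. 2 * (Pd $ i \<bullet> Pd $ i))" for i
      unfolding a_def[abs_def]
      by (rule jet2_quadratic[OF d]) (use ip[OF Hd Hd, of i i] ip[OF Hd Pd, of i i] ip[OF Pd Pd, of i i] Ms in linarith)+
    have jb: "jet2 d (8 * (2 * (M\<^sup>2 * s))) (\<beta> i) (\<lambda>t. (H \<bullet> Pd $ i + P \<bullet> Hd $ i) + 2 * (P \<bullet> Pd $ i) * t) (\<lambda>t. 2 * (P \<bullet> Pd $ i))" for i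
      unfolding \<beta>_def[abs_def]
      by (rule jet2_quadratic[OF d]) (use ip[OF HM Pd, of i] ip[OF P Hd, of i] ip[OF P Pd, of i] Ms in \<open>simp_all only: mult.assoc[symmetric]; linarith\<close>)+
    note jqa = jet2_mult[OF jqq ja]
    note jbb = jet2_mult[OF jet2_mult[OF jqq jqq] jet2_mult[OF jb jb]]
    have tb: "\<bar>trace (A ** B ** C)\<bar> \<le> 27 * M ^ 3" if "norm A \<le> M" "norm B \<le> M" "norm C \<le> M" for A B C :: "real^3^3"
    proof -
      have "norm A * norm B * norm C \<le> M * M * M" using that M by (intro mult_mono) auto
      then show ?thesis using abs_trace_mult_le[of A B C] by (simp add: power3_eq_cube)
    qed
    have M3: "M ^ 3 \<ge> 0" using M by simp
    define T where "T t = trace (H ** H ** H) + 3 * trace (H ** H ** P) * t + 3 * trace (H ** P ** P) * t\<^sup>2 + trace (P ** P ** P) * t ^ 3" for t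
    have jT: "jet2 d (8 * (81 * M ^ 3)) T (\<lambda>t. 3 * trace (H ** H ** P) + 2 * (3 * trace (H ** P ** P)) * t + 3 * trace (P ** P ** P) * t\<^sup>2)
        (\<lambda>t. 2 * (3 * trace (H ** P ** P)) + 6 * trace (P ** P ** P) * t)"
      unfolding T_def[abs_def]
      by (rule jet2_cubic[OF d]) (use tb[OF HM HM HM] tb[OF HM HM P] tb[OF HM P P] tb[OF P P P] M3 in linarith)+
    note jqT = jet2_mult[OF jet2_mult[OF jqq jq] jT, folded Kt_def]
    note js = jet2_sum[OF finite, of UNIV, OF jet2_diff[OF jqa jbb]]
    note je = jet2_add[OF jet2_cmult[OF js, of "1 / 2"] jet2_cmult[OF jet2_diff[OF jet2_const[of d "1 / (3 * sqrt 6)"] jet2_cmult[OF jqT, of "1 / 3"]], of lam]]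
    have dens: "edensity lam H Hd P Pd = (\<lambda>t. 1 / 2 * (\<Sum>i\<in>UNIV. q t * q t * a i t
        - q t * q t * (q t * q t) * (\<beta> i t * \<beta> i t)) + lam * (1 / (3 * sqrt 6) - 1 / 3 * (q t * q t * q t * T t)))"
    proof
      fix t
      have 1: "1 / norm (H + t *\<^sub>R P) = q t" by (simp add: qeq q_def)
      have 2: "(norm (Hd $ i + t *\<^sub>R Pd $ i))\<^sup>2 = a i t" for i
        unfolding power2_norm_eq_inner a_def
        by (simp add: inner_add_left inner_add_right inner_commute[of "Pd $ i" "Hd $ i"] power2_eq_square algebra_simps)
      have 3: "(H + t *\<^sub>R P) \<bullet> (Hd $ i + t *\<^sub>R Pd $ i) = \<beta> i t" for i
        by (simp add: \<beta>_def inner_add_left inner_add_right orth power2_eq_square algebra_simps)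
      show "edensity lam H Hd P Pd t = 1 / 2 * (\<Sum>i\<in>UNIV. q t * q t * a i t
        - q t * q t * (q t * q t) * (\<beta> i t * \<beta> i t)) + lam * (1 / (3 * sqrt 6) - 1 / 3 * (q t * q t * q t * T t))"
        unfolding edensity_def Let_def 1 2 3 trace_cube_add T_def[symmetric]
        by (simp add: power2_eq_square power3_eq_cube)
    qed
    have half: "1 / 2 * sum f UNIV = (\<Sum>i\<in>UNIV. 1 / 2 * f i)" for f :: "3 \<Rightarrow> real"
      by (rule sum_distrib_left)
    have "\<bar>lam\<bar> * (1 / (3 * sqrt 6) + 1 / 3 * Kt) * 1 \<le> \<bar>lam\<bar> * (1 / (3 * sqrt 6) + 1 / 3 * Kt) * s\<^sup>2"
      using s M by (intro mult_left_mono mult_nonneg_nonneg add_nonneg_nonneg)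
        (auto simp: Kt_def K2_def Kq_def)
    then have bnd: "\<bar>1 / 2\<bar> * (\<Sum>i::3\<in>UNIV. 4 * (K2 * (8 * (2 * (M\<^sup>2 * s\<^sup>2)))) +
        4 * (4 * (K2 * K2) * (4 * (8 * (2 * (M\<^sup>2 * s)) * (8 * (2 * (M\<^sup>2 * s))))))) +
        \<bar>lam\<bar> * (\<bar>1 / (3 * sqrt 6)\<bar> + \<bar>1 / 3\<bar> * Kt) \<le> K * s\<^sup>2"
      by (simp add: K_def Ka_def Kb_def power2_eq_square algebra_simps)
    note jd = jet2_mono[OF je bnd]
    show "\<exists>e1 e2. jet2 (1 / (8 * M)) (K * s\<^sup>2) (edensity lam H Hd P Pd) e1 e2 \<and>
        e1 0 = edensity_d1 lam H Hd P Pd \<and> e2 0 = edensity_d2 lam H Hd P Pd"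
      \<comment> \<open>The derivatives are those computed in \<open>je\<close> by the rules for sums and products.\<close>
      apply (rule exI)+
      apply (intro conjI)
        apply (subst dens)
        apply (fold d_def)
        apply (rule jd)
       apply (simp add: q0 a_def \<beta>_def T_def b_def[symmetric] edensity_d1_def sum_3 dot_square_norm power2_eq_square field_simps)
      apply (simp add: q0 a_def \<beta>_def T_def b_def[symmetric] c_def edensity_d2_def sum_3 dot_square_norm
          power2_eq_square field_simps)
      done
  qed
qed

section \<open>The two variations of the energy at the hedgehog\<close>

lemma C_c_oneD: "f \<in> C_c 1 \<Omega> V \<Longrightarrow> C_k 1 f"
  by (auto simp: C_c_def one_enat_def)

lemma C_c_infinity_subset: "C_c \<infinity> \<Omega> V \<subseteq> C_c 1 \<Omega> V"
  by (auto simp: C_c_def)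

text \<open>
  The lower bound 2 lets the same \<open>M\<close> serve in the estimate \<open>|dH x (axis i 1)| \<le> 2 / |x|\<close>.
\<close>

lemma C_c_bounds:
  fixes \<Phi> :: "real^3 \<Rightarrow> 'b::real_normed_vector"
  assumes "\<Phi> \<in> C_c 1 B1 V"
  obtains M where "M \<ge> 2" "\<And>x. norm (\<Phi> x) \<le> M" "\<And>x i. norm x < 1 \<Longrightarrow> norm (grad \<Phi> x $ i) \<le> M"
proof -
  have C1: "C_k_on 1 UNIV \<Phi>" unfolding C_k_on_UNIV by (rule C_c_oneD[OF assms])
  have c0: "continuous_on (cball 0 1) \<Phi>" by (rule continuous_on_subset[OF C_k_on_imp_continuous_on[OF C1]]) simp
  have c1: "continuous_on (cball 0 1) (grad \<Phi>)" by (rule continuous_on_subset[OF continuous_on_grad[OF C1]]) simp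
  obtain A where A: "A \<ge> 0" "\<And>x. x \<in> cball 0 1 \<Longrightarrow> norm (\<Phi> x) \<le> A"
    using continuous_on_compact_bound[OF compact_cball c0] by metis
  obtain B where B: "B \<ge> 0" "\<And>x. x \<in> cball 0 1 \<Longrightarrow> norm (grad \<Phi> x) \<le> B"
    using continuous_on_compact_bound[OF compact_cball c1] by metis
  show ?thesis
  proof (rule that[of "A + B + 2"])
    show "norm (\<Phi> x) \<le> A + B + 2" for x
    proof (cases "x \<in> cball 0 1")
      case True
      then show ?thesis using A(2)[OF True] B(1) by linarith
    next
      case False
      then have "\<Phi> x = 0" by (intro C_c_eq_0[OF assms]) auto
      then show ?thesis using A B by simp
    qed
    show "norm (grad \<Phi> x $ i) \<le> A + B + 2" if "norm x < 1" for x i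
      using B(2)[of x] that A(1) Finite_Cartesian_Product.norm_nth_le[of "grad \<Phi> x" i] by simp
  qed (use A B in simp)
qed

lemma normalize_has_derivative:
  fixes A :: "'a::real_normed_vector \<Rightarrow> 'b::real_inner"
  assumes A: "(A has_derivative A') (at x)" and nz: "A x \<noteq> 0"
  shows "((\<lambda>x. (1 / norm (A x)) *\<^sub>R A x) has_derivative
    (\<lambda>h. (1 / norm (A x)) *\<^sub>R A' h - ((1 / norm (A x)) ^ 3 * (A x \<bullet> A' h)) *\<^sub>R A x)) (at x)"
proof -
  have pos: "A x \<bullet> A x > 0" using nz by simp
  have u: "((\<lambda>x. A x \<bullet> A x) has_derivative (\<lambda>h. 2 * (A x \<bullet> A' h))) (at x)"
    by (rule has_derivative_eq_rhs[OF has_derivative_inner[OF A A]]) (simp add: inner_commute fun_eq_iff)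
  have p: "((\<lambda>y. y powr (- 1 / 2)) has_derivative (*) ((- 1 / 2) * (A x \<bullet> A x) powr (- 1 / 2 - 1))) (at (A x \<bullet> A x))"
    using has_real_derivative_powr[OF pos, of "- 1 / 2"] by (simp add: has_field_derivative_def)
  have n: "norm (A x) > 0" using nz by simp
  have pw: "(y \<bullet> y) powr (- 1 / 2) = 1 / norm y" for y :: 'b
    by (simp add: powr_minus_divide powr_half_sqrt norm_eq_sqrt_inner)
  have pw3: "(A x \<bullet> A x) powr (- 1 / 2 - 1) = (1 / norm (A x)) ^ 3"
  proof -
    have "(A x \<bullet> A x) powr (- 1 / 2 - 1) = (norm (A x) powr 2) powr (- 3 / 2)"
      using n by (simp add: dot_square_norm)
    also have "\<dots> = norm (A x) powr (- 3)" by (simp only: powr_powr) simp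
    also have "\<dots> = (1 / norm (A x)) ^ 3" using n by (simp add: powr_minus_divide power_divide)
    finally show ?thesis .
  qed
  have "((\<lambda>x. (A x \<bullet> A x) powr (- 1 / 2)) has_derivative (\<lambda>h. - ((1 / norm (A x)) ^ 3 * (A x \<bullet> A' h)))) (at x)"
    by (rule has_derivative_eq_rhs[OF has_derivative_compose[OF u p]]) (simp only: pw3, simp add: fun_eq_iff)
  from has_derivative_scaleR[OF this A] show ?thesis unfolding pw by simp
qed

text \<open>The normalisation removes the component of the derivative in direction \<open>A\<close> and rescales the rest.\<close>

lemma norm_normalize_derivative:
  fixes A B :: "'b::real_inner"
  assumes "A \<noteq> 0"
  shows "(norm ((1 / norm A) *\<^sub>R B - ((1 / norm A) ^ 3 * (A \<bullet> B)) *\<^sub>R A))\<^sup>2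
    = (1 / norm A)\<^sup>2 * (norm B)\<^sup>2 - ((1 / norm A)\<^sup>2)\<^sup>2 * (A \<bullet> B)\<^sup>2"
proof -
  define n k where "n = norm A" and "k = A \<bullet> B"
  have n: "n > 0" "A \<bullet> A = n\<^sup>2" using assms by (simp_all add: n_def dot_square_norm)
  have "(norm ((1 / n) *\<^sub>R B - ((1 / n) ^ 3 * k) *\<^sub>R A))\<^sup>2
      = (1 / n)\<^sup>2 * (B \<bullet> B) - 2 * ((1 / n) * ((1 / n) ^ 3 * k)) * k + ((1 / n) ^ 3 * k)\<^sup>2 * (A \<bullet> A)"
    unfolding power2_norm_eq_inner inner_diff_left inner_diff_right
    by (simp add: k_def inner_commute[of B A] power2_eq_square algebra_simps)
  also have "\<dots> = (1 / n)\<^sup>2 * (B \<bullet> B) - ((1 / n)\<^sup>2)\<^sup>2 * k\<^sup>2"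
    unfolding n(2) using n(1) by (simp add: power2_eq_square power3_eq_cube field_simps)
  finally show ?thesis by (simp only: n_def k_def power2_norm_eq_inner)
qed

lemma W_normalize:
  assumes "A \<noteq> 0"
  shows "W ((1 / norm A) *\<^sub>R A) = 1 / (3 * sqrt 6) - 1 / 3 * ((1 / norm A) ^ 3 * trace (A ** A ** A))"
proof -
  have s: "(r *\<^sub>R A) ** B = r *\<^sub>R (A ** B)" "A ** (r *\<^sub>R B) = r *\<^sub>R (A ** B)" for r and A B :: "real^3^3"
    by (simp_all add: scalar_matrix_assoc[symmetric] matrix_scalar_ac)
  have tr: "trace (r *\<^sub>R A) = r * trace A" for r and A :: "real^3^3" by (simp add: trace_def sum_distrib_left)
  have "norm ((1 / norm A) *\<^sub>R A) = 1" using assms by simp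
  then show ?thesis unfolding W_def by (simp add: s tr power3_eq_cube)
qed

lemma hedgehog_variation_neq_0:
  assumes "x \<noteq> 0" "norm (\<Phi> x) \<le> M" "\<bar>t\<bar> < 1 / (8 * M)" "M \<ge> 1"
  shows "hedgehog x + t *\<^sub>R \<Phi> x \<noteq> 0"
proof
  assume "hedgehog x + t *\<^sub>R \<Phi> x = 0"
  then have "norm (hedgehog x) = norm (t *\<^sub>R \<Phi> x)" by (metis add_eq_0_iff norm_minus_cancel)
  also have "\<dots> \<le> (1 / (8 * M)) * M" using assms by (simp only: norm_scaleR) (intro mult_mono; simp)
  also have "\<dots> < 1" using assms by simp
  finally show False using norm_hedgehog[OF assms(1)] by simp
qed

lemma
  fixes \<Phi> :: "real^3 \<Rightarrow> real^3^3"
  assumes C1: "C_k 1 \<Phi>" and M: "M \<ge> 1" "\<And>x. norm (\<Phi> x) \<le> M" and t: "\<bar>t\<bar> < 1 / (8 * M)"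
  shows C_k_on_hedgehog_variation: "C_k_on 1 (- {0}) (variation hedgehog \<Phi> t)"
    and energy_density_hedgehog_variation: "x \<noteq> 0 \<Longrightarrow>
      1 / 2 * (norm (grad (variation hedgehog \<Phi> t) x))\<^sup>2 + lam * W (variation hedgehog \<Phi> t x)
        = edensity lam (hedgehog x) (grad hedgehog x) (\<Phi> x) (grad \<Phi> x) t"
    and grad_hedgehog_variation_bound: "x \<noteq> 0 \<Longrightarrow> norm (grad \<Phi> x $ i) \<le> M / norm x \<Longrightarrow>
      norm (grad (variation hedgehog \<Phi> t) x $ i) \<le> 8 * M / norm x"
proof -
  let ?A = "\<lambda>x. hedgehog x + t *\<^sub>R \<Phi> x"
  have nz: "?A x \<noteq> 0" if "x \<noteq> 0" for x
    using hedgehog_variation_neq_0[OF that M(2) t M(1)] .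
  have C1': "C_k_on 1 UNIV \<Phi>" using C1 by (simp only: C_k_on_UNIV)
  have A1: "C_k_on 1 (- {0}) ?A"
    by (intro C_k_on_add C_k_on_hedgehog C_k_on_scaleR C_k_on_const C_k_on_subset[OF C1']) auto
  have "C_k_on 1 (- {0}) (\<lambda>x. (?A x \<bullet> ?A x) powr (- 1 / 2) *\<^sub>R ?A x)"
    by (intro C_k_on_scaleR C_k_on_powr C_k_on_inner A1) (use nz in auto)
  then show "C_k_on 1 (- {0}) (variation hedgehog \<Phi> t)"
    by (rule C_k_on_cong[rotated]) (auto simp: variation_def powr_minus_divide powr_half_sqrt norm_eq_sqrt_inner)
  have der\<Phi>: "(\<Phi> has_derivative frechet_derivative \<Phi> (at x)) (at x)" for x
    using C1' by (simp add: frechet_derivative_works[symmetric])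
  have gr: "grad (variation hedgehog \<Phi> t) x $ i = (1 / norm (?A x)) *\<^sub>R (grad hedgehog x $ i + t *\<^sub>R grad \<Phi> x $ i)
      - ((1 / norm (?A x)) ^ 3 * (?A x \<bullet> (grad hedgehog x $ i + t *\<^sub>R grad \<Phi> x $ i))) *\<^sub>R ?A x" if "x \<noteq> 0" for x i
  proof -
    have "(?A has_derivative (\<lambda>h. dH x h + t *\<^sub>R frechet_derivative \<Phi> (at x) h)) (at x)"
      by (intro has_derivative_add has_derivative_scaleR_right hedgehog_has_derivative that der\<Phi>)
    note der = normalize_has_derivative[OF this nz[OF that]]
    have "variation hedgehog \<Phi> t = (\<lambda>x. (1 / norm (?A x)) *\<^sub>R ?A x)"
      by (rule ext) (simp add: variation_def)
    then show ?thesis using grad_eqI[OF der, of i] by (simp add: grad_hedgehog[OF that] grad_nth[of \<Phi>])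
  qed
  have nsq: "(norm (grad (variation hedgehog \<Phi> t) x $ i))\<^sup>2 =
      (1 / norm (?A x))\<^sup>2 * (norm (grad hedgehog x $ i + t *\<^sub>R grad \<Phi> x $ i))\<^sup>2
      - ((1 / norm (?A x))\<^sup>2)\<^sup>2 * (?A x \<bullet> (grad hedgehog x $ i + t *\<^sub>R grad \<Phi> x $ i))\<^sup>2" if "x \<noteq> 0" for x i
    unfolding gr[OF that] by (rule norm_normalize_derivative[OF nz[OF that]])
  show "1 / 2 * (norm (grad (variation hedgehog \<Phi> t) x))\<^sup>2 + lam * W (variation hedgehog \<Phi> t x)
        = edensity lam (hedgehog x) (grad hedgehog x) (\<Phi> x) (grad \<Phi> x) t" if "x \<noteq> 0"
    unfolding edensity_def Let_def norm_vec_power2[of "grad _ _"] nsq[OF that] variation_def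
      W_normalize[OF nz[OF that]] ..
  show "norm (grad (variation hedgehog \<Phi> t) x $ i) \<le> 8 * M / norm x"
    if x: "x \<noteq> 0" and g: "norm (grad \<Phi> x $ i) \<le> M / norm x"
  proof -
    have tM: "\<bar>t\<bar> * M \<le> 1 / 8" using t M by (simp add: field_simps)
    have "norm (t *\<^sub>R \<Phi> x) \<le> \<bar>t\<bar> * M" unfolding norm_scaleR using M(2) by (intro mult_left_mono) auto
    then have "norm (?A x) \<ge> 1 / 2"
      using norm_triangle_ineq2[of "hedgehog x" "- (t *\<^sub>R \<Phi> x)"] norm_hedgehog[OF x] tM by simp
    then have "1 / norm (?A x) \<le> 1 / (1 / 2)" by (intro divide_left_mono) (auto intro: mult_pos_pos)
    then have q: "1 / norm (?A x) \<le> 2" "0 \<le> 1 / norm (?A x)" by simp_all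
    have "norm (grad hedgehog x $ i + t *\<^sub>R grad \<Phi> x $ i) \<le> norm (grad hedgehog x $ i) + \<bar>t\<bar> * norm (grad \<Phi> x $ i)"
      using norm_triangle_ineq[of "grad hedgehog x $ i" "t *\<^sub>R grad \<Phi> x $ i"] by simp
    also have "\<dots> \<le> 2 / norm x + \<bar>t\<bar> * (M / norm x)"
      using norm_dH_axis[OF x, of i] g by (intro add_mono mult_left_mono) (auto simp: grad_hedgehog[OF x])
    also have "\<dots> = (2 + \<bar>t\<bar> * M) / norm x" by (simp add: add_divide_distrib)
    also have "\<dots> \<le> (4 * M) / norm x" using tM M by (intro divide_right_mono) auto
    finally have 1: "norm (grad hedgehog x $ i + t *\<^sub>R grad \<Phi> x $ i) \<le> 4 * M / norm x" .
    have "(norm (grad (variation hedgehog \<Phi> t) x $ i))\<^sup>2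
        \<le> (1 / norm (?A x))\<^sup>2 * (norm (grad hedgehog x $ i + t *\<^sub>R grad \<Phi> x $ i))\<^sup>2"
      unfolding nsq[OF x] by simp
    also have "\<dots> \<le> 2\<^sup>2 * (4 * M / norm x)\<^sup>2"
      using q 1 by (intro mult_mono power_mono) auto
    also have "\<dots> = (8 * M / norm x)\<^sup>2" by (simp add: power_mult_distrib power_divide)
    finally show ?thesis by (rule power2_le_imp_le) (use M in simp)
  qed
qed

abbreviation first_variation_density :: "real \<Rightarrow> (real^3 \<Rightarrow> real^3^3) \<Rightarrow> real^3 \<Rightarrow> real" where
  "first_variation_density lam \<Phi> x \<equiv> edensity_d1 lam (hedgehog x) (grad hedgehog x) (\<Phi> x) (grad \<Phi> x)"

abbreviation second_variation_density :: "real \<Rightarrow> (real^3 \<Rightarrow> real^3^3) \<Rightarrow> real^3 \<Rightarrow> real" where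
  "second_variation_density lam \<Phi> x \<equiv> edensity_d2 lam (hedgehog x) (grad hedgehog x) (\<Phi> x) (grad \<Phi> x)"

text \<open>
  Pointwise the density of the energy and its first two derivatives in \<open>t\<close> are bounded by a multiple of \<open>1 / |x|\<^sup>2\<close>, uniformly
  for small \<open>t\<close>; so it may be differentiated twice under the integral.
\<close>

lemma energy_hedgehog_variation:
  assumes \<Phi>: "\<Phi> \<in> C_c 1 B1 S0"
  obtains e' where "\<forall>\<^sub>F t in nhds 0. ((\<lambda>s. energy lam (variation hedgehog \<Phi> s)) has_real_derivative e' t) (at t)"
    and "e' 0 = (\<integral>x\<in>B1. first_variation_density lam \<Phi> x \<partial>lebesgue)"
    and "(e' has_real_derivative
      (\<integral>x\<in>B1. second_variation_density lam \<Phi> x \<partial>lebesgue)) (at 0)"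
    and "set_integrable lebesgue B1 (\<lambda>x. second_variation_density lam \<Phi> x)"
proof -
  obtain M where M: "M \<ge> 2" "\<And>x. norm (\<Phi> x) \<le> M" "\<And>x i. norm x < 1 \<Longrightarrow> norm (grad \<Phi> x $ i) \<le> M"
    using C_c_bounds[OF \<Phi>] by blast
  have M1: "M \<ge> 1" using M(1) by simp
  define d where "d = 1 / (8 * M)"
  have d: "d > 0" using M1 by (simp add: d_def)
  have C1: "C_k 1 \<Phi>" by (rule C_c_oneD[OF \<Phi>])
  let ?X = "B1 - {0} :: (real^3) set"
  let ?E = "\<lambda>t x. 1 / 2 * (norm (grad (variation hedgehog \<Phi> t) x))\<^sup>2 + lam * W (variation hedgehog \<Phi> t x)"
  let ?d = "\<lambda>x. edensity lam (hedgehog x) (grad hedgehog x) (\<Phi> x) (grad \<Phi> x)"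
  have gM: "norm (grad \<Phi> x $ i) \<le> M / norm x" if "x \<noteq> 0" "norm x < 1" for x i
  proof -
    have "norm (grad \<Phi> x $ i) \<le> M * 1" using M(3)[OF that(2)] by simp
    also have "\<dots> \<le> M * (1 / norm x)" using one_le_inverse[of x] that M1 by (intro mult_left_mono) auto
    finally show ?thesis by simp
  qed
  obtain K where K: "\<And>H Hd P Pd s. s \<ge> 1 \<Longrightarrow> norm H = 1 \<Longrightarrow> norm P \<le> M \<Longrightarrow>
      (\<And>i. H \<bullet> Hd $ i = 0) \<Longrightarrow> (\<And>i. norm (Hd $ i) \<le> M * s) \<Longrightarrow> (\<And>i. norm (Pd $ i) \<le> M * s) \<Longrightarrow>
      \<exists>e1 e2. jet2 (1 / (8 * M)) (K * s\<^sup>2) (edensity lam H Hd P Pd) e1 e2 \<and>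
        e1 0 = edensity_d1 lam H Hd P Pd \<and> e2 0 = edensity_d2 lam H Hd P Pd"
    using edensity_jet2[OF M1, of lam] by blast
  have "\<forall>x\<in>?X. \<exists>e1 e2. jet2 d (K * (1 / norm x)\<^sup>2) (?d x) e1 e2 \<and>
        e1 0 = first_variation_density lam \<Phi> x \<and>
        e2 0 = second_variation_density lam \<Phi> x"
    unfolding d_def
  proof
    fix x :: "real^3" assume "x \<in> ?X"
    then have x: "x \<noteq> 0" "norm x < 1" by auto
    show "\<exists>e1 e2. jet2 (1 / (8 * M)) (K * (1 / norm x)\<^sup>2) (?d x) e1 e2 \<and>
        e1 0 = first_variation_density lam \<Phi> x \<and>
        e2 0 = second_variation_density lam \<Phi> x"
    proof (rule K)
      show "1 \<le> 1 / norm x" using one_le_inverse[of x] x by simp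
      show "norm (hedgehog x) = 1" by (rule norm_hedgehog[OF x(1)])
      show "hedgehog x \<bullet> grad hedgehog x $ i = 0" for i
        by (simp add: grad_hedgehog[OF x(1)] inner_hedgehog_dH[OF x(1)])
      have "2 / norm x \<le> M / norm x" using M(1) by (intro divide_right_mono) auto
      then show "norm (grad hedgehog x $ i) \<le> M * (1 / norm x)" for i
        using norm_dH_axis[OF x(1), of i] by (simp add: grad_hedgehog[OF x(1)])
      show "norm (grad \<Phi> x $ i) \<le> M * (1 / norm x)" for i using gM[OF x, of i] by simp
    qed (rule M(2))
  qed
  then obtain e1 e2 where e: "\<And>x. x \<in> ?X \<Longrightarrow> jet2 d (K * (1 / norm x)\<^sup>2) (?d x) (e1 x) (e2 x)"
      and e10: "\<And>x. x \<in> ?X \<Longrightarrow> e1 x 0 = first_variation_density lam \<Phi> x"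
      and e20: "\<And>x. x \<in> ?X \<Longrightarrow> e2 x 0 = second_variation_density lam \<Phi> x"
    by metis
  \<comment> \<open>The density is set to 0 outside the punctured ball, so that the bounds hold at every point.\<close>
  define f0 where "f0 t x = (if x \<in> ?X then ?d x t else 0)" for t x
  define f1 where "f1 t x = (if x \<in> ?X then e1 x t else 0)" for t x
  define f2 where "f2 t x = (if x \<in> ?X then e2 x t else 0)" for t x
  define g where "g x = K * (indicator (cball 0 1) x * (1 / (norm x)\<^sup>2))" for x :: "real^3"
  have g: "integrable lebesgue g" unfolding g_def by (intro integrable_mult_right integrable_inverse_square)
  have gX: "g x = K * (1 / norm x)\<^sup>2" if "x \<in> ?X" for x using that by (simp add: g_def power_divide)
  have b: "(?d x has_real_derivative e1 x t) (at t)" "(e1 x has_real_derivative e2 x t) (at t)"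
      "\<bar>?d x t\<bar> \<le> g x" "\<bar>e1 x t\<bar> \<le> g x" "\<bar>e2 x t\<bar> \<le> g x" if "x \<in> ?X" "\<bar>t\<bar> < d" for x t
    using e[OF that(1)] that(2) unfolding jet2_def gX[OF that(1)] by auto
  have g0: "0 \<le> g x" for x
  proof (cases "x \<in> ?X")
    case True
    show ?thesis using order_trans[OF abs_ge_zero b(3)[OF True, of 0]] d by simp
  next
    case False
    have "(1/2) *\<^sub>R axis 1 1 \<in> ?X" by (simp add: axis_eq_0_iff)
    then have "0 \<le> g ((1/2) *\<^sub>R axis 1 1)" using order_trans[OF abs_ge_zero b(3)[of _ 0]] d by simp
    then have "K \<ge> 0" by (simp add: g_def power2_eq_square)
    then show ?thesis by (simp add: g_def)
  qed
  have var: "C_k_on 1 (- {0}) (variation hedgehog \<Phi> t)" if "\<bar>t\<bar> < d" for t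
    using C_k_on_hedgehog_variation[OF C1 M1 M(2)] that by (simp add: d_def)
  have dens: "?E t x = ?d x t"
    if "\<bar>t\<bar> < d" "x \<noteq> 0" for t x
    using energy_density_hedgehog_variation[OF C1 M1 M(2)] that by (simp add: d_def)
  have m0: "f0 t \<in> borel_measurable lebesgue" if t: "\<bar>t\<bar> < d" for t
  proof -
    have "continuous_on UNIV W"
      unfolding W_def[abs_def] trace_def matrix_matrix_mult_def by (intro continuous_intros)
    then have "continuous_on (- {0}) (\<lambda>x. ?E t x)"
      by (intro continuous_intros continuous_on_grad[OF var[OF t]]
          continuous_on_compose2[OF _ C_k_on_imp_continuous_on[OF var[OF t]]]) auto
    then have m: "(\<lambda>x. indicator ?X x *\<^sub>R (?E t x))
        \<in> borel_measurable lebesgue"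
      by (intro borel_measurable_scaleR borel_measurable_indicator measurable_of_continuous_off_0) auto
    moreover have "(\<lambda>x. indicator ?X x *\<^sub>R (?E t x)) = f0 t"
    proof
      show "indicator ?X x *\<^sub>R (?E t x) = f0 t x" for x
        using dens[OF t, of x] by (cases "x \<in> ?X") (auto simp: f0_def)
    qed
    ultimately show ?thesis by simp
  qed
  have i0: "integrable lebesgue (f0 t)" if t: "\<bar>t\<bar> < d" for t
    by (rule Bochner_Integration.integrable_bound[OF g m0[OF t]])
      (use b(3)[OF _ t] g0 in \<open>auto intro!: AE_I2 simp: f0_def\<close>)
  have en: "energy lam (variation hedgehog \<Phi> t) = (\<integral>x. f0 t x \<partial>lebesgue)" if t: "\<bar>t\<bar> < d" for t
  proof -
    have "energy lam (variation hedgehog \<Phi> t) = (\<integral>x\<in>B1. ?E t x \<partial>lebesgue)"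
    proof (rule energy_eq[OF var[OF t], of "8 * M"])
      fix x :: "real^3" assume x: "x \<noteq> 0" "norm x < 1"
      show "norm (variation hedgehog \<Phi> t x) \<le> 8 * M"
        using hedgehog_variation_neq_0[OF x(1) M(2) _ M1] t M1 by (simp add: variation_def d_def)
      show "norm (grad (variation hedgehog \<Phi> t) x $ i) \<le> 8 * M / norm x" for i
        using grad_hedgehog_variation_bound[OF C1 M1 M(2) _ x(1) gM[OF x]] t by (simp add: d_def)
    qed
    also have "\<dots> = (\<integral>x. f0 t x \<partial>lebesgue)"
      unfolding set_lebesgue_integral_def
    proof (rule integral_lebesgue_cong_AE(2)[OF i0[OF t], symmetric])
      show "AE x in lebesgue. f0 t x = indicator B1 x *\<^sub>R (?E t x)"
        using AE_lebesgue_neq_0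
      proof eventually_elim
        case (elim x)
        then show ?case using dens[OF t elim] by (auto simp: f0_def indicator_def)
      qed
    qed
    finally show ?thesis .
  qed
  have der01: "((\<lambda>s. f0 s x) has_real_derivative f1 t x) (at t)" and der12: "((\<lambda>s. f1 s x) has_real_derivative f2 t x) (at t)"
    and bound1: "\<bar>f1 t x\<bar> \<le> g x" and bound2: "\<bar>f2 t x\<bar> \<le> g x" if t: "\<bar>t\<bar> < d" for t x
  proof -
    have "((\<lambda>s. f0 s x) has_real_derivative f1 t x) (at t) \<and> ((\<lambda>s. f1 s x) has_real_derivative f2 t x) (at t)
        \<and> \<bar>f1 t x\<bar> \<le> g x \<and> \<bar>f2 t x\<bar> \<le> g x"
    proof (cases "x \<in> ?X")
      case True
      show ?thesis unfolding f0_def f1_def f2_def if_P[OF True] by (intro conjI b[OF True t])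
    next
      case False
      show ?thesis unfolding f0_def f1_def f2_def if_not_P[OF False] using g0[of x] by simp
    qed
    then show "((\<lambda>s. f0 s x) has_real_derivative f1 t x) (at t)" "((\<lambda>s. f1 s x) has_real_derivative f2 t x) (at t)"
      "\<bar>f1 t x\<bar> \<le> g x" "\<bar>f2 t x\<bar> \<le> g x" by blast+
  qed
  have D1: "integrable lebesgue (f1 t)" "((\<lambda>t. \<integral>x. f0 t x \<partial>lebesgue) has_real_derivative (\<integral>x. f1 t x \<partial>lebesgue)) (at t)"
    if t: "\<bar>t\<bar> < d" for t
  proof -
    have near: "\<bar>s\<bar> < d" if "\<bar>s - t\<bar> < d - \<bar>t\<bar>" for s using that by linarith
    have pos: "0 < d - \<bar>t\<bar>" using t by simp
    note R = derivative_under_integral[OF pos i0[OF near] der01[OF near] bound1[OF near] g]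
    show "integrable lebesgue (f1 t)" by (rule R(1))
    show "((\<lambda>t. \<integral>x. f0 t x \<partial>lebesgue) has_real_derivative (\<integral>x. f1 t x \<partial>lebesgue)) (at t)" by (rule R(2))
  qed
  have near0: "\<bar>s\<bar> < d" if "\<bar>s - 0\<bar> < d" for s using that by simp
  have D2: "integrable lebesgue (f2 0)" "((\<lambda>t. \<integral>x. f1 t x \<partial>lebesgue) has_real_derivative (\<integral>x. f2 0 x \<partial>lebesgue)) (at 0)"
  proof -
    note R = derivative_under_integral[where ?t0.0 = 0, OF d D1(1)[OF near0] der12[OF near0] bound2[OF near0] g]
    show "integrable lebesgue (f2 0)" by (rule R(1))
    show "((\<lambda>t. \<integral>x. f1 t x \<partial>lebesgue) has_real_derivative (\<integral>x. f2 0 x \<partial>lebesgue)) (at 0)" by (rule R(2))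
  qed
  have ae1: "AE x in lebesgue. f1 0 x = indicator B1 x *\<^sub>R first_variation_density lam \<Phi> x"
    using AE_lebesgue_neq_0 by eventually_elim (simp add: f1_def e10 indicator_def)
  have ae2: "AE x in lebesgue. f2 0 x = indicator B1 x *\<^sub>R second_variation_density lam \<Phi> x"
    using AE_lebesgue_neq_0 by eventually_elim (simp add: f2_def e20 indicator_def)
  show ?thesis
  proof (rule that[of "\<lambda>t. \<integral>x. f1 t x \<partial>lebesgue"])
    have op: "open {-d<..<d}" "0 \<in> {-d<..<d}" using d by auto
    show "\<forall>\<^sub>F t in nhds 0. ((\<lambda>s. energy lam (variation hedgehog \<Phi> s)) has_real_derivative (\<integral>x. f1 t x \<partial>lebesgue)) (at t)"
    proof (rule eventually_mono[OF eventually_nhds_in_open[OF op]])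
      fix t assume t: "t \<in> {-d<..<d}"
      show "((\<lambda>s. energy lam (variation hedgehog \<Phi> s)) has_real_derivative (\<integral>x. f1 t x \<partial>lebesgue)) (at t)"
        by (rule has_field_derivative_transform_within_open[OF D1(2) op(1) t]) (use t en in \<open>auto simp: abs_less_iff\<close>)
    qed
    show "(\<integral>x. f1 0 x \<partial>lebesgue) = (\<integral>x\<in>B1. first_variation_density lam \<Phi> x \<partial>lebesgue)"
      unfolding set_lebesgue_integral_def using d by (intro integral_lebesgue_cong_AE(2)[OF D1(1) ae1]) simp
    show "((\<lambda>t. \<integral>x. f1 t x \<partial>lebesgue) has_real_derivative
      (\<integral>x\<in>B1. second_variation_density lam \<Phi> x \<partial>lebesgue)) (at 0)"
      using D2(2) unfolding integral_lebesgue_cong_AE(2)[OF D2(1) ae2] set_lebesgue_integral_def .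
    show "set_integrable lebesgue B1 (\<lambda>x. second_variation_density lam \<Phi> x)"
      using integral_lebesgue_cong_AE(1)[OF D2(1) ae2] by (simp only: set_integrable_def)
  qed
qed

section \<open>The hedgehog is a critical point\<close>

lemma tensor_matrix_mult: "tensor a b ** tensor c d = (b \<bullet> c) *\<^sub>R tensor a d"
  by (simp add: vec_eq_iff matrix_matrix_mult_def tensor_nth inner_vec_def sum_distrib_left sum_distrib_right mult_ac)

lemma hedgehog_in_S0:
  assumes "x \<noteq> 0"
  shows "hedgehog x \<in> S0"
proof -
  have "trace (hedgehog x) = 0"
    using assms unfolding inner_mat_1[symmetric] hedgehog_eq
    by (simp add: inner_diff_right tensor_inners)
  moreover have "transpose (hedgehog x) = hedgehog x"
    unfolding hedgehog_eq by (auto simp: vec_eq_iff transpose_def tensor_nth mat_def mult.commute)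
  ultimately show ?thesis by (simp add: S0_def)
qed

text \<open>
  The quadratic relation that singles out the uniaxial matrices \<open>sqrt (3/2) (n \<otimes> n - I/3)\<close>; it says that the
  derivative of the potential has no component in \<open>S0\<close> tangential to the sphere.
\<close>

lemma hedgehog_square:
  assumes "x \<noteq> 0"
  shows "hedgehog x ** hedgehog x = (1 / sqrt 6) *\<^sub>R hedgehog x + (1 / 3) *\<^sub>R mat 1"
proof -
  have s: "(r *\<^sub>R A) ** B = r *\<^sub>R (A ** B)" "A ** (r *\<^sub>R B) = r *\<^sub>R (A ** B)" for r and A B :: "real^3^3"
    by (simp_all add: scalar_matrix_assoc[symmetric] matrix_scalar_ac)
  have sub: "(A - B) ** (A - B) = A ** A - A ** B - B ** A + B ** B" for A B :: "real^3^3"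
    by (simp add: vec_eq_iff matrix_matrix_mult_def sum_subtractf sum.distrib algebra_simps)
  have sq: "1 / sqrt 6 * sqrt (3 / 2) = 1 / 2"
  proof -
    have "sqrt 6 = sqrt (3 / 2) * sqrt 4" unfolding real_sqrt_mult[symmetric] by simp
    then show ?thesis by simp
  qed
  have "hedgehog x ** hedgehog x = (3 / 2) *\<^sub>R (((1 / (x \<bullet> x)) *\<^sub>R tensor x x - (1 / 3) *\<^sub>R mat 1)
      ** ((1 / (x \<bullet> x)) *\<^sub>R tensor x x - (1 / 3) *\<^sub>R mat 1))"
    unfolding hedgehog_eq by (simp add: s)
  also have "\<dots> = (1 / 2) *\<^sub>R ((1 / (x \<bullet> x)) *\<^sub>R tensor x x - (1 / 3) *\<^sub>R mat 1) + (1 / 3) *\<^sub>R mat 1"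
    using assms unfolding sub by (simp add: s tensor_matrix_mult) (simp add: vec_eq_iff algebra_simps)
  also have "\<dots> = (1 / sqrt 6 * sqrt (3 / 2)) *\<^sub>R ((1 / (x \<bullet> x)) *\<^sub>R tensor x x - (1 / 3) *\<^sub>R mat 1) + (1 / 3) *\<^sub>R mat 1"
    by (simp only: sq)
  also have "\<dots> = (1 / sqrt 6) *\<^sub>R hedgehog x + (1 / 3) *\<^sub>R mat 1"
    unfolding hedgehog_eq by (simp only: scaleR_scaleR)
  finally show ?thesis .
qed

lemma trace_hedgehog_square_mult:
  assumes "x \<noteq> 0" "P \<in> S0"
  shows "trace (hedgehog x ** hedgehog x ** P) = (hedgehog x \<bullet> P) / sqrt 6"
proof -
  have s: "(r *\<^sub>R A) ** B = r *\<^sub>R (A ** B)" for r and A B :: "real^3^3"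
    by (simp add: scalar_matrix_assoc[symmetric])
  have rd: "(A + B) ** C = A ** C + B ** C" for A B C :: "real^3^3"
    by (simp add: vec_eq_iff matrix_matrix_mult_def sum.distrib algebra_simps)
  have tr: "trace (r *\<^sub>R A) = r * trace A" for r and A :: "real^3^3" by (simp add: trace_def sum_distrib_left)
  have "trace (hedgehog x ** hedgehog x ** P) = 1 / sqrt 6 * trace (hedgehog x ** P) + 1 / 3 * trace P"
    unfolding hedgehog_square[OF assms(1)] by (simp add: rd s tr trace_add)
  also have "\<dots> = (hedgehog x \<bullet> P) / sqrt 6"
    using assms(2) by (simp add: inner_S0[OF hedgehog_in_S0[OF assms(1)] assms(2)] S0_def)
  finally show ?thesis .
qed

lemma trace_hedgehog_cube:
  "x \<noteq> 0 \<Longrightarrow> trace (hedgehog x ** hedgehog x ** hedgehog x) = 1 / sqrt 6"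
  using trace_hedgehog_square_mult[OF _ hedgehog_in_S0] inner_hedgehog_hedgehog by simp

lemma hedgehog_in_W12: "hedgehog \<in> W12 B1 S4"
proof -
  have H1: "C_k_on 1 (- {0}) hedgehog" by (rule C_k_on_hedgehog)
  have m: "hedgehog \<in> borel_measurable lebesgue" "grad hedgehog \<in> borel_measurable lebesgue"
    by (intro measurable_of_continuous_off_0 C_k_on_imp_continuous_on[OF H1] continuous_on_grad[OF H1])+
  have b1: "norm (grad hedgehog x $ i) \<le> 2 / norm x" if "x \<noteq> 0" for x i
    using norm_dH_axis[OF that] by (simp add: grad_hedgehog[OF that])
  have "has_weak_gradient hedgehog (grad hedgehog) B1"
    by (rule has_weak_gradient_grad[OF H1, of 2]) (use norm_hedgehog b1 in auto)
  moreover have "square_integrable B1 hedgehog"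
    unfolding square_integrable_def set_borel_measurable_def
  proof
    show "(\<lambda>x. indicator B1 x *\<^sub>R hedgehog x) \<in> borel_measurable lebesgue"
      by (intro borel_measurable_scaleR borel_measurable_indicator m) simp
    show "set_integrable lebesgue B1 (\<lambda>x. (norm (hedgehog x))\<^sup>2)"
    proof (rule set_integrable_inverse_square_bound[where C = 1])
      fix x :: "real^3" assume x: "x \<in> B1" "x \<noteq> 0"
      have "1 \<le> 1 / (norm x)\<^sup>2" using order_trans[OF one_le_inverse inverse_le_inverse_square, of x] x by simp
      then show "norm ((norm (hedgehog x))\<^sup>2) \<le> 1 / (norm x)\<^sup>2" by (simp add: norm_hedgehog[OF x(2)])
    qed (use m ball_subset_cball in auto)
  qed
  moreover have "square_integrable B1 (grad hedgehog)"
    unfolding square_integrable_def set_borel_measurable_def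
  proof
    show "(\<lambda>x. indicator B1 x *\<^sub>R grad hedgehog x) \<in> borel_measurable lebesgue"
      by (intro borel_measurable_scaleR borel_measurable_indicator m) simp
    show "set_integrable lebesgue B1 (\<lambda>x. (norm (grad hedgehog x))\<^sup>2)"
      by (rule set_integrable_inverse_square_bound[where C = 6])
        (use m ball_subset_cball in \<open>auto simp: norm_grad_hedgehog dot_square_norm\<close>)
  qed
  moreover have "AE x in lebesgue. x \<in> B1 \<longrightarrow> hedgehog x \<in> S4"
    using AE_lebesgue_neq_0 by eventually_elim (simp add: S4_def hedgehog_in_S0 norm_hedgehog)
  ultimately show ?thesis unfolding W12_def by blast
qed

lemma C_k_on_dH_axis: "C_k_on k (- {0}) (\<lambda>x. dH x (axis i 1))"
proof -
  have "C_k_on (Suc k) (- {0}) hedgehog" by (rule C_k_on_hedgehog)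
  then have "C_k_on k (- {0}) (\<lambda>x. frechet_derivative hedgehog (at x) (axis i 1))" by simp
  then show ?thesis
    by (rule C_k_on_cong[rotated]) (auto simp: grad_hedgehog[symmetric] grad_nth)
qed

abbreviation tension :: "(real^3 \<Rightarrow> real^3^3) \<Rightarrow> real^3 \<Rightarrow> real" where
  "tension \<Phi> x \<equiv>
     \<Sum>i\<in>UNIV. grad hedgehog x $ i \<bullet> grad \<Phi> x $ i - (hedgehog x \<bullet> \<Phi> x) * (norm (grad hedgehog x $ i))\<^sup>2"

text \<open>
  The weak form of \<open>- \<Delta>H = |\<nabla>H|\<^sup>2 H\<close>, valid across the singularity: the integrand is the sum over \<open>i\<close> of the i-th partial
  derivatives of \<open>\<Phi> \<bullet> dH x (axis i 1)\<close>, which are functions of order \<open>1 / |x|\<close>.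
\<close>

lemma hedgehog_weakly_harmonic:
  assumes \<Phi>: "\<Phi> \<in> C_c 1 B1 V"
  shows "set_integrable lebesgue B1 (tension \<Phi>)" (is ?int)
    and "(\<integral>x\<in>B1. tension \<Phi> x \<partial>lebesgue) = 0" (is ?zero)
proof -
  obtain M where M: "M \<ge> 2" "\<And>x. norm (\<Phi> x) \<le> M" "\<And>x i. norm x < 1 \<Longrightarrow> norm (grad \<Phi> x $ i) \<le> M"
    using C_c_bounds[OF \<Phi>] by blast
  obtain C where C: "\<And>x i. x \<noteq> 0 \<Longrightarrow> norm (ddH x (axis i 1) (axis i 1)) \<le> C / (norm x)\<^sup>2"
    using norm_ddH_axis by blast
  have C1: "C_k_on 1 UNIV \<Phi>" unfolding C_k_on_UNIV by (rule C_c_oneD[OF \<Phi>])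
  have der\<Phi>: "(\<Phi> has_derivative frechet_derivative \<Phi> (at x)) (at x)" for x
    using C1 by (simp add: frechet_derivative_works[symmetric])
  define D where "D i x h = \<Phi> x \<bullet> ddH x (axis i 1) h + frechet_derivative \<Phi> (at x) h \<bullet> dH x (axis i 1)" for i :: 3 and x h
  have C0: "C \<ge> 0" using order_trans[OF norm_ge_zero C[of "axis 1 1" 1]] by (simp add: axis_eq_0_iff)
  have *: "set_integrable lebesgue B1 (\<lambda>x. D i x (axis i 1))" "(\<integral>x\<in>B1. D i x (axis i 1) \<partial>lebesgue) = 0" for i
  proof -
    have C1': "C_k_on 1 (- {0}) (\<lambda>x. \<Phi> x \<bullet> dH x (axis i 1))"
      by (intro C_k_on_inner C_k_on_subset[OF C1] C_k_on_dH_axis) auto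
    have supp: "\<Phi> x \<bullet> dH x (axis i 1) = 0" if "x \<notin> B1" for x using C_c_eq_0[OF \<Phi> that] by simp
    have ax: "axis i 1 \<in> (Basis :: (real^3) set)" by simp
    have b0: "\<bar>\<Phi> x \<bullet> dH x (axis i 1)\<bar> \<le> (2 * M + M * C) / norm x" if x: "x \<noteq> 0" "norm x < 1" for x
    proof -
      have "\<bar>\<Phi> x \<bullet> dH x (axis i 1)\<bar> \<le> M * (2 / norm x)"
        by (rule order_trans[OF Cauchy_Schwarz_ineq2]) (use M norm_dH_axis[OF x(1)] in \<open>intro mult_mono; simp\<close>)
      also have "\<dots> \<le> (2 * M + M * C) / norm x" using M C0 by (simp add: divide_right_mono)
      finally show ?thesis .
    qed
    have der: "((\<lambda>x. \<Phi> x \<bullet> dH x (axis i 1)) has_derivative D i x) (at x)" if "x \<noteq> 0" for x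
      unfolding D_def by (rule has_derivative_inner[OF der\<Phi> dH_has_derivative[OF that]])
    have b1: "\<bar>D i x (axis i 1)\<bar> \<le> (2 * M + M * C) / (norm x)\<^sup>2" if x: "x \<noteq> 0" "norm x < 1" for x
    proof -
      have "\<bar>\<Phi> x \<bullet> ddH x (axis i 1) (axis i 1)\<bar> \<le> M * (C / (norm x)\<^sup>2)"
        by (rule order_trans[OF Cauchy_Schwarz_ineq2]) (use M C[OF x(1)] in \<open>intro mult_mono; simp\<close>)
      moreover have "\<bar>frechet_derivative \<Phi> (at x) (axis i 1) \<bullet> dH x (axis i 1)\<bar> \<le> M * (2 / norm x)"
        by (rule order_trans[OF Cauchy_Schwarz_ineq2])
          (use M(1) M(3)[OF x(2), of i] norm_dH_axis[OF x(1)] in \<open>intro mult_mono; simp add: grad_nth\<close>)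
      moreover have "M * (2 / norm x) \<le> 2 * M * (1 / (norm x)\<^sup>2)"
        using inverse_le_inverse_square[of x] x M(1) mult_left_mono[of "1 / norm x" "1 / (norm x)\<^sup>2" "2 * M"]
        by (simp add: mult.commute)
      ultimately have "\<bar>D i x (axis i 1)\<bar> \<le> M * (C / (norm x)\<^sup>2) + 2 * M * (1 / (norm x)\<^sup>2)"
        unfolding D_def by linarith
      also have "\<dots> = (2 * M + M * C) / (norm x)\<^sup>2" by (simp add: add_divide_distrib)
      finally show ?thesis .
    qed
    show "set_integrable lebesgue B1 (\<lambda>x. D i x (axis i 1))"
      by (rule set_integral_partial_derivative_singular(1)[OF C1' supp ax b0 der b1])
    show "(\<integral>x\<in>B1. D i x (axis i 1) \<partial>lebesgue) = 0"
      by (rule set_integral_partial_derivative_singular(2)[OF C1' supp ax b0 der b1])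
  qed
  have "tension \<Phi> x
      = (\<Sum>i\<in>UNIV. D i x (axis i 1))" if "x \<noteq> 0" for x
  proof -
    have "(\<Sum>i\<in>UNIV. (hedgehog x \<bullet> \<Phi> x) * (norm (grad hedgehog x $ i))\<^sup>2) = (hedgehog x \<bullet> \<Phi> x) * (6 / (x \<bullet> x))"
      unfolding sum_distrib_left[symmetric] norm_vec_power2[symmetric] norm_grad_hedgehog[OF that] ..
    moreover have "(\<Sum>i\<in>UNIV. \<Phi> x \<bullet> ddH x (axis i 1) (axis i 1)) = - (hedgehog x \<bullet> \<Phi> x) * (6 / (x \<bullet> x))"
      unfolding inner_sum_right[symmetric] laplacian_hedgehog[OF that] by (simp add: inner_commute)
    ultimately show ?thesis
      by (simp add: D_def sum.distrib sum_subtractf grad_hedgehog[OF that] grad_nth[of \<Phi>] inner_commute)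
  qed
  then have ae: "AE x in lebesgue. indicator B1 x *\<^sub>R (\<Sum>i\<in>UNIV. D i x (axis i 1)) = indicator B1 x *\<^sub>R
      tension \<Phi> x"
    using AE_lebesgue_neq_0 by (elim eventually_mono) simp
  have int: "integrable lebesgue (\<lambda>x. \<Sum>i\<in>UNIV. indicator B1 x *\<^sub>R D i x (axis i 1))"
    using *(1) by (intro Bochner_Integration.integrable_sum) (simp add: set_integrable_def)
  show ?int
    using integral_lebesgue_cong_AE(1)[OF _ ae] int by (simp only: scaleR_sum_right set_integrable_def)
  have "(\<integral>x\<in>B1. tension \<Phi> x \<partial>lebesgue)
      = (\<integral>x. (\<Sum>i\<in>UNIV. indicator B1 x *\<^sub>R D i x (axis i 1)) \<partial>lebesgue)"
    unfolding set_lebesgue_integral_def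
    using integral_lebesgue_cong_AE(2)[OF _ ae] int by (simp only: scaleR_sum_right)
  also have "\<dots> = (\<Sum>i\<in>UNIV. \<integral>x. indicator B1 x *\<^sub>R D i x (axis i 1) \<partial>lebesgue)"
    using *(1) by (intro Bochner_Integration.integral_sum) (simp add: set_integrable_def)
  also have "\<dots> = 0" using *(2) by (simp add: set_lebesgue_integral_def)
  finally show ?zero .
qed

text \<open>
  The contribution of the Dirichlet energy vanishes by integration by parts, that of the potential pointwise.
\<close>

theorem critical_point_hedgehog: "critical_point lam hedgehog"
  unfolding critical_point_def
proof (intro conjI ballI hedgehog_in_W12)
  fix \<Phi> assume \<Phi>: "\<Phi> \<in> C_c 1 B1 S0"
  have S0: "\<Phi> x \<in> S0" for x using \<Phi> by (simp add: C_c_def)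
  obtain e' where e: "\<forall>\<^sub>F t in nhds 0. ((\<lambda>s. energy lam (variation hedgehog \<Phi> s)) has_real_derivative e' t) (at t)"
    and e0: "e' 0 = (\<integral>x\<in>B1. first_variation_density lam \<Phi> x \<partial>lebesgue)"
    using energy_hedgehog_variation[OF \<Phi>] by blast
  have d1: "first_variation_density lam \<Phi> x =
      tension \<Phi> x" if "x \<noteq> 0" for x
    unfolding edensity_d1_def trace_hedgehog_square_mult[OF that S0] trace_hedgehog_cube[OF that] by simp
  have ae: "AE x in lebesgue. indicator B1 x *\<^sub>R
      tension \<Phi> x
      = indicator B1 x *\<^sub>R first_variation_density lam \<Phi> x"
    using AE_lebesgue_neq_0 by (rule eventually_mono) (simp only: d1 not_False_eq_True)
  have "e' 0 = 0"
    unfolding e0 set_lebesgue_integral_def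
    using integral_lebesgue_cong_AE(2)[OF hedgehog_weakly_harmonic(1)[OF \<Phi>, unfolded set_integrable_def] ae]
      hedgehog_weakly_harmonic(2)[OF \<Phi>] by (simp only: set_lebesgue_integral_def)
  then show "((\<lambda>t. energy lam (variation hedgehog \<Phi> t)) has_real_derivative 0) (at 0)"
    using eventually_nhds_x_imp_x[OF e] by simp
qed

section \<open>Averages over spheres\<close>

text \<open>
  The divergence theorem for a vector field \<open>G(|x|\<^sup>2) Y(x)\<close> with \<open>Y\<close> tangential to the spheres: the
  derivative of the radial factor drops out. This replaces integration over spheres.
\<close>

lemma integral_radial_times_divergence:
  fixes Y :: "real^3 \<Rightarrow> real^3"
  assumes G: "C_k 1 G" "\<And>s. s > 1 \<Longrightarrow> G s = 0"
    and Y: "C_k_on 1 UNIV Y" "\<And>x. (Y has_derivative Y' x) (at x)" "\<And>x. x \<bullet> Y x = 0"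
  shows "integrable lebesgue (\<lambda>x. G (x \<bullet> x) * (\<Sum>i\<in>UNIV. Y' x (axis i 1) $ i))"
    and "(\<integral>x. G (x \<bullet> x) * (\<Sum>i\<in>UNIV. Y' x (axis i 1) $ i) \<partial>lebesgue) = 0"
proof -
  let ?\<psi> = "\<lambda>i x. G (x \<bullet> x) * Y x $ i"
  define G' where "G' s = frechet_derivative G (at s) 1" for s
  have C\<psi>: "C_k_on 1 UNIV (?\<psi> i)" for i
    by (intro C_k_on_mult C_k_on_compose[OF _ G(1)] C_k_on_inner C_k_on_ident
        C_k_on_bounded_linear[OF _ bounded_linear_vec_nth Y(1)] open_UNIV)
  have dG: "(G has_derivative (\<lambda>h. h * G' s)) (at s)" for s
  proof -
    have *: "(G has_derivative frechet_derivative G (at s)) (at s)"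
      using G(1) by (simp add: frechet_derivative_works[symmetric])
    have "frechet_derivative G (at s) h = h * G' s" for h
      using linear_scale[OF has_derivative_linear[OF *], of h 1] by (simp add: G'_def)
    then have "frechet_derivative G (at s) = (\<lambda>h. h * G' s)" by (rule ext)
    with * show ?thesis by argo
  qed
  have d\<psi>: "(?\<psi> i has_derivative (\<lambda>h. G (x \<bullet> x) * Y' x h $ i + (2 * (x \<bullet> h)) * G' (x \<bullet> x) * Y x $ i)) (at x)" for i x
  proof -
    have "((\<lambda>x. x \<bullet> x) has_derivative (\<lambda>h. 2 * (x \<bullet> h))) (at x)"
      by (rule has_derivative_eq_rhs[OF has_derivative_inner[OF has_derivative_ident has_derivative_ident]])
        (simp add: inner_commute fun_eq_iff)
    from has_derivative_mult[OF has_derivative_compose[OF this dG] bounded_linear.has_derivative[OF bounded_linear_vec_nth Y(2)]]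
    show ?thesis .
  qed
  let ?D = "\<lambda>i x. frechet_derivative (?\<psi> i) (at x) (axis i 1)"
  have D: "?D i x = G (x \<bullet> x) * Y' x (axis i 1) $ i + (2 * (x \<bullet> axis i 1)) * G' (x \<bullet> x) * Y x $ i" for i x
    using fun_cong[OF frechet_derivative_at[OF d\<psi>[of i x]], of "axis i 1"] by simp
  have sum: "G (x \<bullet> x) * (\<Sum>i\<in>UNIV. Y' x (axis i 1) $ i) = (\<Sum>i\<in>UNIV. ?D i x)" for x
  proof -
    have "(\<Sum>i\<in>UNIV. (2 * (x \<bullet> axis i 1)) * G' (x \<bullet> x) * Y x $ i) = 2 * G' (x \<bullet> x) * (\<Sum>i\<in>UNIV. x $ i * Y x $ i)"
      unfolding sum_distrib_left by (intro sum.cong) (simp_all add: inner_axis)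
    also have "(\<Sum>i\<in>UNIV. x $ i * Y x $ i) = 0" using Y(3)[of x] by (simp add: inner_vec_def)
    finally show ?thesis unfolding D sum.distrib sum_distrib_left[symmetric] by simp
  qed
  have supp: "?\<psi> i x = 0" if "x \<notin> cball 0 1" for i x
  proof -
    have "norm x > 1" using that by simp
    then have "1 < (norm x)\<^sup>2" by (intro one_less_power) auto
    then show ?thesis using G(2)[of "x \<bullet> x"] by (simp add: power2_norm_eq_inner)
  qed
  have int: "integrable lebesgue (?D i)" for i
  proof -
    have c: "continuous_on UNIV (?D i)" using C\<psi>[of i] by simp
    have "integrable lborel (\<lambda>x. indicator (cball 0 1) x *\<^sub>R ?D i x)"
      by (rule borel_integrable_compact) (use continuous_on_subset[OF c] in auto)
    moreover have "(\<lambda>x. indicator (cball 0 1) x *\<^sub>R ?D i x) = ?D i"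
    proof
      fix x :: "real^3"
      show "indicator (cball 0 1) x *\<^sub>R ?D i x = ?D i x"
      proof (cases "x \<in> cball 0 1")
        case False
        then have "?D i x = 0"
          by (intro frechet_derivative_zero_on_open(2)[of "- cball 0 1"] supp) auto
        then show ?thesis by simp
      qed simp
    qed
    ultimately have "integrable lborel (?D i)" by simp
    then show ?thesis by (subst integrable_completion) (use borel_measurable_continuous_onI[OF c] in auto)
  qed
  have zero: "(\<integral>x. ?D i x \<partial>lebesgue) = 0" for i
    by (rule integral_partial_derivative_eq_0[where R = 1])
      (use C\<psi>[of i] supp[of _ i] in \<open>simp_all only: C_k_on_UNIV axis_in_Basis_iff Basis_real_def, simp_all\<close>)
  show "integrable lebesgue (\<lambda>x. G (x \<bullet> x) * (\<Sum>i\<in>UNIV. Y' x (axis i 1) $ i))"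
    unfolding sum by (intro Bochner_Integration.integrable_sum int)
  show "(\<integral>x. G (x \<bullet> x) * (\<Sum>i\<in>UNIV. Y' x (axis i 1) $ i) \<partial>lebesgue) = 0"
    unfolding sum by (subst Bochner_Integration.integral_sum[OF int]) (simp add: zero)
qed

lemma inner_matrix_vector_symmetric:
  fixes v :: "real^'n^'n"
  assumes "transpose v = v"
  shows "(v *v a) \<bullet> b = a \<bullet> (v *v b)"
proof -
  have "v *v a = a v* v" using transpose_matrix_vector[of v a] unfolding assms .
  then show ?thesis by (simp only: dot_lmul_matrix)
qed

lemma sum_inner_axis_mult: "(\<Sum>i\<in>UNIV. (a \<bullet> axis i 1) * b $ i) = a \<bullet> b" for a b :: "real^'n"
  by (simp add: inner_axis) (simp add: inner_vec_def)

lemma sum_matrix_axis: "(\<Sum>i\<in>UNIV. (v *v axis i 1) $ i) = trace v" for v :: "real^'n^'n"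
  by (simp add: trace_def matrix_vector_mult_basis column_def)

text \<open>
  With \<open>n = x / |x|\<close> these identities say that \<open>|v n|\<^sup>2\<close> and \<open>(n \<bullet> v n)\<^sup>2\<close> have the averages 1/3 and 2/15 over
  every sphere; in particular \<open>(hedgehog x \<bullet> v)\<^sup>2\<close> has average 1/5.
\<close>

lemma sphere_averages:
  fixes v :: "real^3^3"
  assumes G: "C_k 1 G" "\<And>s. s > 1 \<Longrightarrow> G s = 0" and v: "transpose v = v" "trace v = 0" "trace (v ** v) = 1"
  defines "S \<equiv> \<lambda>x. (v *v x) \<bullet> (v *v x)" and "P \<equiv> \<lambda>x. x \<bullet> (v *v x)"
  shows "integrable lebesgue (\<lambda>x. G (x \<bullet> x) * (x \<bullet> x - 3 * S x))"
    and "(\<integral>x. G (x \<bullet> x) * (x \<bullet> x - 3 * S x) \<partial>lebesgue) = 0"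
    and "integrable lebesgue (\<lambda>x. G (x \<bullet> x) * (2 * (x \<bullet> x) * S x - 5 * (P x)\<^sup>2))"
    and "(\<integral>x. G (x \<bullet> x) * (2 * (x \<bullet> x) * S x - 5 * (P x)\<^sup>2) \<partial>lebesgue) = 0"
proof -
  note sym = inner_matrix_vector_symmetric[OF v(1)]
  have bl: "bounded_linear ((*v) v)" by (rule matrix_vector_mul_bounded_linear)
  have dv: "((*v) v has_derivative (*v) v) (at x)" for x
    by (rule bounded_linear_imp_has_derivative[OF bl])
  have Cv: "C_k_on 1 UNIV ((*v) v)" by (rule C_k_on_linear[OF open_UNIV bl])
  note Ci = C_k_on_ident[OF open_UNIV, of 1]
  have dr: "((\<lambda>x. x \<bullet> x) has_derivative (\<lambda>h. 2 * (x \<bullet> h))) (at x)" for x :: "real^3"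
    by (rule has_derivative_eq_rhs[OF has_derivative_inner[OF has_derivative_ident has_derivative_ident]])
      (simp add: inner_commute fun_eq_iff)
  have dS: "(S has_derivative (\<lambda>h. 2 * ((v *v (v *v x)) \<bullet> h))) (at x)" for x
    unfolding S_def
  proof (rule has_derivative_eq_rhs[OF has_derivative_inner[OF dv dv]], rule ext)
    show "(v *v x) \<bullet> (v *v h) + (v *v h) \<bullet> (v *v x) = 2 * ((v *v (v *v x)) \<bullet> h)" for h
      using sym[of "v *v x" h] inner_commute[of "v *v h" "v *v x"] by linarith
  qed
  have dP: "(P has_derivative (\<lambda>h. 2 * ((v *v x) \<bullet> h))) (at x)" for x
    unfolding P_def
  proof (rule has_derivative_eq_rhs[OF has_derivative_inner[OF has_derivative_ident dv]], rule ext)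
    show "x \<bullet> (v *v h) + h \<bullet> (v *v x) = 2 * ((v *v x) \<bullet> h)" for h
      using sym[of x h] inner_commute[of h "v *v x"] by linarith
  qed
  \<comment> \<open>Up to powers of \<open>|x|\<close>, these are the tangential gradients of \<open>|v n|\<^sup>2\<close> and of \<open>(n \<bullet> v n)\<^sup>2\<close>.\<close>
  define Y1 where "Y1 x = (x \<bullet> x) *\<^sub>R (v *v (v *v x)) - S x *\<^sub>R x" for x
  define Y1' where "Y1' x h = ((x \<bullet> x) *\<^sub>R (v *v (v *v h)) + (2 * (x \<bullet> h)) *\<^sub>R (v *v (v *v x)))
      - (S x *\<^sub>R h + (2 * ((v *v (v *v x)) \<bullet> h)) *\<^sub>R x)" for x h
  define Y2 where "Y2 x = P x *\<^sub>R ((x \<bullet> x) *\<^sub>R (v *v x) - P x *\<^sub>R x)" for x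
  define Y2' where "Y2' x h = P x *\<^sub>R (((x \<bullet> x) *\<^sub>R (v *v h) + (2 * (x \<bullet> h)) *\<^sub>R (v *v x))
        - (P x *\<^sub>R h + (2 * ((v *v x) \<bullet> h)) *\<^sub>R x))
      + (2 * ((v *v x) \<bullet> h)) *\<^sub>R ((x \<bullet> x) *\<^sub>R (v *v x) - P x *\<^sub>R x)" for x h
  have C1: "C_k_on 1 UNIV Y1"
    unfolding Y1_def[abs_def] S_def
    by (intro C_k_on_diff C_k_on_scaleR C_k_on_inner Ci C_k_on_bounded_linear[OF open_UNIV bl Cv] Cv open_UNIV)
  have C2: "C_k_on 1 UNIV Y2"
    unfolding Y2_def[abs_def] P_def
    by (intro C_k_on_diff C_k_on_scaleR C_k_on_inner Ci Cv open_UNIV)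
  have D1: "(Y1 has_derivative Y1' x) (at x)" for x
    unfolding Y1_def[abs_def] Y1'_def[abs_def]
    by (intro has_derivative_diff has_derivative_scaleR dr dS has_derivative_ident
        bounded_linear.has_derivative[OF bl] dv)
  have D2: "(Y2 has_derivative Y2' x) (at x)" for x
    unfolding Y2_def[abs_def] Y2'_def[abs_def]
    by (intro has_derivative_diff has_derivative_scaleR dr dP has_derivative_ident dv)
  have xz: "x \<bullet> (v *v (v *v x)) = S x" for x unfolding S_def sym ..
  have xy: "x \<bullet> (v *v x) = P x" and yy: "(v *v x) \<bullet> (v *v x) = S x" for x
    by (simp_all add: P_def S_def)
  have T1: "x \<bullet> Y1 x = 0" for x
    by (simp add: Y1_def inner_diff_right xz)
  have T2: "x \<bullet> Y2 x = 0" for x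
    by (simp add: Y2_def inner_diff_right P_def mult.commute)
  have div1: "(\<Sum>i\<in>UNIV. Y1' x (axis i 1) $ i) = x \<bullet> x - 3 * S x" for x
  proof -
    have "(\<Sum>i\<in>UNIV. Y1' x (axis i 1) $ i) = (x \<bullet> x) * (\<Sum>i\<in>UNIV. ((v ** v) *v axis i 1) $ i)
        + 2 * (\<Sum>i\<in>UNIV. (x \<bullet> axis i 1) * (v *v (v *v x)) $ i) - S x * (\<Sum>i\<in>UNIV. (axis i 1 :: real^3) $ i)
        - 2 * (\<Sum>i\<in>UNIV. ((v *v (v *v x)) \<bullet> axis i 1) * x $ i)"
      unfolding Y1'_def by (simp add: sum.distrib sum_subtractf sum_distrib_left matrix_vector_mul_assoc mult.assoc)
    also have "\<dots> = (x \<bullet> x) * 1 + 2 * S x - S x * 3 - 2 * S x"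
      unfolding sum_matrix_axis sum_inner_axis_mult v(3) xz inner_commute[of "v *v (v *v x)" x]
      by (simp add: axis_nth)
    finally show ?thesis by simp
  qed
  have div2: "(\<Sum>i\<in>UNIV. Y2' x (axis i 1) $ i) = 2 * (x \<bullet> x) * S x - 5 * (P x)\<^sup>2" for x
  proof -
    have "(\<Sum>i\<in>UNIV. Y2' x (axis i 1) $ i) = P x * ((x \<bullet> x) * (\<Sum>i\<in>UNIV. (v *v axis i 1) $ i)
        + 2 * (\<Sum>i\<in>UNIV. (x \<bullet> axis i 1) * (v *v x) $ i) - P x * (\<Sum>i\<in>UNIV. (axis i 1 :: real^3) $ i)
        - 2 * (\<Sum>i\<in>UNIV. ((v *v x) \<bullet> axis i 1) * x $ i))
        + 2 * (\<Sum>i\<in>UNIV. ((v *v x) \<bullet> axis i 1) * ((x \<bullet> x) *\<^sub>R (v *v x) - P x *\<^sub>R x) $ i)"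
      unfolding Y2'_def by (simp add: sum.distrib sum_subtractf sum_distrib_left mult.assoc algebra_simps)
    also have "\<dots> = P x * (2 * P x - P x * 3 - 2 * P x) + 2 * ((x \<bullet> x) * S x - P x * P x)"
      unfolding sum_matrix_axis sum_inner_axis_mult v(2) inner_diff_right inner_scaleR_right
      by (simp add: axis_nth inner_commute[of "v *v x" x] xy yy)
    finally show ?thesis by (simp add: power2_eq_square algebra_simps)
  qed
  show "integrable lebesgue (\<lambda>x. G (x \<bullet> x) * (x \<bullet> x - 3 * S x))"
    "(\<integral>x. G (x \<bullet> x) * (x \<bullet> x - 3 * S x) \<partial>lebesgue) = 0"
    using integral_radial_times_divergence[OF G C1 D1 T1] unfolding div1 by simp_all
  show "integrable lebesgue (\<lambda>x. G (x \<bullet> x) * (2 * (x \<bullet> x) * S x - 5 * (P x)\<^sup>2))"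
    "(\<integral>x. G (x \<bullet> x) * (2 * (x \<bullet> x) * S x - 5 * (P x)\<^sup>2) \<partial>lebesgue) = 0"
    using integral_radial_times_divergence[OF G C2 D2 T2] unfolding div2 by simp_all
qed

section \<open>The second variation along radial multiples of a constant matrix\<close>

lemma inner_hedgehog_constant:
  assumes "v \<in> S0"
  shows "hedgehog x \<bullet> v = sqrt (3 / 2) * ((x \<bullet> (v *v x)) / (x \<bullet> x))"
  using assms by (simp add: hedgehog_eq inner_diff_left inner_tensor_matrix inner_mat_1 S0_def)

lemma inner_dH_constant:
  assumes "v \<in> S0"
  shows "dH x h \<bullet> v = sqrt (3 / 2) * (2 * ((v *v x) \<bullet> h) / (x \<bullet> x) - 2 * (x \<bullet> h) * (x \<bullet> (v *v x)) / (x \<bullet> x)\<^sup>2)"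
proof -
  have "transpose v = v" using assms by (simp add: S0_def)
  from inner_matrix_vector_symmetric[OF this, of x h] have "x \<bullet> (v *v h) = (v *v x) \<bullet> h" "h \<bullet> (v *v x) = (v *v x) \<bullet> h"
    by (simp_all add: inner_commute)
  then show ?thesis
    by (simp add: dH_def inner_diff_left inner_add_left inner_tensor_matrix)
qed

lemma trace_mult_eq_inner_transpose: "trace (A ** B) = A \<bullet> transpose B" for A B :: "real^'n^'n"
  by (simp add: trace_def matrix_matrix_mult_def inner_vec_def transpose_def)

lemma trace_hedgehog_mult_square:
  assumes "v \<in> S0" "norm v = 1"
  shows "trace (hedgehog x ** v ** v) = sqrt (3 / 2) * ((v *v x) \<bullet> (v *v x) / (x \<bullet> x) - 1 / 3)"
proof -
  have sym: "transpose v = v" using assms by (simp add: S0_def)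
  have vv: "trace (v ** v) = 1" using norm_S0[OF assms(1)] assms(2) by simp
  have "transpose (v ** v) = v ** v" by (simp add: matrix_transpose_mul sym)
  then have "trace (hedgehog x ** (v ** v)) = hedgehog x \<bullet> (v ** v)"
    by (simp only: trace_mult_eq_inner_transpose)
  also have "\<dots> = sqrt (3 / 2) * ((v *v x) \<bullet> (v *v x) / (x \<bullet> x) - 1 / 3)"
    by (simp add: hedgehog_eq inner_diff_left inner_tensor_matrix inner_mat_1 vv matrix_vector_mul_assoc[symmetric]
        inner_matrix_vector_symmetric[OF sym])
  finally show ?thesis by (simp add: matrix_mul_assoc)
qed

text \<open>
  The last line is the contribution of the potential. From the other terms the two brackets that average to zero over
  spheres have been split off, which leaves \<open>4/5 (|\<nabla>\<xi>|\<^sup>2 - 3 \<xi>\<^sup>2 / |x|\<^sup>2)\<close> for \<open>\<xi>(x) = \<phi>(|x|\<^sup>2)\<close>.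
\<close>

lemma edensity_d2_radial:
  fixes v :: "real^3^3" and \<phi> :: "real \<Rightarrow> real"
  assumes v: "v \<in> S0" "norm v = 1" and x: "x \<noteq> 0" and d: "(\<phi> has_real_derivative p') (at (x \<bullet> x))"
  defines "S \<equiv> (v *v x) \<bullet> (v *v x)" and "P \<equiv> x \<bullet> (v *v x)" and "\<rho> \<equiv> x \<bullet> x" and "p \<equiv> \<phi> (x \<bullet> x)"
  shows "edensity_d2 lam (hedgehog x) (grad hedgehog x) (\<phi> (x \<bullet> x) *\<^sub>R v) (grad (\<lambda>x. \<phi> (x \<bullet> x) *\<^sub>R v) x)
    = 16 / 5 * \<rho> * p'\<^sup>2 - 12 / 5 * p\<^sup>2 / \<rho>
      + (4 / 5 * p'\<^sup>2 - 18 / 5 * p\<^sup>2 / \<rho>\<^sup>2) * (\<rho> - 3 * S)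
      + (6 / 5 * p'\<^sup>2 / \<rho> - 42 / 5 * p\<^sup>2 / \<rho> ^ 3) * (2 * \<rho> * S - 5 * P\<^sup>2)
      - lam * p\<^sup>2 * (2 * trace (hedgehog x ** v ** v) - (hedgehog x \<bullet> v)\<^sup>2 / sqrt 6 - 1 / sqrt 6)"
proof -
  have \<rho>: "\<rho> > 0" using x by (simp add: \<rho>_def)
  have sym: "transpose v = v" using v by (simp add: S0_def)
  define B where "B = hedgehog x \<bullet> v"
  define Bi where "Bi i = dH x (axis i 1) \<bullet> v" for i
  have B2: "B\<^sup>2 = 3 / 2 * P\<^sup>2 / \<rho>\<^sup>2"
    unfolding B_def inner_hedgehog_constant[OF v(1)] by (simp add: power_mult_distrib power_divide P_def \<rho>_def)
  have dr: "((\<lambda>x. x \<bullet> x) has_derivative (\<lambda>h. 2 * (x \<bullet> h))) (at x)"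
    by (rule has_derivative_eq_rhs[OF has_derivative_inner[OF has_derivative_ident has_derivative_ident]])
      (simp add: inner_commute fun_eq_iff)
  have "((\<lambda>x. \<phi> (x \<bullet> x) *\<^sub>R v) has_derivative (\<lambda>h. (p' * (2 * (x \<bullet> h))) *\<^sub>R v)) (at x)"
    by (intro has_derivative_scaleR_left has_derivative_compose[OF dr d[unfolded has_field_derivative_def]])
  then have g: "grad (\<lambda>x. \<phi> (x \<bullet> x) *\<^sub>R v) x $ i = (2 * p' * x $ i) *\<^sub>R v" for i
    using grad_eqI[of _ _ x i] by (fastforce simp: inner_axis mult.left_commute)
  have Bi: "Bi i = sqrt (3 / 2) * (2 / \<rho> * (v *v x) $ i - 2 * P / \<rho>\<^sup>2 * x $ i)" for i
    unfolding Bi_def inner_dH_constant[OF v(1)] by (simp add: inner_axis P_def \<rho>_def)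
  have sums: "(\<Sum>i\<in>UNIV. (x $ i)\<^sup>2) = \<rho>" "(\<Sum>i\<in>UNIV. ((v *v x) $ i)\<^sup>2) = S" "(\<Sum>i\<in>UNIV. x $ i * (v *v x) $ i) = P"
    by (simp_all add: \<rho>_def S_def P_def inner_vec_def power2_eq_square)
  have xB: "(\<Sum>i\<in>UNIV. x $ i * Bi i) = 0"
  proof -
    have "(\<Sum>i\<in>UNIV. x $ i * Bi i) = (\<Sum>i\<in>UNIV. sqrt (3 / 2) * (2 / \<rho>) * (x $ i * (v *v x) $ i) - sqrt (3 / 2) * (2 * P / \<rho>\<^sup>2) * (x $ i)\<^sup>2)"
      by (intro sum.cong) (simp_all add: Bi power2_eq_square algebra_simps)
    also have "\<dots> = sqrt (3 / 2) * (2 / \<rho>) * P - sqrt (3 / 2) * (2 * P / \<rho>\<^sup>2) * \<rho>"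
      unfolding sum_subtractf sum_distrib_left[symmetric] sums ..
    also have "\<dots> = 0" using \<rho> by (simp add: power2_eq_square field_simps)
    finally show ?thesis .
  qed
  have BB: "(\<Sum>i\<in>UNIV. (Bi i)\<^sup>2) = 6 * S / \<rho>\<^sup>2 - 6 * P\<^sup>2 / \<rho> ^ 3"
  proof -
    have "(Bi i)\<^sup>2 = 6 / \<rho>\<^sup>2 * ((v *v x) $ i)\<^sup>2 - 12 * P / \<rho> ^ 3 * (x $ i * (v *v x) $ i) + 6 * P\<^sup>2 / \<rho> ^ 4 * (x $ i)\<^sup>2" for i
      unfolding Bi power_mult_distrib using \<rho>
      by (simp add: power2_diff power_divide power_mult_distrib) (simp add: field_simps power2_eq_square power3_eq_cube power4_eq_xxxx)
    then have "(\<Sum>i\<in>UNIV. (Bi i)\<^sup>2) = 6 / \<rho>\<^sup>2 * S - 12 * P / \<rho> ^ 3 * P + 6 * P\<^sup>2 / \<rho> ^ 4 * \<rho>"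
      by (simp only: sum_subtractf sum.distrib sum_distrib_left[symmetric] sums)
    also have "\<dots> = 6 * S / \<rho>\<^sup>2 - 6 * P\<^sup>2 / \<rho> ^ 3"
      using \<rho> by (simp add: field_simps power2_eq_square power3_eq_cube power4_eq_xxxx)
    finally show ?thesis .
  qed
  have HH: "(\<Sum>i\<in>UNIV. (norm (grad hedgehog x $ i))\<^sup>2) = 6 / \<rho>"
    unfolding norm_vec_power2[symmetric] norm_grad_hedgehog[OF x] \<rho>_def ..
  have b: "hedgehog x \<bullet> (p *\<^sub>R v) = p * B" by (simp add: B_def)
  have S0: "p *\<^sub>R v \<in> S0" using v(1) by (simp add: S0_def transpose_scalar trace_def sum_distrib_left[symmetric])
  have tr: "trace (hedgehog x ** (p *\<^sub>R v) ** (p *\<^sub>R v)) = p\<^sup>2 * trace (hedgehog x ** v ** v)"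
    by (simp add: scalar_matrix_assoc[symmetric] matrix_scalar_ac power2_eq_square trace_def sum_distrib_left mult.assoc)
  let ?l = "\<lambda>i. (norm ((2 * p' * x $ i) *\<^sub>R v))\<^sup>2 - 4 * (p * B) * (grad hedgehog x $ i \<bullet> ((2 * p' * x $ i) *\<^sub>R v))
       + (4 * (p * B)\<^sup>2 - (norm (p *\<^sub>R v))\<^sup>2) * (norm (grad hedgehog x $ i))\<^sup>2
       - (hedgehog x \<bullet> ((2 * p' * x $ i) *\<^sub>R v) + (p *\<^sub>R v) \<bullet> grad hedgehog x $ i)\<^sup>2"
  let ?r = "\<lambda>i. 4 * p'\<^sup>2 * (1 - B\<^sup>2) * (x $ i)\<^sup>2 - 12 * p * p' * B * (x $ i * Bi i)
       + (4 * (p * B)\<^sup>2 - p\<^sup>2) * (norm (grad hedgehog x $ i))\<^sup>2 - p\<^sup>2 * (Bi i)\<^sup>2"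
  let ?main = "16 / 5 * \<rho> * p'\<^sup>2 - 12 / 5 * p\<^sup>2 / \<rho>
      + (4 / 5 * p'\<^sup>2 - 18 / 5 * p\<^sup>2 / \<rho>\<^sup>2) * (\<rho> - 3 * S)
      + (6 / 5 * p'\<^sup>2 / \<rho> - 42 / 5 * p\<^sup>2 / \<rho> ^ 3) * (2 * \<rho> * S - 5 * P\<^sup>2)"
  have "(\<Sum>i\<in>UNIV. ?l i)
    = (\<Sum>i\<in>UNIV. ?r i)"
  proof (intro sum.cong refl)
    fix i :: 3
    have g: "grad hedgehog x $ i \<bullet> v = Bi i" "v \<bullet> grad hedgehog x $ i = Bi i"
      by (simp_all add: Bi_def grad_hedgehog[OF x] inner_commute)
    show "?l i
      = ?r i"
      unfolding norm_scaleR v(2) inner_scaleR_left inner_scaleR_right g B_def[symmetric]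
      by (simp add: power_mult_distrib) (simp add: power2_eq_square algebra_simps)
  qed
  also have "\<dots> = 4 * p'\<^sup>2 * (1 - B\<^sup>2) * \<rho> + (4 * (p * B)\<^sup>2 - p\<^sup>2) * (6 / \<rho>) - p\<^sup>2 * (6 * S / \<rho>\<^sup>2 - 6 * P\<^sup>2 / \<rho> ^ 3)"
    unfolding sum_subtractf sum.distrib sum_distrib_left[symmetric] sums xB BB HH by simp
  also have "\<dots> = ?main"
  proof -
    \<comment> \<open>With \<open>w\<close> for the reciprocal of \<open>\<rho>\<close> this is a polynomial identity modulo \<open>\<rho> w = 1\<close>.\<close>
    obtain w where w: "\<rho> * w = 1" "\<And>a. a / \<rho> = a * w"
      using \<rho> by (intro that[of "1 / \<rho>"]) auto
    have w': "a / \<rho>\<^sup>2 = a * w\<^sup>2" "a / \<rho> ^ 3 = a * w ^ 3" for a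
      by (simp_all add: power2_eq_square power3_eq_cube divide_divide_eq_left[symmetric] w(2) del: divide_divide_eq_left)
    show ?thesis
      unfolding power_mult_distrib B2 w(2) w' using w(1) by algebra
  qed
  finally have main: "(\<Sum>i\<in>UNIV. ?l i) = ?main" .
  have pot: "2 * (p\<^sup>2 * trace (hedgehog x ** v ** v)) - 6 * (p * B) * (p * B / sqrt 6) + (5 * (p * B)\<^sup>2 - (norm (p *\<^sub>R v))\<^sup>2) * (1 / sqrt 6)
      = p\<^sup>2 * (2 * trace (hedgehog x ** v ** v) - B\<^sup>2 / sqrt 6 - 1 / sqrt 6)"
    unfolding norm_scaleR v(2) by (simp add: power_mult_distrib power2_eq_square algebra_simps diff_divide_distrib add_divide_distrib)
  show ?thesis
    unfolding edensity_d2_def g p_def[symmetric] b main tr trace_hedgehog_square_mult[OF x S0] trace_hedgehog_cube[OF x] pot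
    by (simp add: B_def)
qed

section \<open>A radial profile that beats the Hardy inequality\<close>

text \<open>
  In terms of \<open>s = |x|\<^sup>2\<close> the profile is \<open>|x|\<^sup>-\<^sup>1\<^sup>/\<^sup>2\<close>, the borderline power in the Hardy inequality
  \<open>\<integral> |\<nabla>\<xi>|\<^sup>2 \<ge> 1/4 \<integral> \<xi>\<^sup>2 / |x|\<^sup>2\<close>, cut off near the radii \<open>sqrt e\<close> and \<open>sqrt D\<close>.
\<close>

definition cutoff :: "real \<Rightarrow> real \<Rightarrow> real \<Rightarrow> real" where
  "cutoff e D s = smooth_step (s / e) * (1 - smooth_step (s / D))"

definition profile :: "real \<Rightarrow> real \<Rightarrow> real \<Rightarrow> real" where
  "profile e D s = s powr (- 1 / 4) * cutoff e D s"

definition profile' :: "real \<Rightarrow> real \<Rightarrow> real \<Rightarrow> real" where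
  "profile' e D s = frechet_derivative (profile e D) (at s) 1"

lemma cutoff_eq_1:
  assumes "0 < e" "0 < D" "2 * e \<le> s" "s \<le> D"
  shows "cutoff e D s = 1"
  using assms by (simp add: cutoff_def smooth_step_simps(1,2) field_simps)

lemma cutoff_eq_0:
  assumes "0 < e" "0 < D" "s \<notin> {e..2 * D}"
  shows "cutoff e D s = 0"
proof (cases "s < e")
  case True
  then have "s / e \<le> 1" using assms by simp
  then show ?thesis by (simp add: cutoff_def smooth_step_simps)
next
  case False
  then have "s / D \<ge> 2" using assms by (simp add: field_simps)
  then show ?thesis by (simp add: cutoff_def smooth_step_simps)
qed

lemma profile_eq_0: "0 < e \<Longrightarrow> 0 < D \<Longrightarrow> s \<notin> {e..2 * D} \<Longrightarrow> profile e D s = 0"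
  by (simp add: profile_def cutoff_eq_0)

lemma profile'_eq_0:
  assumes "0 < e" "0 < D" "s \<notin> {e..2 * D}"
  shows "profile' e D s = 0"
  unfolding profile'_def
  by (rule frechet_derivative_zero_on_open(2)[of "- {e..2 * D}"]) (use assms profile_eq_0 in auto)

lemma C_k_profile:
  assumes "0 < e" "0 < D"
  shows "C_k k (profile e D)"
proof (rule C_k_extend_by_zero[where U = "{0<..}" and K = "{e..2 * D}"])
  have "C_k_on k {0<..} (\<lambda>s. s powr (- 1 / 4) * (smooth_step (s * (1 / e)) * (1 - smooth_step (s * (1 / D)))))"
    by (intro C_k_on_mult C_k_on_powr C_k_on_diff C_k_on_const C_k_on_ident
        C_k_on_compose[OF _ C_k_smooth_step] open_greaterThan) auto
  then show "C_k_on k {0<..} (profile e D)"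
    by (simp add: profile_def[abs_def] cutoff_def)
qed (use assms profile_eq_0 in auto)

lemma C_k_profile':
  assumes "0 < e" "0 < D"
  shows "C_k k (profile' e D)"
  using C_k_profile[OF assms, of "Suc k"] by (simp add: profile'_def[abs_def])

lemma profile_has_derivative:
  assumes "0 < e" "0 < D"
  shows "(profile e D has_real_derivative profile' e D s) (at s)"
proof -
  have *: "(profile e D has_derivative frechet_derivative (profile e D) (at s)) (at s)"
    using C_k_profile[OF assms, of 1] by (simp add: frechet_derivative_works[symmetric])
  have "frechet_derivative (profile e D) (at s) h = profile' e D s * h" for h
    using linear_scale[OF has_derivative_linear[OF *], of h 1] by (simp add: profile'_def)
  then have "frechet_derivative (profile e D) (at s) = (*) (profile' e D s)" by (rule ext)
  with * show ?thesis unfolding has_field_derivative_def by argo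
qed

lemma C_k_profile_weight:
  assumes "0 < e" "0 < D"
  shows "C_k 1 (\<lambda>s. a * (profile' e D s)\<^sup>2 * s powr b + c * (profile e D s)\<^sup>2 * s powr d)"
proof (rule C_k_extend_by_zero[where U = "{0<..}" and K = "{e..2 * D}"])
  have 1: "C_k_on 1 {0<..} (profile e D)" "C_k_on 1 {0<..} (profile' e D)"
    by (rule C_k_on_subset[OF _ subset_UNIV], unfold C_k_on_UNIV, rule C_k_profile[OF assms] C_k_profile'[OF assms])+
  show "C_k_on 1 {0<..} (\<lambda>s. a * (profile' e D s)\<^sup>2 * s powr b + c * (profile e D s)\<^sup>2 * s powr d)"
    unfolding power2_eq_square
    by (intro C_k_on_add C_k_on_mult 1 C_k_on_powr C_k_on_const C_k_on_ident open_greaterThan) auto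
qed (use assms profile_eq_0 profile'_eq_0 in auto)

text \<open>
  The first two summands bound the cost of the cutoffs, which arises for \<open>s \<le> 2 e\<close> and for \<open>s \<le> 2 D\<close>; the last one is the
  gain \<open>|x|\<^sup>-\<^sup>3\<close> on the region where the cutoff equals 1. Here \<open>C\<close> bounds the derivative of the step function.
\<close>

definition shell_bound :: "real \<Rightarrow> real \<Rightarrow> real \<Rightarrow> real \<Rightarrow> real" where
  "shell_bound C e D s = 64 / 5 * C\<^sup>2 * ((if s \<le> 2 * e then sqrt (2 * e) / e\<^sup>2 else 0) + (if s \<le> 2 * D then sqrt (2 * D) / D\<^sup>2 else 0))
      - (if 2 * e \<le> s \<and> s \<le> D then 1 / (s * sqrt s) else 0)"

text \<open>
  The inequality \<open>|\<nabla>(|x|\<^sup>-\<^sup>1\<^sup>/\<^sup>2 \<eta>)|\<^sup>2 \<le> 2 |x|\<^sup>-\<^sup>1 |\<nabla>\<eta>|\<^sup>2 + 1/2 |x|\<^sup>-\<^sup>3 \<eta>\<^sup>2\<close> for the cutoff \<open>\<eta>\<close> doubles the Hardy constant \<open>1/4\<close>, which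
  is affordable because \<open>1/2\<close> is still well below 3. Half of the gain that is left pays for the potential.
\<close>

lemma profile_bound:
  assumes e: "0 < e" "2 * e \<le> D" and lam: "0 \<le> lam" "4 * lam * D \<le> 1" and s: "0 < s"
    and C: "\<And>t. \<bar>smooth_step' t\<bar> \<le> C"
  shows "16 / 5 * s * (profile' e D s)\<^sup>2 - 12 / 5 * (profile e D s)\<^sup>2 / s + 2 * lam * (profile e D s)\<^sup>2
    \<le> shell_bound C e D s"
proof -
  have D: "0 < D" using e by simp
  have C0: "C \<ge> 0" using C[of 0] by (rule order_trans[OF abs_ge_zero])
  define a where "a = s powr (- 1 / 4)"
  define h where "h = cutoff e D s"
  define h' where "h' = smooth_step' (s / e) / e * (1 - smooth_step (s / D)) - smooth_step (s / e) * (smooth_step' (s / D) / D)"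
  have a2: "a\<^sup>2 = 1 / sqrt s"
  proof -
    have "a\<^sup>2 = s powr (- 1 / 2)" unfolding a_def power2_eq_square powr_add[symmetric] by simp
    then show ?thesis using s by (simp add: powr_minus_divide powr_half_sqrt)
  qed
  have ss: "sqrt s > 0" "s = sqrt s * sqrt s" using s by simp_all
  have dh: "(cutoff e D has_real_derivative h') (at s)"
  proof -
    have d: "((\<lambda>s. smooth_step (s / E)) has_real_derivative smooth_step' (s / E) / E) (at s)" for E
      using DERIV_chain2[OF smooth_step_has_derivative DERIV_cdivide[OF DERIV_ident]] by simp
    have "((\<lambda>s. smooth_step (s / e) * (1 - smooth_step (s / D))) has_real_derivative
        smooth_step' (s / e) / e * (1 - smooth_step (s / D)) + (0 - smooth_step' (s / D) / D) * smooth_step (s / e)) (at s)"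
      by (intro DERIV_mult DERIV_diff DERIV_const d)
    then show ?thesis unfolding cutoff_def[abs_def] h'_def by (simp add: mult.commute)
  qed
  have da: "((\<lambda>s. s powr (- 1 / 4)) has_real_derivative - (1 / 4) * (a / s)) (at s)"
  proof -
    have "s powr (- 1 / 4 - 1) = a / s" using s by (simp only: powr_diff a_def) simp
    then show ?thesis using has_real_derivative_powr[OF s, of "- 1 / 4"] by simp
  qed
  have "(profile e D has_real_derivative - (1 / 4) * (a / s) * h + h' * a) (at s)"
    using DERIV_mult[OF da dh] unfolding profile_def[abs_def] h_def a_def .
  then have p': "profile' e D s = a * h' - 1 / 4 * (a / s) * h"
    using DERIV_unique[OF profile_has_derivative[OF e(1) D]] by (simp add: mult.commute)
  have p: "profile e D s = a * h" by (simp add: profile_def a_def h_def)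
  have sq2: "(u - w)\<^sup>2 \<le> 2 * u\<^sup>2 + 2 * w\<^sup>2" "(u + w)\<^sup>2 \<le> 2 * u\<^sup>2 + 2 * w\<^sup>2" for u w :: real
    using sum_squares_ge_zero[of "u + w" 0] sum_squares_ge_zero[of "u - w" 0]
    by (simp_all add: power2_eq_square algebra_simps)
  \<comment> \<open>\<open>k\<close> is \<open>\<xi>\<^sup>2 / |x|\<^sup>2\<close>, the integrand of the Hardy term.\<close>
  define k where "k = h\<^sup>2 / (s * sqrt s)"
  have k: "k \<ge> 0" using s by (simp add: k_def)
  have 1: "16 / 5 * s * (profile' e D s)\<^sup>2 \<le> 32 / 5 * (sqrt s * h'\<^sup>2) + 2 / 5 * k"
  proof -
    have "(profile' e D s)\<^sup>2 \<le> 2 * (a * h')\<^sup>2 + 2 * (1 / 4 * (a / s) * h)\<^sup>2" unfolding p' by (rule sq2)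
    also have "\<dots> = 2 * (h'\<^sup>2 / sqrt s) + 1 / 8 * (h\<^sup>2 / (s\<^sup>2 * sqrt s))"
      by (simp add: power_mult_distrib power_divide a2)
    finally have "16 / 5 * s * (profile' e D s)\<^sup>2 \<le> 16 / 5 * s * (2 * (h'\<^sup>2 / sqrt s) + 1 / 8 * (h\<^sup>2 / (s\<^sup>2 * sqrt s)))"
      using s by (intro mult_left_mono) auto
    also have "\<dots> = 32 / 5 * (s * (h'\<^sup>2 / sqrt s)) + 2 / 5 * (s * (h\<^sup>2 / (s\<^sup>2 * sqrt s)))"
      by (simp add: algebra_simps)
    also have "s * (h'\<^sup>2 / sqrt s) = sqrt s * h'\<^sup>2" using s by (simp add: field_simps)
    also have "s * (h\<^sup>2 / (s\<^sup>2 * sqrt s)) = k" using s by (simp add: k_def power2_eq_square)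
    finally show ?thesis .
  qed
  have 2: "(profile e D s)\<^sup>2 / s = k" by (simp add: p power_mult_distrib a2 k_def mult.commute)
  have 3: "2 * lam * (profile e D s)\<^sup>2 \<le> k"
  proof (cases "s \<le> 2 * D")
    case True
    have "2 * lam * s \<le> 2 * lam * (2 * D)" using True lam by (intro mult_left_mono) auto
    also have "\<dots> = 4 * lam * D" by simp
    also have "\<dots> \<le> 1" by (rule lam(2))
    finally have "2 * lam * s \<le> 1" .
    have "2 * lam * (profile e D s)\<^sup>2 = (2 * lam * s) * ((profile e D s)\<^sup>2 / s)" using s by simp
    also have "\<dots> = (2 * lam * s) * k" unfolding 2 ..
    also have "\<dots> \<le> 1 * k" by (rule mult_right_mono) fact+
    finally show ?thesis by simp
  next
    case False
    then have "profile e D s = 0" by (intro profile_eq_0 e D) simp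
    then show ?thesis using k by simp
  qed
  define u where "u = (if s \<le> 2 * e then C / e else 0)"
  define w where "w = (if s \<le> 2 * D then C / D else 0)"
  have b: "\<bar>smooth_step' (s / E) / E\<bar> \<le> (if s \<le> 2 * E then C / E else 0)" if "E > 0" for E
  proof (cases "s \<le> 2 * E")
    case True
    then show ?thesis using C[of "s / E"] that by (simp add: abs_divide divide_right_mono)
  next
    case False
    then have "s / E > 2" using that by (simp add: field_simps)
    then show ?thesis using False by (simp add: smooth_step'_eq_0)
  qed
  have "\<bar>h'\<bar> \<le> u + w"
  proof -
    have "\<bar>smooth_step' (s / e) / e * (1 - smooth_step (s / D))\<bar> \<le> u * 1"
      unfolding abs_mult u_def using b[OF e(1)] smooth_step_simps(3,4)[of "s / D"] C0 e by (intro mult_mono) auto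
    moreover have "\<bar>smooth_step (s / e) * (smooth_step' (s / D) / D)\<bar> \<le> 1 * w"
      unfolding abs_mult w_def using b[OF D] smooth_step_simps(3,4)[of "s / e"] C0 D by (intro mult_mono) auto
    ultimately show ?thesis unfolding h'_def by linarith
  qed
  then have "h'\<^sup>2 \<le> (u + w)\<^sup>2" by (metis abs_ge_zero power2_abs power_mono)
  also have "\<dots> \<le> 2 * u\<^sup>2 + 2 * w\<^sup>2" by (rule sq2)
  finally have "sqrt s * h'\<^sup>2 \<le> sqrt s * (2 * u\<^sup>2 + 2 * w\<^sup>2)" using ss by (intro mult_left_mono) auto
  also have "\<dots> = 2 * (sqrt s * u\<^sup>2) + 2 * (sqrt s * w\<^sup>2)" by (simp add: algebra_simps)
  also have "\<dots> \<le> 2 * (C\<^sup>2 * (if s \<le> 2 * e then sqrt (2 * e) / e\<^sup>2 else 0)) + 2 * (C\<^sup>2 * (if s \<le> 2 * D then sqrt (2 * D) / D\<^sup>2 else 0))"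
  proof -
    have "sqrt s * (if s \<le> 2 * E then C / E else 0)\<^sup>2 \<le> C\<^sup>2 * (if s \<le> 2 * E then sqrt (2 * E) / E\<^sup>2 else 0)" for E
    proof (cases "s \<le> 2 * E")
      case True
      then have "sqrt s * (C / E)\<^sup>2 \<le> sqrt (2 * E) * (C / E)\<^sup>2" by (intro mult_right_mono) auto
      then show ?thesis using True by (simp add: power_divide mult.commute)
    qed simp
    then show ?thesis unfolding u_def w_def by (intro add_mono mult_left_mono) auto
  qed
  finally have 4: "sqrt s * h'\<^sup>2 \<le> 2 * (C\<^sup>2 * (if s \<le> 2 * e then sqrt (2 * e) / e\<^sup>2 else 0))
      + 2 * (C\<^sup>2 * (if s \<le> 2 * D then sqrt (2 * D) / D\<^sup>2 else 0))" .
  have 5: "(if 2 * e \<le> s \<and> s \<le> D then 1 / (s * sqrt s) else 0) \<le> k"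
    using k cutoff_eq_1[OF e(1) D, of s] by (auto simp: k_def h_def)
  have "16 / 5 * s * (profile' e D s)\<^sup>2 - 12 / 5 * (profile e D s)\<^sup>2 / s + 2 * lam * (profile e D s)\<^sup>2
      = 16 / 5 * s * (profile' e D s)\<^sup>2 - 12 / 5 * ((profile e D s)\<^sup>2 / s) + 2 * lam * (profile e D s)\<^sup>2" by simp
  also have "\<dots> \<le> 32 / 5 * (sqrt s * h'\<^sup>2) - k" using 1 3 unfolding 2 by linarith
  also have "\<dots> \<le> 32 / 5 * (2 * (C\<^sup>2 * (if s \<le> 2 * e then sqrt (2 * e) / e\<^sup>2 else 0))
      + 2 * (C\<^sup>2 * (if s \<le> 2 * D then sqrt (2 * D) / D\<^sup>2 else 0))) - (if 2 * e \<le> s \<and> s \<le> D then 1 / (s * sqrt s) else 0)"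
    using 4 5 by (intro diff_mono mult_left_mono) auto
  also have "\<dots> = shell_bound C e D s"
    by (simp add: shell_bound_def algebra_simps)
  finally show ?thesis .
qed

lemma integral_indicator_cball_3:
  assumes "R \<ge> 0"
  shows "integrable lebesgue (indicat_real (cball (0::real^3) R))"
    and "(\<integral>x. indicat_real (cball (0::real^3) R) x \<partial>lebesgue) = R ^ 3 * measure lborel (ball (0::real^3) 1)"
proof -
  have "emeasure lborel (cball (0::real^3) R) < \<infinity>" by (rule emeasure_lborel_cball_finite)
  then show "integrable lebesgue (indicat_real (cball (0::real^3) R))"
    by (intro integrable_real_indicator) auto
  show "(\<integral>x. indicat_real (cball (0::real^3) R) x \<partial>lebesgue) = R ^ 3 * measure lborel (ball (0::real^3) 1)"
    using measure_cball_3[OF assms] by simp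
qed

text \<open>
  The gain \<open>|x|\<^sup>-\<^sup>3\<close> has the same integral over every dyadic shell, the loss on each of the two transition shells does
  not depend on the scale: with sufficiently many shells between them the gain prevails.
\<close>

lemma negative_majorant:
  fixes C D :: real
  assumes D: "0 < D" "2 * D < 1"
  obtains e and U :: "real^3 \<Rightarrow> real" where "0 < e" "2 * e \<le> D" "integrable lebesgue U" "(\<integral>x. U x \<partial>lebesgue) < 0"
    "\<And>x. x \<notin> B1 \<Longrightarrow> U x = 0"
    "\<And>x. x \<noteq> 0 \<Longrightarrow> shell_bound C e D (x \<bullet> x) \<le> U x"
proof -
  have "\<exists>N. 512 / 5 * C\<^sup>2 < real N * (7 / 8)" by (rule reals_Archimedean3[rule_format]) simp
  then obtain N where N: "512 / 5 * C\<^sup>2 < real N * (7 / 8)" by blast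
  \<comment> \<open>The choice of \<open>e\<close> leaves room for \<open>N\<close> dyadic shells in \<open>2 e \<le> |x|\<^sup>2 \<le> D\<close>.\<close>
  define e where "e = D / (2 * 4 ^ N)"
  define \<delta> where "\<delta> = sqrt D"
  define c where "c = measure lborel (ball (0::real^3) 1)"
  let ?I = "\<lambda>R. indicat_real (cball (0::real^3) R)"
  let ?A = "\<lambda>E. 64 / 5 * C\<^sup>2 * (sqrt (2 * E) / E\<^sup>2)"
  define U where "U x = ?A e * ?I (sqrt (2 * e)) x + ?A D * ?I (sqrt (2 * D)) x
      - (\<Sum>j<N. (2 ^ j / \<delta>) ^ 3 * (?I (\<delta> / 2 ^ j) x - ?I (\<delta> / 2 ^ Suc j) x))" for x
  have e: "0 < e" "2 * e = D / 4 ^ N" "2 * e \<le> D" using D by (simp_all add: e_def divide_le_eq)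
  have \<delta>: "\<delta> > 0" "\<delta>\<^sup>2 = D" "\<delta> < 1" using D by (simp_all add: \<delta>_def)
  have c: "c > 0" unfolding c_def by (rule content_ball_pos) simp
  note I = integral_indicator_cball_3
  have intj: "integrable lebesgue (\<lambda>x. (2 ^ j / \<delta>) ^ 3 * (?I (\<delta> / 2 ^ j) x - ?I (\<delta> / 2 ^ Suc j) x))" for j
    using \<delta> by (intro integrable_mult_right Bochner_Integration.integrable_diff I(1)) auto
  have valj: "(\<integral>x. (2 ^ j / \<delta>) ^ 3 * (?I (\<delta> / 2 ^ j) x - ?I (\<delta> / 2 ^ Suc j) x) \<partial>lebesgue) = 7 / 8 * c" for j
  proof -
    have "(\<integral>x. (2 ^ j / \<delta>) ^ 3 * (?I (\<delta> / 2 ^ j) x - ?I (\<delta> / 2 ^ Suc j) x) \<partial>lebesgue)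
        = (2 ^ j / \<delta>) ^ 3 * ((\<delta> / 2 ^ j) ^ 3 * c - (\<delta> / 2 ^ Suc j) ^ 3 * c)"
      using I[of "\<delta> / 2 ^ j"] I[of "\<delta> / 2 ^ Suc j"] \<delta> by (simp add: c_def)
    also have "\<dots> = 7 / 8 * c" using \<delta> by (simp add: power_divide field_simps)
    finally show ?thesis .
  qed
  have intA: "integrable lebesgue (\<lambda>x. ?A E * ?I (sqrt (2 * E)) x)"
    and valA: "(\<integral>x. ?A E * ?I (sqrt (2 * E)) x \<partial>lebesgue) = 256 / 5 * C\<^sup>2 * c" if E: "E > 0" for E
  proof -
    have s: "sqrt (2 * E) \<ge> 0" using E by simp
    show "integrable lebesgue (\<lambda>x. ?A E * ?I (sqrt (2 * E)) x)" by (intro integrable_mult_right I(1)[OF s])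
    have "(\<integral>x. ?A E * ?I (sqrt (2 * E)) x \<partial>lebesgue) = ?A E * ((sqrt (2 * E)) ^ 3 * c)"
      unfolding Bochner_Integration.integral_mult_right_zero I(2)[OF s] c_def ..
    also have "\<dots> = 64 / 5 * C\<^sup>2 * ((sqrt (2 * E)) ^ 4 / E\<^sup>2) * c" by (simp add: power3_eq_cube power4_eq_xxxx)
    also have "(sqrt (2 * E)) ^ 4 = 4 * E\<^sup>2"
      using E power_mult[of "sqrt (2 * E)" 2 2] by (simp add: power_mult_distrib)
    finally show "(\<integral>x. ?A E * ?I (sqrt (2 * E)) x \<partial>lebesgue) = 256 / 5 * C\<^sup>2 * c" using E by simp
  qed
  have intU: "integrable lebesgue U"
    unfolding U_def by (intro Bochner_Integration.integrable_diff Bochner_Integration.integrable_add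
        Bochner_Integration.integrable_sum intA intj e D)
  have "(\<integral>x. U x \<partial>lebesgue) = 256 / 5 * C\<^sup>2 * c + 256 / 5 * C\<^sup>2 * c - (\<Sum>j<N. 7 / 8 * c)"
    unfolding U_def
    by (subst Bochner_Integration.integral_diff Bochner_Integration.integral_add Bochner_Integration.integral_sum,
        (intro Bochner_Integration.integrable_add Bochner_Integration.integrable_sum intA intj e D)+)+
      (simp only: valA[OF e(1)] valA[OF D(1)] valj)
  also have "\<dots> = (512 / 5 * C\<^sup>2 - real N * (7 / 8)) * c" by (simp add: algebra_simps)
  also have "\<dots> < 0" using N c by (intro mult_neg_pos) auto
  finally have negU: "(\<integral>x. U x \<partial>lebesgue) < 0" .
  have out: "?I R x = 0" if "x \<notin> B1" "R < 1" for x R using that by (auto simp: indicator_def)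
  have U0: "U x = 0" if x: "x \<notin> B1" for x
  proof -
    have small: "\<delta> / 2 ^ j < 1" for j
    proof -
      have "\<delta> / 2 ^ j \<le> \<delta> / 1" using \<delta> by (intro divide_left_mono) auto
      then show ?thesis using \<delta>(3) unfolding div_by_1 by (rule le_less_trans)
    qed
    have small': "sqrt (2 * e) < 1" "sqrt (2 * D) < 1"
      unfolding real_sqrt_lt_1_iff using e(3) D by linarith+
    show ?thesis unfolding U_def out[OF x small] out[OF x small'(1)] out[OF x small'(2)] by simp
  qed
  have ind: "?I (sqrt E) x = (if x \<bullet> x \<le> E then 1 else 0)" for E and x :: "real^3"
    by (simp add: indicator_def norm_eq_sqrt_inner)
  have shells: "(\<Sum>j<N. (2 ^ j / \<delta>) ^ 3 * (?I (\<delta> / 2 ^ j) x - ?I (\<delta> / 2 ^ Suc j) x))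
      \<le> (if 2 * e \<le> x \<bullet> x \<and> x \<bullet> x \<le> D then 1 / ((x \<bullet> x) * sqrt (x \<bullet> x)) else 0)" if x: "x \<noteq> 0" for x
  proof -
    define f where "f j = (2 ^ j / \<delta>) ^ 3 * (?I (\<delta> / 2 ^ j) x - ?I (\<delta> / 2 ^ Suc j) x)" for j :: nat
    have mono: "\<delta> / 2 ^ j \<le> \<delta> / 2 ^ i" if "i \<le> j" for i j :: nat
      using that \<delta> by (intro divide_left_mono power_increasing) auto
    have f0: "f j = 0" if "\<not> (\<delta> / 2 ^ Suc j < norm x \<and> norm x \<le> \<delta> / 2 ^ j)" for j
    proof -
      have "norm x \<le> \<delta> / 2 ^ Suc j \<longrightarrow> norm x \<le> \<delta> / 2 ^ j" using mono[of j "Suc j"] by simp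
      then have "?I (\<delta> / 2 ^ j) x = ?I (\<delta> / 2 ^ Suc j) x" using that by (auto simp: indicator_def simp del: power_Suc)
      then show ?thesis by (simp add: f_def)
    qed
    show ?thesis
    proof (cases "\<exists>j<N. \<delta> / 2 ^ Suc j < norm x \<and> norm x \<le> \<delta> / 2 ^ j")
      case False
      then have "(\<Sum>j<N. f j) = 0" by (intro sum.neutral) (auto intro!: f0)
      then show ?thesis unfolding f_def[symmetric] by simp
    next
      case True
      then obtain j where j: "j < N" "\<delta> / 2 ^ Suc j < norm x" "norm x \<le> \<delta> / 2 ^ j" by blast
      have "f i = 0" if "i \<noteq> j" for i
      proof (rule f0)
        show "\<not> (\<delta> / 2 ^ Suc i < norm x \<and> norm x \<le> \<delta> / 2 ^ i)"
          using mono[of "Suc i" j] mono[of "Suc j" i] j that by (cases "i < j") (auto simp del: power_Suc)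
      qed
      then have "(\<Sum>j<N. f j) = f j" using j(1) by (simp add: sum.remove[of _ j])
      also have "f j = (2 ^ j / \<delta>) ^ 3" using j by (simp add: f_def indicator_def del: power_Suc)
      also have "\<dots> \<le> (1 / norm x) ^ 3"
      proof (rule power_mono)
        have "1 / (\<delta> / 2 ^ j) \<le> 1 / norm x" using j(3) x \<delta> by (intro divide_left_mono) auto
        then show "2 ^ j / \<delta> \<le> 1 / norm x" by simp
      qed (use \<delta> in auto)
      also have "\<dots> = 1 / ((x \<bullet> x) * sqrt (x \<bullet> x))"
        by (simp add: norm_eq_sqrt_inner[symmetric] dot_square_norm power_divide power2_eq_square power3_eq_cube mult.assoc)
      finally have le: "(\<Sum>j<N. f j) \<le> 1 / ((x \<bullet> x) * sqrt (x \<bullet> x))" .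
      have "norm x \<le> \<delta>" using j(3) mono[of 0 j] by simp
      then have "(norm x)\<^sup>2 \<le> \<delta>\<^sup>2" by (intro power_mono) auto
      then have 1: "x \<bullet> x \<le> D" by (simp add: dot_square_norm \<delta>(2))
      have "\<delta> / 2 ^ N \<le> norm x" using mono[of "Suc j" N] j by simp
      then have "(\<delta> / 2 ^ N)\<^sup>2 \<le> (norm x)\<^sup>2" using \<delta> by (intro power_mono) auto
      moreover have "(\<delta> / 2 ^ N)\<^sup>2 = 2 * e"
        unfolding e(2) power_divide \<delta>(2) by (simp add: power_mult[symmetric] mult.commute[of N] power_mult)
      ultimately have 2: "2 * e \<le> x \<bullet> x" by (simp add: dot_square_norm)
      show ?thesis unfolding f_def[symmetric] using 1 2 le by simp
    qed
  qed
  show ?thesis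
  proof (rule that[OF e(1,3) intU negU U0])
    fix x :: "real^3" assume "x \<noteq> 0"
    from shells[OF this]
    show "shell_bound C e D (x \<bullet> x) \<le> U x"
      unfolding U_def ind shell_bound_def by (auto simp: algebra_simps)
  qed
qed

section \<open>Instability\<close>

text \<open>
  The trace is bounded below because \<open>hedgehog x\<close> has no eigenvalue below \<open>- sqrt (3/2) / 3\<close>.
\<close>

lemma potential_second_variation_bound:
  assumes v: "v \<in> S0" "norm v = 1" and x: "x \<noteq> 0"
  shows "- (2 * trace (hedgehog x ** v ** v) - (hedgehog x \<bullet> v)\<^sup>2 / sqrt 6 - 1 / sqrt 6) \<le> 2"
proof -
  have "sqrt (3 / 2) \<le> 5 / 4" by (rule real_le_lsqrt) (auto simp: power2_eq_square)
  moreover have "0 \<le> sqrt (3 / 2) * ((v *v x) \<bullet> (v *v x) / (x \<bullet> x))" by simp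
  ultimately have T: "- trace (hedgehog x ** v ** v) \<le> 5 / 12"
    unfolding trace_hedgehog_mult_square[OF v] right_diff_distrib by linarith
  have "\<bar>hedgehog x \<bullet> v\<bar> \<le> 1"
    using Cauchy_Schwarz_ineq2[of "hedgehog x" v] norm_hedgehog[OF x] v by simp
  then have B: "(hedgehog x \<bullet> v)\<^sup>2 \<le> 1" by (simp add: abs_square_le_1)
  have s6: "2 \<le> sqrt 6" by (rule real_le_rsqrt) simp
  have "(hedgehog x \<bullet> v)\<^sup>2 / sqrt 6 \<le> 1 / sqrt 6" using B by (intro divide_right_mono) auto
  moreover have "1 / sqrt 6 \<le> 1 / 2" using s6 by (intro divide_left_mono) auto
  ultimately show ?thesis using T by linarith
qed

text \<open>
  The second variation is at most the integral of the negative majorant, since the two remaining terms integrate to 0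
  by \<open>sphere_averages\<close>. The profile does not depend on \<open>v\<close>.
\<close>

lemma hedgehog_unstable:
  assumes lam: "0 \<le> lam"
  obtains \<xi> where "\<xi> \<in> C_c \<infinity> (B1 - {0}) UNIV" "radial \<xi>"
    "\<And>v. v \<in> S4 \<Longrightarrow> unstable_along lam hedgehog (\<lambda>x. \<xi> x *\<^sub>R v)"
proof -
  \<comment> \<open>The support shrinks with growing \<open>lam\<close>, so that the potential is controlled by the Hardy term.\<close>
  define D where "D = 1 / (4 * lam + 4)"
  have D: "0 < D" "2 * D < 1" "4 * lam * D \<le> 1" using lam by (auto simp: D_def divide_simps)
  obtain C where C: "\<And>t. \<bar>smooth_step' t\<bar> \<le> C" using smooth_step'_bounded by blast
  obtain e and U :: "real^3 \<Rightarrow> real" where e: "0 < e" "2 * e \<le> D" and intU: "integrable lebesgue U" and negU: "(\<integral>x. U x \<partial>lebesgue) < 0"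
    and U0: "\<And>x. x \<notin> B1 \<Longrightarrow> U x = 0"
    and U: "\<And>x. x \<noteq> 0 \<Longrightarrow> shell_bound C e D (x \<bullet> x) \<le> U x"
    using negative_majorant[OF D(1,2), of C] by metis
  let ?\<phi> = "profile e D" and ?\<phi>' = "profile' e D"
  define \<xi> where "\<xi> x = ?\<phi> (x \<bullet> x)" for x :: "real^3"
  define K where "K = {x::real^3. e \<le> x \<bullet> x \<and> x \<bullet> x \<le> 2 * D}"
  have K: "compact K" "K \<subseteq> B1 - {0}"
  proof -
    have sub: "K \<subseteq> B1"
    proof
      fix x assume "x \<in> K"
      then have "(norm x)\<^sup>2 < 1" using D by (simp add: K_def power2_norm_eq_inner)
      then show "x \<in> B1" by (simp add: power_less_one_iff)
    qed
    moreover have "0 \<notin> K" using e by (simp add: K_def)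
    ultimately show "K \<subseteq> B1 - {0}" by blast
    have "closed K" unfolding K_def
      by (intro closed_Collect_conj closed_Collect_le continuous_intros)
    moreover have "bounded K" by (rule bounded_subset[OF bounded_ball sub])
    ultimately show "compact K" by (simp add: compact_eq_bounded_closed)
  qed
  have \<xi>0: "\<xi> x = 0" if "x \<notin> K" for x
    using profile_eq_0[OF e(1) D(1), of "x \<bullet> x"] that by (auto simp: \<xi>_def K_def)
  have C\<xi>: "C_k_on k UNIV \<xi>" for k
    unfolding \<xi>_def[abs_def]
    by (intro C_k_on_compose[OF _ C_k_profile[OF e(1) D(1)]] C_k_on_inner C_k_on_ident open_UNIV)
  show ?thesis
  proof (rule that)
    show "\<xi> \<in> C_c \<infinity> (B1 - {0}) UNIV"
      by (rule C_c_infinityI[OF open_UNIV C\<xi> K(1) subset_UNIV K(2) \<xi>0]) auto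
    show "radial \<xi>" by (simp add: radial_def \<xi>_def dot_square_norm)
    fix v assume "v \<in> S4"
    then have v: "v \<in> S0" "norm v = 1" by (auto simp: S4_def)
    let ?\<Phi> = "\<lambda>x. \<xi> x *\<^sub>R v"
    have \<Phi>: "?\<Phi> \<in> C_c \<infinity> B1 S0"
    proof (rule C_c_infinityI[OF open_UNIV _ K(1) subset_UNIV])
      show "C_k_on k UNIV ?\<Phi>" for k by (intro C_k_on_scaleR C\<xi> C_k_on_const open_UNIV)
      show "\<xi> x *\<^sub>R v \<in> S0" for x
        using v(1) by (simp add: S0_def transpose_scalar trace_def sum_distrib_left[symmetric])
    qed (use K \<xi>0 in auto)
    then have \<Phi>1: "?\<Phi> \<in> C_c 1 B1 S0" using C_c_infinity_subset by blast
    let ?d2 = "\<lambda>x. second_variation_density lam ?\<Phi> x"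
    obtain e' where e': "\<forall>\<^sub>F t in nhds 0. ((\<lambda>s. energy lam (variation hedgehog ?\<Phi> s)) has_real_derivative e' t) (at t)"
      and e2: "(e' has_real_derivative (\<integral>x\<in>B1. ?d2 x \<partial>lebesgue)) (at 0)"
      and int: "set_integrable lebesgue B1 ?d2"
      using energy_hedgehog_variation[OF \<Phi>1, of lam] by blast
    have vS: "transpose v = v" "trace v = 0" "trace (v ** v) = 1"
      using v norm_S0[OF v(1)] by (auto simp: S0_def)
    define S where "S x = (v *v x) \<bullet> (v *v x)" for x
    define P where "P x = x \<bullet> (v *v x)" for x
    define G1 where "G1 s = 4 / 5 * (?\<phi>' s)\<^sup>2 * s powr 0 + (- 18 / 5) * (?\<phi> s)\<^sup>2 * s powr (- 2)" for s
    define G2 where "G2 s = 6 / 5 * (?\<phi>' s)\<^sup>2 * s powr (- 1) + (- 42 / 5) * (?\<phi> s)\<^sup>2 * s powr (- 3)" for s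
    have G0: "?\<phi> s = 0" "?\<phi>' s = 0" if "s \<ge> 1" for s
      using that D by (auto intro!: profile_eq_0 profile'_eq_0 e)
    have G: "C_k 1 G1" "C_k 1 G2" "\<And>s. s \<ge> 1 \<Longrightarrow> G1 s = 0" "\<And>s. s \<ge> 1 \<Longrightarrow> G2 s = 0"
      unfolding G1_def[abs_def] G2_def[abs_def]
      by (rule C_k_profile_weight[OF e(1) D(1)], rule C_k_profile_weight[OF e(1) D(1)]) (simp_all add: G0)
    have G': "\<And>s. s > 1 \<Longrightarrow> G1 s = 0" "\<And>s. s > 1 \<Longrightarrow> G2 s = 0" using G(3,4) by simp_all
    note A1 = sphere_averages(1,2)[OF G(1) G'(1) vS, folded S_def P_def]
    note A2 = sphere_averages(3,4)[OF G(2) G'(2) vS, folded S_def P_def]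
    let ?M = "\<lambda>x. U x + G1 (x \<bullet> x) * (x \<bullet> x - 3 * S x) + G2 (x \<bullet> x) * (2 * (x \<bullet> x) * S x - 5 * (P x)\<^sup>2)"
    have le: "indicator B1 x *\<^sub>R ?d2 x \<le> ?M x" if x: "x \<noteq> 0" for x
    proof (cases "x \<in> B1")
      case False
      then have "1 \<le> norm x" by simp
      then have "1 \<le> x \<bullet> x" unfolding dot_square_norm by (rule one_le_power)
      then show ?thesis using False U0[OF False] G(3,4) by simp
    next
      case True
      define \<rho> where "\<rho> = x \<bullet> x"
      have \<rho>: "\<rho> > 0" using x by (simp add: \<rho>_def)
      have pw: "\<rho> powr 0 = 1" "\<rho> powr (- 2) = 1 / \<rho>\<^sup>2" "\<rho> powr (- 1) = 1 / \<rho>" "\<rho> powr (- 3) = 1 / \<rho> ^ 3"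
        using \<rho> by (simp_all add: powr_minus_divide)
      have G1: "G1 \<rho> = 4 / 5 * (?\<phi>' \<rho>)\<^sup>2 - 18 / 5 * (?\<phi> \<rho>)\<^sup>2 / \<rho>\<^sup>2"
        and G2: "G2 \<rho> = 6 / 5 * (?\<phi>' \<rho>)\<^sup>2 / \<rho> - 42 / 5 * (?\<phi> \<rho>)\<^sup>2 / \<rho> ^ 3"
        unfolding G1_def G2_def pw by simp_all
      let ?T = "2 * trace (hedgehog x ** v ** v) - (hedgehog x \<bullet> v)\<^sup>2 / sqrt 6 - 1 / sqrt 6"
      have "lam * (?\<phi> \<rho>)\<^sup>2 * (- ?T) \<le> lam * (?\<phi> \<rho>)\<^sup>2 * 2"
        using potential_second_variation_bound[OF v x] lam by (intro mult_left_mono) auto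
      then have T: "- (lam * (?\<phi> \<rho>)\<^sup>2 * ?T) \<le> 2 * lam * (?\<phi> \<rho>)\<^sup>2" by (simp only: mult_minus_right mult_ac)
      have "?d2 x = 16 / 5 * \<rho> * (?\<phi>' \<rho>)\<^sup>2 - 12 / 5 * (?\<phi> \<rho>)\<^sup>2 / \<rho> + G1 \<rho> * (\<rho> - 3 * S x) + G2 \<rho> * (2 * \<rho> * S x - 5 * (P x)\<^sup>2)
          - lam * (?\<phi> \<rho>)\<^sup>2 * ?T"
        unfolding G1 G2 unfolding \<xi>_def[abs_def] S_def P_def \<rho>_def
        by (rule edensity_d2_radial[OF v x profile_has_derivative[OF e(1) D(1)]])
      also have "\<dots> \<le> (16 / 5 * \<rho> * (?\<phi>' \<rho>)\<^sup>2 - 12 / 5 * (?\<phi> \<rho>)\<^sup>2 / \<rho> + 2 * lam * (?\<phi> \<rho>)\<^sup>2) + G1 \<rho> * (\<rho> - 3 * S x) + G2 \<rho> * (2 * \<rho> * S x - 5 * (P x)\<^sup>2)"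
        using T by linarith
      also have "\<dots> \<le> U x + G1 \<rho> * (\<rho> - 3 * S x) + G2 \<rho> * (2 * \<rho> * S x - 5 * (P x)\<^sup>2)"
        using order_trans[OF profile_bound[OF e lam D(3) \<rho> C] U[OF x, folded \<rho>_def]] by linarith
      finally show ?thesis using True by (simp add: \<rho>_def)
    qed
    have "(\<integral>x\<in>B1. ?d2 x \<partial>lebesgue) \<le> (\<integral>x. ?M x \<partial>lebesgue)"
      unfolding set_lebesgue_integral_def
    proof (rule integral_mono_AE)
      show "AE x in lebesgue. indicator B1 x *\<^sub>R ?d2 x \<le> ?M x"
        using AE_lebesgue_neq_0 by eventually_elim (rule le)
    qed (use int intU A1 A2 in \<open>auto simp: set_integrable_def\<close>)
    also have "\<dots> = (\<integral>x. U x \<partial>lebesgue)" using intU A1 A2 by simp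
    also have "\<dots> < 0" by (rule negU)
    finally have "(\<integral>x\<in>B1. ?d2 x \<partial>lebesgue) < 0" .
    moreover have "has_second_variation lam ?\<Phi> hedgehog (\<integral>x\<in>B1. ?d2 x \<partial>lebesgue)"
      unfolding has_second_variation_def using \<Phi> e' e2 by blast
    ultimately show "unstable_along lam hedgehog ?\<Phi>"
      unfolding unstable_along_def by blast
  qed
qed

theorem proposition4p7:
  shows "(\<exists>\<xi>. \<xi> \<in> C_c \<infinity> (B1 - {0}) UNIV \<and> radial \<xi> \<and>
            (\<forall>v\<in>S4. critical_point 0 hedgehog \<and> unstable_along 0 hedgehog (\<lambda>x. \<xi> x *\<^sub>R v))) \<and>
         (\<forall>lam>0. \<exists>\<xi>. \<xi> \<in> C_c \<infinity> (B1 - {0}) UNIV \<and> radial \<xi> \<and>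
            (\<forall>v\<in>S4. critical_point lam hedgehog \<and> unstable_along lam hedgehog (\<lambda>x. \<xi> x *\<^sub>R v)))"
proof -
  have "\<exists>\<xi>. \<xi> \<in> C_c \<infinity> (B1 - {0}) UNIV \<and> radial \<xi> \<and>
      (\<forall>v\<in>S4. critical_point lam hedgehog \<and> unstable_along lam hedgehog (\<lambda>x. \<xi> x *\<^sub>R v))" if "0 \<le> lam" for lam
    using hedgehog_unstable[OF that] critical_point_hedgehog by metis
  then show ?thesis by simp
qed

end
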